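(* Let $n\ge 1$ and let $(K,(I^k)_k,(J^k)_k,g,q)$ be a finite two-player zero-sum stochastic game with state set $K=\{1,\dots,n\}$ and finite state-dependent action sets. Fix a discount factor $\lambda\in(0,1]$ and a state $1\le k\le n$, and let $v_\lambda=(v^1_\lambda,\dots,v^n_\lambda)$ be the vector of $\lambda$-discounted values. For each state $\ell$ let $\dot I^\ell\subset I^\ell$, $\dot J^\ell\subset J^\ell$ be the sets of rows and columns of a Shapley-Snow kernel of the local game $\mathcal G^\ell(\lambda,v_\lambda)$, and let $\dot\Delta^0,\dots,\dot\Delta^n$ be the auxiliary matrices of the corresponding reduced array $\dot D(\lambda)$. Let $E^k$ be the finite set of polynomials defined in the context. Then: (i) $v^k_\lambda$ is the unique $w\in\mathbb R$ satisfying $\mathrm{val}\big((-1)^n(\dot\Delta^k-w\dot\Delta^0)\big)=0$. (ii) $\mathrm{rank}(\dot\Delta^k-v^k_\lambda\dot\Delta^0)<\max_{w\in\mathbb R}\mathrm{rank}(\dot\Delta^k-w\dot\Delta^0)$. (iii) There exists $P^k\in E^k$ such that $P^k(\lambda,v^k_\lambda)=0$. (iv) If all the stage payoffs $g(\ell,i,j)$, all the transition probabilities $q(\ell'|\ell,i,j)$ and the discount factor $\lambda$ are rational, then $v^k_\lambda$ is an algebraic number of degree (over $\mathbb Q$) at most $\mathrm{rank}(\dot\Delta^0)$.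
   Context: **Matrix games.** A real $p\times m$ matrix $A$ is identified with the zero-sum game in which Player 1 (maximizer) chooses rows and Player 2 (minimizer) chooses columns; mixed strategies $x,y$ are column probability vectors, the expected payoff is ${}^{t}x A y$ and $\mathrm{val}(A)=\max_x\min_y {}^{t}xAy=\min_y\max_x{}^{t}xAy$. **Cofactors.** For a square matrix $M$, $\mathrm{co}(M)$ is its cofactor matrix, with $(i,j)$ entry $(-1)^{i+j}$ times the determinant of $M$ with row $i$ and column $j$ deleted ($\mathrm{co}(M)=1$ for $1\times1$ matrices); $S(M)$ is the sum of the entries of $M$; $\mathbf 1$ is a column vector of ones and $U$ a matrix of ones, of the appropriate dimensions. **Shapley-Snow kernel.** Let $G$ be a matrix game. A basic solution is an extreme point $(x,y)$ of the set of pairs of optimal strategies. A Shapley-Snow kernel of $G$ is a square sub-matrix $\dot G$ of $G$ such that, for some basic solution $(x,y)$, with $\dot x,\dot y$ the restrictions of $x,y$ to the row and column indices of $\dot G$: (1) $S(\mathrm{co}(\dot G))\ne0$; (2) $\dot x=\frac{\mathrm{co}(\dot G)}{S(\mathrm{co}(\dot G))}\mathbf 1$ and $\dot y=\frac{{}^{t}\mathrm{co}(\dot G)}{S(\mathrm{co}(\dot G))}\mathbf 1$; (3) $\mathrm{val}(G)=\mathrm{val}(\dot G)=\frac{\det\dot G}{S(\mathrm{co}(\dot G))}$; (4) ${}^{t}\dot x\dot G=\mathrm{val}(G)\,{}^{t}\mathbf 1$ and $\dot G\dot y=\mathrm{val}(G)\mathbf 1$. (By Shapley and Snow (1950), every matrix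 game has one, and (1)-(2) imply (3)-(4).) **Stochastic game.** $I^k$ and $J^k$ are finite nonempty action sets of Players 1 and 2 in state $k$; for $(i,j)\in I^k\times J^k$, $g(k,i,j)\in\mathbb R$ is the stage payoff and $q(\cdot|k,i,j)$ is a probability on $K$. At each stage $m\ge1$ the players, knowing the current state $k_m$, simultaneously choose $i_m\in I^{k_m}$, $j_m\in J^{k_m}$; the next state is drawn from $q(\cdot|k_m,i_m,j_m)$. From initial state $k$, Player 1 maximizes and Player 2 minimizes the expectation of $\sum_{m\ge1}\lambda(1-\lambda)^{m-1}g(k_m,i_m,j_m)$. This game has a value $v^k_\lambda$ (the max-min equals the min-max over stationary mixed strategies). For $z\in\mathbb R^n$, the local game $\mathcal G^k(\lambda,z)$ is the $I^k\times J^k$ matrix with entries $\lambda g(k,i,j)+(1-\lambda)\sum_{\ell=1}^n q(\ell|k,i,j)z^\ell$. By Shapley (1953), $v_\lambda$ is the unique $z\in\mathbb R^n$ with $z^k=\mathrm{val}(\mathcal G^k(\lambda,z))$ for all $k$. **Data array.** For $1\le k\le n$, $0\le\ell\le n$ define $I^k\times J^k$ matrices $M^k_\ell$ by $M^k_0=\lambda(g(k,i,j))_{i,j}$, $M^k_k=(1-\lambda)(q(k|k,i,j))_{i,j}-U$, and $M^k_\ell=(1-\lambda)(q(\ell|k,i,j))_{i,j}$ for $\ell\ge1$, $\ell\neq k$. Then $D(\lambda)$ is the $n\times(n+1)$ array of matrices $(M^k_\ell)$, $1\le k\le n$, $0\le\ell\le n$. **Kronecker determinant and auxiliary matrices.**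 For an $n\times n$ array $(A^k_\ell)$ of matrices in which matrices on the same row $k$ have the same size, $\det_\otimes(A^k_\ell)=\sum_{\sigma}\epsilon(\sigma)A^1_{\sigma(1)}\otimes\cdots\otimes A^n_{\sigma(n)}$, the sum being over permutations $\sigma$ of $\{1,\dots,n\}$, with $\epsilon(\sigma)$ the signature and $\otimes$ the Kronecker product. The auxiliary matrices of an $n\times(n+1)$ array with columns indexed $0,\dots,n$ are $\Delta^\ell=(-1)^\ell\det_\otimes D^{(\ell)}$, $0\le\ell\le n$, where $D^{(\ell)}$ is the array with the column indexed $\ell$ removed. $\Delta^0,\dots,\Delta^n$ denote the auxiliary matrices of $D(\lambda)$. The reduced array $\dot D(\lambda)=(\dot M^k_\ell)$ consists of the $\dot I^k\times\dot J^k$ sub-matrices $\dot M^k_\ell$ of $M^k_\ell$; its auxiliary matrices $\dot\Delta^0,\dots,\dot\Delta^n$ are square, of equal size $\prod_k|\dot I^k|$, and are sub-matrices of $\Delta^0,\dots,\Delta^n$. **The set $E^k$.** Each square sub-matrix of $\Delta^k-w\Delta^0$ (given by a choice of rows and columns) has a determinant that is a polynomial in the discount factor and $w$. For the fixed $\lambda$ and the chosen kernels, $E^k$ is the finite set of those determinants $P$ such that $w\mapsto P(\lambda,w)$ is not identically zero and has degree at most $\mathrm{rank}(\dot\Delta^0)$. *)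

theory Defs
  imports
    "HOL-Probability.Projective_Family"
    "HOL-Probability.Probability_Mass_Function"
    "HOL-Computational_Algebra.Polynomial_Factorial"
    "Jordan_Normal_Form.Determinant"
    "Jordan_Normal_Form.DL_Rank"
    "Jordan_Normal_Form.DL_Submatrix"
begin

unbundle no vec_syntax
unbundle no inner_syntax

section \<open>Matrix games\<close>

definition mixed :: "nat \<Rightarrow> real vec set" where
  "mixed p = {x \<in> carrier_vec p. (\<forall>i<p. 0 \<le> x $ i) \<and> (\<Sum>i<p. x $ i) = 1}"

definition game_payoff :: "real mat \<Rightarrow> real vec \<Rightarrow> real vec \<Rightarrow> real" where
  "game_payoff A x y = x \<bullet> (A *\<^sub>v y)"

text \<open>The supremum and the infimum are attained, by compactness, whenever the matrix has at least
  one row and one column.\<close>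

definition game_val :: "real mat \<Rightarrow> real" where
  "game_val A = (SUP x\<in>mixed (dim_row A). INF y\<in>mixed (dim_col A). game_payoff A x y)"

definition optimal_pairs :: "real mat \<Rightarrow> (real vec \<times> real vec) set" where
  "optimal_pairs A = {(x, y).
     x \<in> mixed (dim_row A) \<and> (\<forall>y'\<in>mixed (dim_col A). game_val A \<le> game_payoff A x y') \<and>
     y \<in> mixed (dim_col A) \<and> (\<forall>x'\<in>mixed (dim_row A). game_payoff A x' y \<le> game_val A)}"

text \<open>Extreme points are spelled out because the type of vectors of variable dimension is not an
  instance of \<open>real_vector\<close>.\<close>

definition basic_solution :: "real mat \<Rightarrow> real vec \<Rightarrow> real vec \<Rightarrow> bool" where
  "basic_solution A x y \<longleftrightarrow> (x, y) \<in> optimal_pairs A \<and>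
     (\<forall>(x1, y1)\<in>optimal_pairs A. \<forall>(x2, y2)\<in>optimal_pairs A. \<forall>t::real.
        0 < t \<and> t < 1 \<and>
        x = (1 - t) \<cdot>\<^sub>v x1 + t \<cdot>\<^sub>v x2 \<and> y = (1 - t) \<cdot>\<^sub>v y1 + t \<cdot>\<^sub>v y2 \<longrightarrow>
        (x1, y1) = (x2, y2))"

definition cofactor_mat :: "'a::comm_ring_1 mat \<Rightarrow> 'a mat" where
  "cofactor_mat M = mat (dim_row M) (dim_col M) (\<lambda>(i, j). cofactor M i j)"

definition entry_sum :: "'a::comm_ring_1 mat \<Rightarrow> 'a" where
  "entry_sum M = (\<Sum>i<dim_row M. \<Sum>j<dim_col M. M $$ (i, j))"

definition ones :: "nat \<Rightarrow> real vec" where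
  "ones r = vec r (\<lambda>_. 1)"

definition restrict_vec :: "'a vec \<Rightarrow> nat set \<Rightarrow> 'a vec" where
  "restrict_vec x I = vec (card I) (\<lambda>i. x $ pick I i)"

definition shapley_snow_kernel :: "real mat \<Rightarrow> nat set \<Rightarrow> nat set \<Rightarrow> bool" where
  "shapley_snow_kernel A I J \<longleftrightarrow>
     I \<subseteq> {..<dim_row A} \<and> J \<subseteq> {..<dim_col A} \<and> card I = card J \<and>
     (\<exists>x y. basic_solution A x y \<and>
        (let B = submatrix A I J; C = cofactor_mat B; s = entry_sum C; r = card I;
             x' = restrict_vec x I; y' = restrict_vec y J
         in s \<noteq> 0 \<and>
            x' = (1 / s) \<cdot>\<^sub>v (C *\<^sub>v ones r) \<and> y' = (1 / s) \<cdot>\<^sub>v (transpose_mat C *\<^sub>v ones r) \<and>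
            game_val A = game_val B \<and> game_val B = det B / s \<and>
            transpose_mat B *\<^sub>v x' = game_val A \<cdot>\<^sub>v ones r \<and> B *\<^sub>v y' = game_val A \<cdot>\<^sub>v ones r))"

section \<open>Stochastic games\<close>

text \<open>The states are \<open>1, \<dots>, n\<close>; the actions available to the two players in state \<open>k\<close> are
  \<open>0, \<dots>, num_rows k - 1\<close> and \<open>0, \<dots>, num_cols k - 1\<close>. The fields are irrelevant outside these
  ranges.\<close>

record stoch_game =
  nstates :: nat
  num_rows :: "nat \<Rightarrow> nat"
  num_cols :: "nat \<Rightarrow> nat"
  stage_payoff :: "nat \<Rightarrow> nat \<Rightarrow> nat \<Rightarrow> real"
  trans_law :: "nat \<Rightarrow> nat \<Rightarrow> nat \<Rightarrow> nat pmf"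

definition stochastic_game :: "stoch_game \<Rightarrow> bool" where
  "stochastic_game G \<longleftrightarrow> 1 \<le> nstates G \<and>
     (\<forall>k\<in>{1..nstates G}. 0 < num_rows G k \<and> 0 < num_cols G k \<and>
        (\<forall>i<num_rows G k. \<forall>j<num_cols G k. set_pmf (trans_law G k i j) \<subseteq> {1..nstates G}))"

definition stationary :: "nat \<Rightarrow> (nat \<Rightarrow> nat) \<Rightarrow> (nat \<Rightarrow> nat pmf) set" where
  "stationary n a = {x. \<forall>k\<in>{1..n}. set_pmf (x k) \<subseteq> {..<a k}}"

text \<open>A play is a sequence of triples (state, row action, column action), and its coordinate \<open>m\<close>
  describes stage \<open>m + 1\<close>. The law of the play is the Ionescu-Tulcea measure generated by the
  laws of the successive triples given the past.\<close>

definition stage_law ::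
    "(nat \<Rightarrow> nat pmf) \<Rightarrow> (nat \<Rightarrow> nat pmf) \<Rightarrow> nat \<Rightarrow> (nat \<times> nat \<times> nat) pmf" where
  "stage_law x y k = map_pmf (\<lambda>(i, j). (k, i, j)) (pair_pmf (x k) (y k))"

definition play_kernel ::
    "stoch_game \<Rightarrow> (nat \<Rightarrow> nat pmf) \<Rightarrow> (nat \<Rightarrow> nat pmf) \<Rightarrow> nat \<Rightarrow>
     nat \<Rightarrow> (nat \<Rightarrow> nat \<times> nat \<times> nat) \<Rightarrow> (nat \<times> nat \<times> nat) measure" where
  "play_kernel G x y k m \<omega> = measure_pmf
     (case m of
        0 \<Rightarrow> stage_law x y k
      | Suc m' \<Rightarrow> (case \<omega> m' of (l, i, j) \<Rightarrow> bind_pmf (trans_law G l i j) (stage_law x y)))"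

lemma play_kernel_Ionescu_Tulcea:
  "Ionescu_Tulcea (play_kernel G x y k) (\<lambda>_. count_space UNIV)"
proof (rule Ionescu_Tulcea.intro)
  fix m :: nat
  let ?M = "\<lambda>_::nat. count_space (UNIV :: (nat \<times> nat \<times> nat) set)"
  have *: "measure_pmf p \<in> space (subprob_algebra (count_space UNIV))"
    for p :: "(nat \<times> nat \<times> nat) pmf"
    by (rule measure_pmf_in_subprob_algebra)
  show "play_kernel G x y k m \<in> measurable (PiM {0..<m} ?M) (subprob_algebra (?M m))"
  proof (cases m)
    case 0
    have "(\<lambda>_. measure_pmf (stage_law x y k)) \<in>
        measurable (PiM {0..<m} ?M) (subprob_algebra (count_space UNIV))"
      using * by (rule measurable_const)
    then show ?thesis
      by (simp add: play_kernel_def[abs_def] 0)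
  next
    case (Suc m')
    let ?f = "\<lambda>t. measure_pmf (case t of (l, i, j) \<Rightarrow> bind_pmf (trans_law G l i j) (stage_law x y))"
    have "(\<lambda>\<omega>. \<omega> m') \<in> measurable (PiM {0..<m} ?M) (count_space UNIV)"
      using measurable_component_singleton[of m' "{0..<m}" ?M] Suc by simp
    moreover have "?f \<in> measurable (count_space UNIV) (subprob_algebra (count_space UNIV))"
      using * by simp
    ultimately have "(\<lambda>\<omega>. ?f (\<omega> m')) \<in>
        measurable (PiM {0..<m} ?M) (subprob_algebra (count_space UNIV))"
      by (rule measurable_compose)
    then show ?thesis
      by (simp add: play_kernel_def[abs_def] Suc)
  qed
next
  fix m :: nat and \<omega> :: "nat \<Rightarrow> nat \<times> nat \<times> nat"
  show "prob_space (play_kernel G x y k m \<omega>)"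
    by (simp add: play_kernel_def measure_pmf.prob_space_axioms)
qed

definition play_law ::
    "stoch_game \<Rightarrow> (nat \<Rightarrow> nat pmf) \<Rightarrow> (nat \<Rightarrow> nat pmf) \<Rightarrow> nat \<Rightarrow>
     (nat \<Rightarrow> nat \<times> nat \<times> nat) measure" where
  "play_law G x y k =
     projective_family.lim UNIV
       (Ionescu_Tulcea.CI (play_kernel G x y k) (\<lambda>_. count_space UNIV)) (\<lambda>_. count_space UNIV)"

definition discounted_payoff ::
    "stoch_game \<Rightarrow> real \<Rightarrow> (nat \<Rightarrow> nat pmf) \<Rightarrow> (nat \<Rightarrow> nat pmf) \<Rightarrow> nat \<Rightarrow> real" where
  "discounted_payoff G lam x y k =
     (\<integral>\<omega>. (\<Sum>m. lam * (1 - lam) ^ m * (case \<omega> m of (l, i, j) \<Rightarrow> stage_payoff G l i j))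
        \<partial>play_law G x y k)"

definition discounted_value :: "stoch_game \<Rightarrow> real \<Rightarrow> nat \<Rightarrow> real" where
  "discounted_value G lam k =
     (SUP x\<in>stationary (nstates G) (num_rows G). INF y\<in>stationary (nstates G) (num_cols G).
        discounted_payoff G lam x y k)"

definition local_game :: "stoch_game \<Rightarrow> real \<Rightarrow> (nat \<Rightarrow> real) \<Rightarrow> nat \<Rightarrow> real mat" where
  "local_game G lam z k = mat (num_rows G k) (num_cols G k)
     (\<lambda>(i, j). lam * stage_payoff G k i j +
        (1 - lam) * (\<Sum>l\<in>{1..nstates G}. pmf (trans_law G k i j) l * z l))"

section \<open>Kronecker determinants and the data array\<close>

definition kron :: "'a::comm_ring_1 mat \<Rightarrow> 'a mat \<Rightarrow> 'a mat" where
  "kron A B = mat (dim_row A * dim_row B) (dim_col A * dim_col B)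
     (\<lambda>(i, j). A $$ (i div dim_row B, j div dim_col B) * B $$ (i mod dim_row B, j mod dim_col B))"

definition kron_list :: "'a::comm_ring_1 mat list \<Rightarrow> 'a mat" where
  "kron_list As = foldr kron As (1\<^sub>m 1)"

text \<open>Arrays have rows indexed by \<open>1, \<dots>, n\<close>; the columns of a square array are indexed by
  \<open>1, \<dots>, n\<close>, those of an \<open>n \<times> (n + 1)\<close> array by \<open>0, \<dots>, n\<close>. All matrices in a row \<open>k\<close> have the
  same size, so the dimensions may be read off the diagonal.\<close>

definition kron_det :: "nat \<Rightarrow> (nat \<Rightarrow> nat \<Rightarrow> 'a::comm_ring_1 mat) \<Rightarrow> 'a mat" where
  "kron_det n A = mat (\<Prod>k\<in>{1..n}. dim_row (A k k)) (\<Prod>k\<in>{1..n}. dim_col (A k k))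
     (\<lambda>(i, j). \<Sum>\<sigma> | \<sigma> permutes {1..n}.
        of_int (sign \<sigma>) * kron_list (map (\<lambda>k. A k (\<sigma> k)) [1..<Suc n]) $$ (i, j))"

definition remove_col :: "nat \<Rightarrow> (nat \<Rightarrow> nat \<Rightarrow> 'a mat) \<Rightarrow> nat \<Rightarrow> nat \<Rightarrow> 'a mat" where
  "remove_col l D k j = D k (if j \<le> l then j - 1 else j)"

definition aux_mat :: "nat \<Rightarrow> (nat \<Rightarrow> nat \<Rightarrow> 'a::comm_ring_1 mat) \<Rightarrow> nat \<Rightarrow> 'a mat" where
  "aux_mat n D l = (-1) ^ l \<cdot>\<^sub>m kron_det n (remove_col l D)"

text \<open>The data array over a commutative ring, where \<open>emb\<close> embeds the real data of the game and
  \<open>lam\<close> is the element standing for the discount factor.\<close>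

definition data_array ::
    "(real \<Rightarrow> 'a::comm_ring_1) \<Rightarrow> 'a \<Rightarrow> stoch_game \<Rightarrow> nat \<Rightarrow> nat \<Rightarrow> 'a mat" where
  "data_array emb lam G k l = mat (num_rows G k) (num_cols G k)
     (\<lambda>(i, j).
        if l = 0 then lam * emb (stage_payoff G k i j)
        else (1 - lam) * emb (pmf (trans_law G k i j) l) - (if l = k then 1 else 0))"

definition reduced_array ::
    "(nat \<Rightarrow> nat set) \<Rightarrow> (nat \<Rightarrow> nat set) \<Rightarrow> (nat \<Rightarrow> nat \<Rightarrow> 'a mat) \<Rightarrow> nat \<Rightarrow> nat \<Rightarrow> 'a mat" where
  "reduced_array I J D k l = submatrix (D k l) (I k) (J k)"

definition reduced_aux ::
    "stoch_game \<Rightarrow> real \<Rightarrow> (nat \<Rightarrow> nat set) \<Rightarrow> (nat \<Rightarrow> nat set) \<Rightarrow> nat \<Rightarrow> real mat" where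
  "reduced_aux G lam I J l =
     aux_mat (nstates G) (reduced_array I J (data_array (\<lambda>a. a) lam G)) l"

definition mat_rank :: "real mat \<Rightarrow> nat" where
  "mat_rank A = vec_space.rank (dim_row A) A"

text \<open>Bivariate polynomials have type \<open>real poly poly\<close>: the outer variable is \<open>w\<close>, and the inner
  one is the discount factor.\<close>

definition symbolic_pencil :: "stoch_game \<Rightarrow> nat \<Rightarrow> real poly poly mat" where
  "symbolic_pencil G k =
     (let D = data_array (\<lambda>a. [:[:a:]:]) [:[:0, 1:]:] G
      in aux_mat (nstates G) D k - [:0, 1:] \<cdot>\<^sub>m aux_mat (nstates G) D 0)"

definition specialize :: "real \<Rightarrow> real poly poly \<Rightarrow> real poly" where
  "specialize lam P = map_poly (\<lambda>c. poly c lam) P"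

definition minor_polys ::
    "stoch_game \<Rightarrow> real \<Rightarrow> (nat \<Rightarrow> nat set) \<Rightarrow> (nat \<Rightarrow> nat set) \<Rightarrow> nat \<Rightarrow> real poly poly set" where
  "minor_polys G lam I J k =
     {P. (\<exists>R C. R \<noteq> {} \<and> R \<subseteq> {..<dim_row (symbolic_pencil G k)} \<and>
               C \<subseteq> {..<dim_col (symbolic_pencil G k)} \<and> card R = card C \<and>
               P = det (submatrix (symbolic_pencil G k) R C)) \<and>
         specialize lam P \<noteq> 0 \<and>
         degree (specialize lam P) \<le> mat_rank (reduced_aux G lam I J 0)}"

section \<open>Algebraic numbers\<close>

text \<open>The degree is that of the minimal polynomial over the rationals.\<close>

definition algebraic_of_degree :: "real \<Rightarrow> nat \<Rightarrow> bool" where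
  "algebraic_of_degree a d \<longleftrightarrow>
     (\<exists>p::rat poly. irreducible p \<and> lead_coeff p = 1 \<and> poly (map_poly of_rat p) a = 0 \<and>
        degree p = d)"

end

theory Submission
  imports Defs "Jordan_Normal_Form.Char_Poly" "Jordan_Normal_Form.DL_Rank_Submatrix"
begin

text \<open>
  Write \<open>v\<close> for the vector of discounted values. By Shapley's theorem
  (\<open>discounted_value_fixed_point\<close>) the number \<open>v\<^sup>l\<close> is the value of the local game at \<open>v\<close>, and a
  Shapley-Snow kernel of that local game provides mixed strategies \<open>x\<^sup>l\<close>, \<open>y\<^sup>l\<close> on its
  rows and columns that make the opponent indifferent inside the kernel. In terms of the reduced array this
  reads: \<open>x\<^sup>l\<close> and \<open>y\<^sup>l\<close> annihilate \<open>M\<^sup>l\<^sub>0 + v\<^sup>1 M\<^sup>l\<^sub>1 + \<dots> + v\<^sup>n M\<^sup>l\<^sub>n\<close> from the left and from the right.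

  Each entry of an auxiliary matrix \<open>\<Delta>\<^sup>l\<close> is a signed maximal minor of an \<open>n \<times> (n + 1)\<close> array of
  numbers (\<open>aux_mat_entries\<close>). As determinants are linear in each row, multiplying \<open>\<Delta>\<^sup>l\<close> by the
  product strategy \<open>x = x\<^sup>1 \<otimes> \<dots> \<otimes> x\<^sup>n\<close> amounts to averaging every row of that array
  (\<open>sum_signed_minor_digits\<close>), and the averaged array has the vector \<open>(1, v)\<close> in its kernel.
  Cramer's rule (\<open>signed_minor_cramer\<close>) then gives \<open>x \<Delta>\<^sup>k = v\<^sup>k x \<Delta>\<^sup>0\<close>, and \<open>\<Delta>\<^sup>k y = v\<^sup>k \<Delta>\<^sup>0 y\<close> in the
  same way. Moreover \<open>(-1)\<^sup>n \<Delta>\<^sup>0\<close> is entrywise positive, its entries being determinants of the form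
  \<open>det (1 - (1 - \<lambda>) Q)\<close> with \<open>Q\<close> stochastic. The locale \<open>balanced_pencil\<close> collects these facts, and
  \<open>balanced_pencil_reduced_aux\<close> establishes them.

  The four claims are consequences. (i) In the game \<open>(-1)\<^sup>n (\<Delta>\<^sup>k - w \<Delta>\<^sup>0)\<close> the strategies
  \<open>x\<close> and \<open>y\<close> yield \<open>v\<^sup>k - w\<close> times a positive amount against every pure strategy, so the value has
  the sign of \<open>v\<^sup>k - w\<close>. (ii) The matrix \<open>N = \<Delta>\<^sup>k - v\<^sup>k \<Delta>\<^sup>0\<close> satisfies \<open>x N = 0\<close> and \<open>N y = 0\<close>, whereas
  \<open>x \<Delta>\<^sup>0 y\<close> is not zero. Hence a maximal invertible minor of \<open>N\<close>, bordered by \<open>x\<close> and \<open>y\<close>, becomes an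
  invertible matrix of larger size after a small move along \<open>\<Delta>\<^sup>0\<close> (\<open>pencil_rank_increases\<close>).
  (iii) A nonzero minor of the largest possible size of the pencil \<open>\<Delta>\<^sup>k - w \<Delta>\<^sup>0\<close> vanishes at
  \<open>w = v\<^sup>k\<close> because of (ii), and its degree in \<open>w\<close> is at most the rank of \<open>\<Delta>\<^sup>0\<close>
  (\<open>degree_det_low_rank_pencil\<close>); it is a minor of the unreduced pencil since the embedding of row
  tuples is increasing. (iv) With rational data, that minor has rational coefficients.
\<close>

section \<open>Rank, minors and matrix pencils\<close>

lemma mult_mat_zero_vec:
  "A \<in> carrier_mat nr nc \<Longrightarrow> A *\<^sub>v 0\<^sub>v nc = (0\<^sub>v nr :: 'a::comm_ring_1 vec)"
  by (intro eq_vecI) auto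

lemma bij_betw_pick:
  assumes "finite S"
  shows "bij_betw (pick S) {..<card S} S"
proof (rule bij_betw_imageI)
  show inj: "inj_on (pick S) {..<card S}"
    by (rule inj_onI) (metis lessThan_iff linorder_neqE_nat nat_less_le pick_mono_le)
  have "pick S ` {..<card S} \<subseteq> S"
    by (auto simp: pick_in_set_le)
  then show "pick S ` {..<card S} = S"
    by (metis assms card_image card_lessThan card_subset_eq inj)
qed

text \<open>A maximal independent set of columns spans the column space. Recording column indices, instead of
  column vectors, turns the rank into a statement about submatrices.\<close>

lemma col_skeleton:
  fixes A :: "'a::field mat"
  assumes A: "A \<in> carrier_mat nr nc"
  shows "\<exists>C V. C \<subseteq> {..<nc} \<and> card C = vec_space.rank nr A \<and> V \<in> carrier_mat (card C) nc \<and>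
    A = submatrix A UNIV C * V \<and>
    (\<forall>v\<in>carrier_vec (card C). submatrix A UNIV C *\<^sub>v v = 0\<^sub>v nr \<longrightarrow> v = 0\<^sub>v (card C))"
proof -
  interpret vec_space "TYPE('a)" nr .
  obtain S where max: "maximal S (\<lambda>T. T \<subseteq> set (cols A) \<and> lin_indpt T)"
    using maximal_exists[of "(\<lambda>T. T \<subseteq> set (cols A) \<and> lin_indpt T)" "card (set (cols A))" "{}"]
    by (meson List.finite_set card_mono empty_iff empty_subsetI finite_lin_indpt2 rev_finite_subset)
  have rk: "rank A = card S"
    by (rule rank_card_indpt[OF A max])
  have S: "S \<subseteq> set (cols A)" "lin_indpt S" using max by (auto simp: maximal_def)
  have Sc: "S \<subseteq> carrier_vec nr" using S(1) A cols_dim by blast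
  have finS: "finite S" using S(1) finite_subset by blast
  define idx where "idx s = (SOME j. j < nc \<and> col A j = s)" for s
  have idx: "idx s < nc" "col A (idx s) = s" if "s \<in> S" for s
  proof -
    have "\<exists>j. j < nc \<and> col A j = s"
      using that S(1) A by (force simp: cols_def)
    from someI_ex[OF this] show "idx s < nc" "col A (idx s) = s" by (auto simp: idx_def)
  qed
  define C where "C = idx ` S"
  have finC: "finite C" using finS by (simp add: C_def)
  have "inj_on idx S" by (rule inj_onI) (metis idx(2))
  then have cardC: "card C = card S" by (simp add: C_def card_image)
  have Csub: "C \<subseteq> {..<nc}" using idx by (auto simp: C_def)
  have Cset: "{j. j < nc \<and> j \<in> C} = C" using Csub by auto
  define U where "U = submatrix A UNIV C"
  have U: "U \<in> carrier_mat nr (card C)"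
    using A by (auto simp: U_def submatrix_def Cset)
  have colU: "col U j = col A (pick C j)" if "j < card C" for j
  proof (rule eq_vecI)
    have p: "pick C j < nc" using pick_in_set_le[of j C] that Csub by auto
    show "dim_vec (col U j) = dim_vec (col A (pick C j))" using U A by auto
    fix i assume "i < dim_vec (col A (pick C j))"
    then have i: "i < nr" using A by auto
    show "col U j $ i = col A (pick C j) $ i"
      using A U p i that by (simp add: U_def submatrix_def Cset pick_UNIV)
  qed
  note bij = bij_betw_pick[OF finC]
  have "set (cols U) = (\<lambda>j. col U j) ` {..<card C}"
    using U by (auto simp: cols_def)
  also have "\<dots> = col A ` pick C ` {..<card C}" using colU by (auto simp: image_image)
  also have "\<dots> = col A ` C" using bij by (simp add: bij_betw_def)
  also have "\<dots> = S" using idx by (force simp: C_def image_image)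
  finally have setU: "set (cols U) = S" .
  have "card (set (cols U)) = length (cols U)" using setU cardC U by simp
  then have dist: "distinct (cols U)" by (rule card_distinct)
  have inj: "v = 0\<^sub>v (card C)" if "v \<in> carrier_vec (card C)" "U *\<^sub>v v = 0\<^sub>v nr" for v
    using lin_depI[OF U that(1) _ that(2) dist] S(2) setU by auto
  have "\<exists>w\<in>carrier_vec (card C). col A j = U *\<^sub>v w" if j: "j < nc" for j
  proof -
    have cA: "col A j \<in> set (cols A)" "col A j \<in> carrier_vec nr"
      using A j by (auto simp: cols_def)
    have "col A j \<in> span S"
    proof (cases "col A j \<in> S")
      case True then show ?thesis using span_mem[OF Sc] by auto
    next
      case False
      have "\<not> lin_indpt (S \<union> {col A j})"
      proof
        assume "lin_indpt (S \<union> {col A j})"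
        then have "S \<union> {col A j} \<subseteq> S"
          using max cA S(1) by (auto simp: maximal_def)
        then show False using False by auto
      qed
      then show ?thesis
        using lin_dep_iff_in_span[OF Sc S(2) cA(2) False] by auto
    qed
    then obtain a where "col A j = lincomb a (set (cols U))"
      using finite_span[OF finS Sc] setU by auto
    then have "col A j = U *\<^sub>v vec (card C) (\<lambda>i. a (col U i))"
      using mat_mult_eq_lincomb[OF U dist, of a] by simp
    then show ?thesis by (intro bexI) auto
  qed
  then obtain w where w: "\<And>j. j < nc \<Longrightarrow> w j \<in> carrier_vec (card C) \<and> col A j = U *\<^sub>v w j"
    by metis
  define V where "V = mat (card C) nc (\<lambda>(i, j). w j $ i)"
  have V: "V \<in> carrier_mat (card C) nc" by (simp add: V_def)
  have "A = U * V"
  proof (rule mat_col_eqI)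
    fix j assume "j < dim_col (U * V)"
    then have j: "j < nc" using V by simp
    have "col V j = w j" using w[OF j] j by (auto simp: V_def)
    then show "col A j = col (U * V) j"
      using w[OF j] col_mult2[OF U V j] by simp
  qed (use A U V in auto)
  then show ?thesis
    using Csub cardC rk V inj unfolding U_def by (intro exI[of _ C] exI[of _ V]) auto
qed

lemma rank_factorization:
  fixes A :: "'a::field mat"
  assumes A: "A \<in> carrier_mat nr nc"
  shows "\<exists>U V. U \<in> carrier_mat nr (vec_space.rank nr A) \<and> V \<in> carrier_mat (vec_space.rank nr A) nc \<and> A = U * V"
proof -
  obtain C V where C: "C \<subseteq> {..<nc}" "card C = vec_space.rank nr A"
    and V: "V \<in> carrier_mat (card C) nc" and AV: "A = submatrix A UNIV C * V"
    using col_skeleton[OF A] by blast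
  have "{j. j < nc \<and> j \<in> C} = C" using C by auto
  then have "submatrix A UNIV C \<in> carrier_mat nr (card C)"
    using A by (auto simp: submatrix_def)
  then show ?thesis using C V AV by metis
qed

text \<open>Zero rows complete the matrix to a singular square one.\<close>

lemma wide_kernel:
  fixes X :: "'a::field mat"
  assumes X: "X \<in> carrier_mat a b" and "a < b"
  shows "\<exists>v\<in>carrier_vec b. v \<noteq> 0\<^sub>v b \<and> X *\<^sub>v v = 0\<^sub>v a"
proof -
  define Y where "Y = mat b b (\<lambda>(i, j). if i < a then X $$ (i, j) else 0)"
  have Y: "Y \<in> carrier_mat b b" by (simp add: Y_def)
  have "det Y = (\<Sum>j<b. Y $$ (a, j) * cofactor Y a j)"
    by (rule laplace_expansion_row[OF Y \<open>a < b\<close>])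
  also have "\<dots> = 0" using \<open>a < b\<close> by (auto simp: Y_def)
  finally obtain v where v: "v \<in> carrier_vec b" "v \<noteq> 0\<^sub>v b" "Y *\<^sub>v v = 0\<^sub>v b"
    using det_0_iff_vec_prod_zero_field[OF Y] by auto
  have "X *\<^sub>v v = 0\<^sub>v a"
  proof (rule eq_vecI)
    fix i assume "i < dim_vec (0\<^sub>v a)"
    then have i: "i < a" "i < b" using \<open>a < b\<close> by auto
    have "row Y i = row X i" using i X by (auto simp: Y_def)
    then have "(X *\<^sub>v v) $ i = (Y *\<^sub>v v) $ i" using i X Y by simp
    then show "(X *\<^sub>v v) $ i = 0\<^sub>v a $ i" using i by (simp add: v(3))
  qed (use X in auto)
  then show ?thesis using v by auto
qed

text \<open>If the rank of \<open>M\<close> were smaller than \<open>s\<close>, then \<open>X * M * Z\<close> would factor through a space of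
  dimension less than \<open>s\<close>.\<close>

lemma rank_ge_of_minor_product:
  fixes M :: "'a::field mat"
  assumes X: "X \<in> carrier_mat s nr" and M: "M \<in> carrier_mat nr nc" and Z: "Z \<in> carrier_mat nc s"
    and det: "det (X * M * Z) \<noteq> 0"
  shows "s \<le> vec_space.rank nr M"
proof (rule ccontr)
  assume "\<not> ?thesis"
  then have lt: "vec_space.rank nr M < s" by simp
  obtain U V where V: "V \<in> carrier_mat (vec_space.rank nr M) nc"
    and U: "U \<in> carrier_mat nr (vec_space.rank nr M)" and MUV: "M = U * V"
    using rank_factorization[OF M] by blast
  have VZ: "V * Z \<in> carrier_mat (vec_space.rank nr M) s" using V Z by simp
  obtain v where v: "v \<in> carrier_vec s" "v \<noteq> 0\<^sub>v s" "(V * Z) *\<^sub>v v = 0\<^sub>v (vec_space.rank nr M)"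
    using wide_kernel[OF VZ lt] by auto
  have XU: "X * U \<in> carrier_mat s (vec_space.rank nr M)" using X U by simp
  have "X * M * Z = (X * U) * (V * Z)"
    unfolding MUV using assoc_mult_mat[OF X U V] assoc_mult_mat[OF XU V Z] by simp
  then have "(X * M * Z) *\<^sub>v v = (X * U) *\<^sub>v ((V * Z) *\<^sub>v v)"
    using XU VZ v(1) by (simp add: assoc_mult_mat_vec)
  then have "(X * M * Z) *\<^sub>v v = 0\<^sub>v s"
    using v(3) mult_mat_zero_vec[OF XU] by simp
  moreover have "X * M * Z \<in> carrier_mat s s" using X M Z by simp
  ultimately show False using det v det_0_iff_vec_prod_zero_field by blast
qed

text \<open>A skeleton of the transpose selects rows of \<open>U\<close>. It cannot select fewer than \<open>r\<close> of them: \<open>U\<close>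
  would factor through a space of smaller dimension and fail to be injective.\<close>

lemma injective_minor_exists:
  fixes U :: "'a::field mat"
  assumes U: "U \<in> carrier_mat nr r"
    and inj: "\<And>v. v \<in> carrier_vec r \<Longrightarrow> U *\<^sub>v v = 0\<^sub>v nr \<Longrightarrow> v = 0\<^sub>v r"
  shows "\<exists>R \<subseteq> {..<nr}. card R = r \<and> det (submatrix U R UNIV) \<noteq> 0"
proof -
  define T where "T = transpose_mat U"
  have T: "T \<in> carrier_mat r nr" using U by (simp add: T_def)
  obtain R V where R: "R \<subseteq> {..<nr}" and V: "V \<in> carrier_mat (card R) nr"
    and TV: "T = submatrix T UNIV R * V"
    and injT: "\<forall>v\<in>carrier_vec (card R). submatrix T UNIV R *\<^sub>v v = 0\<^sub>v r \<longrightarrow> v = 0\<^sub>v (card R)"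
    using col_skeleton[OF T] by blast
  have Rset: "{j. j < nr \<and> j \<in> R} = R" using R by auto
  define W where "W = submatrix T UNIV R"
  have W: "W \<in> carrier_mat r (card R)" using T Rset by (auto simp: W_def submatrix_def)
  have "\<not> card R < r"
  proof
    assume lt: "card R < r"
    have Wt: "transpose_mat W \<in> carrier_mat (card R) r" using W by simp
    obtain v where v: "v \<in> carrier_vec r" "v \<noteq> 0\<^sub>v r" "transpose_mat W *\<^sub>v v = 0\<^sub>v (card R)"
      using wide_kernel[OF Wt lt] by auto
    have "U = transpose_mat (W * V)" using TV by (simp add: T_def W_def)
    also have "\<dots> = transpose_mat V * transpose_mat W" by (rule transpose_mult[OF W V])
    finally have "U *\<^sub>v v = transpose_mat V *\<^sub>v (transpose_mat W *\<^sub>v v)"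
      using V W v(1) by (simp add: assoc_mult_mat_vec[of _ nr "card R" _ r])
    then have "U *\<^sub>v v = 0\<^sub>v nr" using v(3) mult_mat_zero_vec[of "transpose_mat V" nr "card R"] V by simp
    then show False using inj v by blast
  qed
  moreover have "\<not> r < card R"
    using wide_kernel[OF W] injT unfolding W_def by blast
  ultimately have cR: "card R = r" by simp
  have "det W \<noteq> 0"
    using det_0_iff_vec_prod_zero_field[of W r] W injT cR unfolding W_def by auto
  moreover have "submatrix U R UNIV = transpose_mat W"
  proof (rule eq_matI)
    fix i j assume "i < dim_row (transpose_mat W)" "j < dim_col (transpose_mat W)"
    then have ij: "i < card R" "j < r" using W cR by auto
    have "pick R i < nr" using pick_in_set_le[of i R] ij R by auto
    then show "submatrix U R UNIV $$ (i, j) = transpose_mat W $$ (i, j)"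
      using ij U Rset cR by (simp add: W_def T_def submatrix_def pick_UNIV)
  qed (use U W Rset cR in \<open>auto simp: submatrix_def\<close>)
  moreover have "det (transpose_mat W) = det W"
    using det_transpose[of W r] W cR by simp
  ultimately show ?thesis using R cR by auto
qed

lemma rank_minor_exists:
  fixes A :: "'a::field mat"
  assumes A: "A \<in> carrier_mat nr nc"
  shows "\<exists>R C. R \<subseteq> {..<nr} \<and> C \<subseteq> {..<nc} \<and> card R = vec_space.rank nr A \<and>
    card C = vec_space.rank nr A \<and> det (submatrix A R C) \<noteq> 0"
proof -
  obtain C V where C: "C \<subseteq> {..<nc}" "card C = vec_space.rank nr A"
    and inj: "\<forall>v\<in>carrier_vec (card C). submatrix A UNIV C *\<^sub>v v = 0\<^sub>v nr \<longrightarrow> v = 0\<^sub>v (card C)"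
    using col_skeleton[OF A] by blast
  have Cset: "{j. j < nc \<and> j \<in> C} = C" using C by auto
  have U: "submatrix A UNIV C \<in> carrier_mat nr (card C)"
    using A Cset by (auto simp: submatrix_def)
  obtain R where R: "R \<subseteq> {..<nr}" "card R = card C" "det (submatrix (submatrix A UNIV C) R UNIV) \<noteq> 0"
    using injective_minor_exists[OF U] inj by blast
  then show ?thesis
    using C submatrix_split[of A R C] by (intro exI[of _ R] exI[of _ C]) auto
qed

text \<open>The matrix \<open>A + w U V\<close> is the Schur complement of the identity block in the matrix with blocks
  \<open>A\<close>, \<open>- w U\<close>, \<open>V\<close>, \<open>1\<close>, where the indeterminate \<open>w\<close> occurs only in the last \<open>r\<close> columns.\<close>

lemma degree_det_low_rank_pencil:
  fixes A :: "'a::field mat"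
  assumes A: "A \<in> carrier_mat s s" and U: "U \<in> carrier_mat s r" and V: "V \<in> carrier_mat r s"
  shows "degree (det (mat s s (\<lambda>(i, j). [:A $$ (i, j), (U * V) $$ (i, j):]))) \<le> r"
proof -
  define c :: "'a mat \<Rightarrow> 'a poly mat" where "c = map_mat (\<lambda>a. [:a:])"
  interpret h: comm_ring_hom "\<lambda>a::'a. [:a:]" by unfold_locales auto
  define wU where "wU = mat s r (\<lambda>(i, j). [:0, U $$ (i, j):])"
  have wU: "wU \<in> carrier_mat s r" by (simp add: wU_def)
  define T where "T = four_block_mat (c A) (- wU) (c V) (1\<^sub>m r)"
  define E where "E = four_block_mat (1\<^sub>m s) (0\<^sub>m s r) (- c V) (1\<^sub>m r)"
  define Q where "Q = mat s s (\<lambda>(i, j). [:A $$ (i, j), (U * V) $$ (i, j):])"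
  have cA: "c A \<in> carrier_mat s s" and cV: "c V \<in> carrier_mat r s" using A V by (auto simp: c_def)
  have T: "T \<in> carrier_mat (s + r) (s + r)" using cA by (auto simp: T_def)
  have E: "E \<in> carrier_mat (s + r) (s + r)" by (auto simp: E_def)
  have wUV: "wU * c V = mat s s (\<lambda>(i, j). [:0, (U * V) $$ (i, j):])"
  proof (rule eq_matI)
    fix i j assume ij: "i < dim_row (mat s s (\<lambda>(i, j). [:0, (U * V) $$ (i, j):]))"
      "j < dim_col (mat s s (\<lambda>(i, j). [:0, (U * V) $$ (i, j):]))"
    then have ij: "i < s" "j < s" by auto
    have "(wU * c V) $$ (i, j) = (\<Sum>k = 0..<r. [:0, U $$ (i, k):] * [:V $$ (k, j):])"
      using ij wU cV U V by (simp add: scalar_prod_def wU_def c_def)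
    also have "\<dots> = [:0, \<Sum>k = 0..<r. U $$ (i, k) * V $$ (k, j):]"
      by (induction r) (auto simp: mult.commute)
    also have "\<dots> = [:0, (U * V) $$ (i, j):]"
      using ij U V by (simp add: scalar_prod_def)
    finally show "(wU * c V) $$ (i, j) = mat s s (\<lambda>(i, j). [:0, (U * V) $$ (i, j):]) $$ (i, j)"
      using ij by simp
  qed (use wU cV in auto)
  have "T * E = four_block_mat (c A * 1\<^sub>m s + (- wU) * (- c V)) (c A * 0\<^sub>m s r + (- wU) * 1\<^sub>m r)
     (c V * 1\<^sub>m s + 1\<^sub>m r * (- c V)) (c V * 0\<^sub>m s r + 1\<^sub>m r * 1\<^sub>m r)"
    unfolding T_def E_def
    by (rule mult_four_block_mat) (use cA cV wU in auto)
  also have "\<dots> = four_block_mat Q (- wU) (0\<^sub>m r s) (1\<^sub>m r)"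
  proof -
    have "c A * 1\<^sub>m s + (- wU) * (- c V) = Q"
      using cA cV wU A by (simp, subst wUV) (auto simp: Q_def c_def)
    moreover have "c A * 0\<^sub>m s r + (- wU) * 1\<^sub>m r = - wU" using cA wU by auto
    moreover have "c V * 1\<^sub>m s + 1\<^sub>m r * (- c V) = 0\<^sub>m r s" using cV by auto
    moreover have "c V * 0\<^sub>m s r + 1\<^sub>m r * 1\<^sub>m r = 1\<^sub>m r" using cV by auto
    ultimately show ?thesis by simp
  qed
  finally have TE: "T * E = four_block_mat Q (- wU) (0\<^sub>m r s) (1\<^sub>m r)" .
  have "det (T * E) = det Q"
    unfolding TE by (subst det_four_block_mat_lower_left_zero[of _ s _ r]) (use wU in \<open>auto simp: Q_def\<close>)
  moreover have "det E = 1"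
    unfolding E_def by (subst det_four_block_mat_upper_right_zero[of _ s _ r]) (use cV in auto)
  ultimately have detQ: "det Q = det T" using det_mult[OF T E] by simp
  have deg: "degree (T $$ (i, j)) \<le> (if s \<le> j then 1 else 0)" if "i < s + r" "j < s + r" for i j
    using that cA cV wU A V by (auto simp: T_def c_def wU_def one_mat_def)
  have "degree (signof p * (\<Prod>i = 0..<s + r. T $$ (i, p i))) \<le> r" if p: "p permutes {0..<s + r}" for p
  proof -
    have pl: "p i < s + r" if "i < s + r" for i using permutes_in_image[OF p, of i] that by auto
    have "degree (signof p * (\<Prod>i = 0..<s + r. T $$ (i, p i))) \<le> degree (\<Prod>i = 0..<s + r. T $$ (i, p i))"
      by (auto simp: sign_def)
    also have "\<dots> \<le> (\<Sum>i = 0..<s + r. degree (T $$ (i, p i)))"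
      using degree_prod_sum_le[of "{0..<s + r}" "\<lambda>i. T $$ (i, p i)"] by (simp add: o_def)
    also have "\<dots> \<le> (\<Sum>i = 0..<s + r. if s \<le> p i then 1 else 0)"
      by (intro sum_mono deg) (auto simp: pl)
    also have "\<dots> = (\<Sum>i = 0..<s + r. if s \<le> i then 1 else 0)"
      using sum.permute[OF p, of "\<lambda>i. if s \<le> i then 1 else 0::nat"] by (simp add: o_def)
    also have "\<dots> = card {s..<s + r}"
    proof -
      have "{i \<in> {0..<s + r}. s \<le> i} = {s..<s + r}" by auto
      then show ?thesis by (subst sum.inter_filter[symmetric]) auto
    qed
    also have "\<dots> = r" by simp
    finally show ?thesis .
  qed
  then have "degree (det T) \<le> r"
    unfolding det_def'[OF T] by (intro degree_sum_le) (auto simp: finite_permutations)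
  then show ?thesis using detQ by (simp add: Q_def)
qed

text \<open>Choose an invertible minor of \<open>N\<close> of the maximal size \<open>r\<close> and border it by the row \<open>x\<close> and the
  column \<open>y\<close>. In the corresponding bordered matrix of \<open>N + t B\<close> the last row is divisible by \<open>t\<close>, as
  \<open>x N = 0\<close>. After division by \<open>t\<close>, the last column at \<open>t = 0\<close> has \<open>x B y\<close> as its only nonzero
  entry, as \<open>N y = 0\<close>. So the determinant is not zero at \<open>t = 0\<close>, nor at small \<open>t\<close>.\<close>

lemma pencil_rank_increases:
  fixes N B :: "real mat"
  assumes N: "N \<in> carrier_mat m m" and B: "B \<in> carrier_mat m m"
    and x: "x \<in> carrier_vec m" and y: "y \<in> carrier_vec m"
    and xN: "transpose_mat N *\<^sub>v x = 0\<^sub>v m" and Ny: "N *\<^sub>v y = 0\<^sub>v m"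
    and xBy: "x \<bullet> (B *\<^sub>v y) \<noteq> 0"
  shows "\<exists>t. vec_space.rank m N < vec_space.rank m (N + t \<cdot>\<^sub>m B)"
proof -
  define r where "r = vec_space.rank m N"
  obtain R C where R: "R \<subseteq> {..<m}" "card R = r" and C: "C \<subseteq> {..<m}" "card C = r"
    and det0: "det (submatrix N R C) \<noteq> 0"
    using rank_minor_exists[OF N] unfolding r_def by blast
  have Rset: "{j. j < m \<and> j \<in> R} = R" "{j. j < m \<and> j \<in> C} = C" using R C by auto
  have pR: "pick R a < m" if "a < r" for a using pick_in_set_le[of a R] that R by auto
  have pC: "pick C a < m" if "a < r" for a using pick_in_set_le[of a C] that C by auto
  define X where "X = mat_of_rows m (map (\<lambda>a. if a < r then unit_vec m (pick R a) else x) [0..<Suc r])"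
  define Z where "Z = mat_of_cols m (map (\<lambda>a. if a < r then unit_vec m (pick C a) else y) [0..<Suc r])"
  have X: "X \<in> carrier_mat (Suc r) m" unfolding X_def by (rule carrier_matI) (simp_all del: upt_Suc)
  have Z: "Z \<in> carrier_mat m (Suc r)" unfolding Z_def by (rule carrier_matI) (simp_all del: upt_Suc)
  have rowX: "row X a = (if a < r then unit_vec m (pick R a) else x)" if "a < Suc r" for a
    using that x unfolding X_def by (subst mat_of_rows_row) (auto simp del: upt_Suc)
  have colZ: "col Z a = (if a < r then unit_vec m (pick C a) else y)" if "a < Suc r" for a
    using that y unfolding Z_def by (subst col_mat_of_cols) (auto simp del: upt_Suc)
  have ent: "(X * M * Z) $$ (a, b) = row X a \<bullet> (M *\<^sub>v col Z b)"
    if "M \<in> carrier_mat m m" "a < Suc r" "b < Suc r" for M a b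
  proof -
    have "X * M * Z = X * (M * Z)" by (rule assoc_mult_mat[OF X that(1) Z])
    then have "(X * M * Z) $$ (a, b) = row X a \<bullet> col (M * Z) b" using X Z that by simp
    then show ?thesis using col_mult2[OF that(1) Z that(3)] by simp
  qed
  \<comment> \<open>the bordered matrix with its last row divided by \<open>t\<close>\<close>
  define H where "H t = mat (Suc r) (Suc r) (\<lambda>(a, b). if a = r then (X * B * Z) $$ (r, b)
     else (X * N * Z) $$ (a, b) + t * (X * B * Z) $$ (a, b))" for t
  have Hc: "H t \<in> carrier_mat (Suc r) (Suc r)" for t by (simp add: H_def)
  have XNr: "(X * N * Z) $$ (r, b) = 0" if "b < Suc r" for b
  proof -
    have c: "col Z b \<in> carrier_vec m" using Z by auto
    have "x \<bullet> (N *\<^sub>v col Z b) = (transpose_mat N *\<^sub>v x) \<bullet> col Z b"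
      using transpose_vec_mult_scalar[OF N c x] by simp
    then show ?thesis using ent[OF N _ that, of r] rowX[of r] xN c by simp
  qed
  have NZr: "(X * N * Z) $$ (a, r) = 0" if "a < Suc r" for a
    using ent[OF N that, of r] colZ[of r] rowX[OF that] X Ny x pR by auto
  have sub: "(X * N * Z) $$ (a, b) = submatrix N R C $$ (a, b)" if "a < r" "b < r" for a b
  proof -
    have "(X * N * Z) $$ (a, b) = unit_vec m (pick R a) \<bullet> (N *\<^sub>v unit_vec m (pick C b))"
      using ent[OF N, of a b] rowX[of a] colZ[of b] that by simp
    also have "\<dots> = (N *\<^sub>v unit_vec m (pick C b)) $ pick R a"
      using pR[OF that(1)] N by (intro scalar_prod_left_unit) auto
    also have "\<dots> = row N (pick R a) \<bullet> unit_vec m (pick C b)" using N pR[OF that(1)] by simp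
    also have "\<dots> = N $$ (pick R a, pick C b)"
      using N pR[OF that(1)] pC[OF that(2)] by (subst scalar_prod_right_unit) auto
    finally show ?thesis using that N R C Rset by (simp add: submatrix_def)
  qed
  have "det (H 0) = (\<Sum>i<Suc r. H 0 $$ (i, r) * cofactor (H 0) i r)"
    by (rule laplace_expansion_column[OF Hc]) simp
  also have "\<dots> = H 0 $$ (r, r) * cofactor (H 0) r r"
    by (simp add: H_def NZr)
  also have "mat_delete (H 0) r r = submatrix N R C"
    using N R C Rset sub by (intro eq_matI) (auto simp: H_def mat_delete_def dim_submatrix)
  then have "cofactor (H 0) r r = det (submatrix N R C)" by (simp add: cofactor_def)
  also have "H 0 $$ (r, r) = x \<bullet> (B *\<^sub>v y)"
    using ent[OF B, of r r] rowX[of r] colZ[of r] by (simp add: H_def)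
  finally have H0: "det (H 0) \<noteq> 0" using det0 xBy by simp
  have "continuous_on UNIV (\<lambda>t. det (H t))"
    unfolding det_def'[OF Hc]
  proof (intro continuous_intros)
    fix p i assume p: "p \<in> {p. p permutes {0..<Suc r}}" and i: "i \<in> {0..<Suc r}"
    then have "i < Suc r" "p i < Suc r" using permutes_in_image[of p "{0..<Suc r}" i] by auto
    then show "continuous_on UNIV (\<lambda>t. H t $$ (i, p i))"
      by (cases "i = r") (simp_all add: H_def continuous_intros)
  qed
  then have "isCont (\<lambda>t. det (H t)) 0"
    using continuous_on_eq_continuous_at by blast
  then have "eventually (\<lambda>t. det (H t) \<noteq> 0) (at 0)"
    using H0 by (auto simp: isCont_def intro: tendsto_imp_eventually_ne)
  moreover have "eventually (\<lambda>t::real. t \<noteq> 0) (at 0)" by (simp add: eventually_at_filter)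
  ultimately have "eventually (\<lambda>t. det (H t) \<noteq> 0 \<and> t \<noteq> 0) (at (0::real))" by eventually_elim simp
  then obtain t where t: "det (H t) \<noteq> 0" "t \<noteq> 0"
    using eventually_happens[of _ "at (0::real)"] by (auto simp: trivial_limit_at)
  have XZ: "X * (N + t \<cdot>\<^sub>m B) * Z = X * N * Z + t \<cdot>\<^sub>m (X * B * Z)"
  proof -
    have "X * (N + t \<cdot>\<^sub>m B) = X * N + t \<cdot>\<^sub>m (X * B)"
      using X N B by (simp add: mult_add_distrib_mat[of X "Suc r" m] mult_smult_distrib[of _ "Suc r" m])
    then show ?thesis
      using X N B Z add_mult_distrib_mat[of "X * N" "Suc r" m "t \<cdot>\<^sub>m (X * B)" Z "Suc r"]
        mult_smult_assoc_mat[of "X * B" "Suc r" m Z "Suc r" t] by simp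
  qed
  have "X * (N + t \<cdot>\<^sub>m B) * Z = multrow r t (H t)"
    unfolding XZ using X N B Z XNr by (intro eq_matI) (auto simp: H_def)
  then have "det (X * (N + t \<cdot>\<^sub>m B) * Z) = t * det (H t)"
    using det_multrow[OF _ Hc] by simp
  then have "Suc r \<le> vec_space.rank m (N + t \<cdot>\<^sub>m B)"
    using rank_ge_of_minor_product[OF X _ Z, of "N + t \<cdot>\<^sub>m B"] t B N by simp
  then show ?thesis by (auto simp: r_def Suc_le_eq)
qed

section \<open>Kronecker products in mixed radix\<close>

text \<open>Mixed radix expansion with bases \<open>ds\<close>, the most significant digit first: this is the order in
  which \<open>kron_list\<close> combines the indices of its factors.\<close>

primrec digits :: "nat list \<Rightarrow> nat \<Rightarrow> nat list" where
  "digits [] i = []"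
| "digits (d # ds) i = (i div prod_list ds) # digits ds (i mod prod_list ds)"

lemma length_digits [simp]: "length (digits ds i) = length ds"
  by (induction ds arbitrary: i) auto

lemma digits_less:
  "i < prod_list ds \<Longrightarrow> s < length ds \<Longrightarrow> digits ds i ! s < ds ! s"
proof (induction ds arbitrary: i s)
  case (Cons d ds)
  have pos: "0 < prod_list ds" using Cons.prems(1) by (cases "prod_list ds") auto
  show ?case
  proof (cases s)
    case 0
    then show ?thesis using Cons.prems(1) by (simp add: less_mult_imp_div_less)
  next
    case (Suc s')
    then show ?thesis using Cons pos by simp
  qed
qed simp

lemma sum_lessThan_mult:
  fixes f :: "nat \<Rightarrow> nat \<Rightarrow> 'a::comm_monoid_add"
  shows "(\<Sum>i<d * m. f (i div m) (i mod m)) = (\<Sum>a<d. \<Sum>b<m. f a b)"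
proof -
  have "(\<Sum>i<d * m. f (i div m) (i mod m)) = (\<Sum>(a, b)\<in>{..<d} \<times> {..<m}. f a b)"
  proof (rule sum.reindex_bij_witness[of _ "\<lambda>(a, b). a * m + b" "\<lambda>i. (i div m, i mod m)"])
    fix i assume "i \<in> {..<d * m}"
    then show "(i div m, i mod m) \<in> {..<d} \<times> {..<m}"
      by (cases "m = 0") (auto simp: less_mult_imp_div_less)
  next
    fix p assume p: "p \<in> {..<d} \<times> {..<m}"
    then obtain a b where ab: "p = (a, b)" "a < d" "b < m" by auto
    have "a * m + b < Suc a * m" using ab by simp
    also have "\<dots> \<le> d * m" using ab by (intro mult_right_mono) auto
    finally show "(case p of (a, b) \<Rightarrow> a * m + b) \<in> {..<d * m}" using ab by simp
  qed auto
  then show ?thesis by (simp add: sum.cartesian_product)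
qed

text \<open>The general distributive law: the digits run exactly once through all tuples bounded by \<open>ds\<close>.\<close>

lemma sum_prod_digits:
  fixes f :: "nat \<Rightarrow> nat \<Rightarrow> 'a::comm_semiring_1"
  shows "(\<Sum>i<prod_list ds. \<Prod>s<length ds. f s (digits ds i ! s)) = (\<Prod>s<length ds. \<Sum>a<ds ! s. f s a)"
proof (induction ds arbitrary: f)
  case (Cons d ds)
  have "(\<Sum>i<prod_list (d # ds). \<Prod>s<length (d # ds). f s (digits (d # ds) i ! s)) =
     (\<Sum>i<d * prod_list ds. f 0 (i div prod_list ds) *
        (\<Prod>s<length ds. f (Suc s) (digits ds (i mod prod_list ds) ! s)))"
    by (simp add: prod.lessThan_Suc_shift del: prod.lessThan_Suc)
  also have "\<dots> = (\<Sum>a<d. \<Sum>b<prod_list ds. f 0 a * (\<Prod>s<length ds. f (Suc s) (digits ds b ! s)))"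
    by (rule sum_lessThan_mult)
  also have "\<dots> = (\<Sum>a<d. f 0 a) * (\<Prod>s<length ds. \<Sum>a<ds ! s. f (Suc s) a)"
    by (simp add: sum_product Cons.IH[symmetric])
  also have "\<dots> = (\<Prod>s<length (d # ds). \<Sum>a<(d # ds) ! s. f s a)"
    by (simp add: prod.lessThan_Suc_shift del: prod.lessThan_Suc)
  finally show ?case .
qed simp

lemma kron_list_Cons: "kron_list (A # As) = kron A (kron_list As)"
  by (simp add: kron_list_def)

lemma dim_kron_list:
  "dim_row (kron_list As) = prod_list (map dim_row As)"
  "dim_col (kron_list As) = prod_list (map dim_col As)"
  by (induction As) (auto simp: kron_list_def kron_def)

lemma kron_list_entry:
  "i < prod_list (map dim_row As) \<Longrightarrow> j < prod_list (map dim_col As) \<Longrightarrow>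
    kron_list As $$ (i, j) =
      (\<Prod>s<length As. As ! s $$ (digits (map dim_row As) i ! s, digits (map dim_col As) j ! s))"
proof (induction As arbitrary: i j)
  case Nil
  then show ?case by (simp add: kron_list_def)
next
  case (Cons A As)
  let ?R = "prod_list (map dim_row As)" and ?C = "prod_list (map dim_col As)"
  have pos: "0 < ?R" "0 < ?C" using Cons.prems by (auto intro!: Nat.gr0I)
  have "kron_list (A # As) $$ (i, j) = A $$ (i div ?R, j div ?C) * kron_list As $$ (i mod ?R, j mod ?C)"
    using Cons.prems by (simp add: kron_list_Cons kron_def dim_kron_list)
  also have "kron_list As $$ (i mod ?R, j mod ?C) =
     (\<Prod>s<length As. As ! s $$ (digits (map dim_row As) (i mod ?R) ! s, digits (map dim_col As) (j mod ?C) ! s))"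
    using pos by (intro Cons.IH) auto
  finally show ?case by (simp add: prod.lessThan_Suc_shift del: prod.lessThan_Suc)
qed

section \<open>Signed minors of an array with one more column than rows\<close>

text \<open>The coordinates of the generalized cross product of the \<open>n\<close> rows of the array \<open>a\<close>, whose columns are
  indexed by \<open>0, \<dots>, n\<close>. The rows are indexed by \<open>0, \<dots>, n - 1\<close>, so the row \<open>s\<close> stands for the
  state \<open>Suc s\<close>.\<close>

definition signed_minor :: "nat \<Rightarrow> (nat \<Rightarrow> nat \<Rightarrow> 'a::comm_ring_1) \<Rightarrow> nat \<Rightarrow> 'a" where
  "signed_minor n a l = (-1) ^ l * det (mat n n (\<lambda>(s, t). a s (if t < l then t else Suc t)))"

lemma signed_minor_cong:
  "(\<And>s t. s < n \<Longrightarrow> t \<le> n \<Longrightarrow> a s t = b s t) \<Longrightarrow> signed_minor n a l = signed_minor n b l"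
  unfolding signed_minor_def by (intro arg_cong2[of _ _ _ _ "(*)"] arg_cong[of _ _ det] eq_matI) auto

lemma signed_minor_expand:
  "signed_minor n a l = (\<Sum>p | p permutes {0..<n}. (-1) ^ l * signof p *
     (\<Prod>s<n. a s (if p s < l then p s else Suc (p s))))"
proof -
  have "det (mat n n (\<lambda>(s, t). a s (if t < l then t else Suc t))) =
    (\<Sum>p | p permutes {0..<n}. signof p * (\<Prod>s<n. a s (if p s < l then p s else Suc (p s))))"
    unfolding det_def'[OF mat_carrier]
  proof (intro sum.cong arg_cong2[of _ _ _ _ "(*)"] refl prod.cong)
    fix p s assume p: "p \<in> {p. p permutes {0..<n}}" and s: "s \<in> {..<n}"
    then have "p s < n" using permutes_in_image[of p "{0..<n}" s] by auto
    then show "mat n n (\<lambda>(s, t). a s (if t < l then t else Suc t)) $$ (s, p s) =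
      a s (if p s < l then p s else Suc (p s))" using s by simp
  qed auto
  then show ?thesis by (simp add: signed_minor_def sum_distrib_left mult.assoc)
qed

text \<open>Every term of the Leibniz expansion is a product over the rows, with one factor for each digit. So
  the weighted sum over all tuples of digits averages each row separately.\<close>

lemma sum_signed_minor_digits:
  fixes A :: "nat \<Rightarrow> nat \<Rightarrow> nat \<Rightarrow> 'a::comm_ring_1"
  assumes n: "length ds = n"
  shows "(\<Sum>i<prod_list ds. (\<Prod>s<n. x s (digits ds i ! s)) * signed_minor n (\<lambda>s l. A s l (digits ds i ! s)) l) =
    signed_minor n (\<lambda>s l. \<Sum>a<ds ! s. x s a * A s l a) l"
proof -
  let ?c = "\<lambda>p s. if p s < l then p s else Suc (p s :: nat)"
  have "(\<Sum>i<prod_list ds. (\<Prod>s<n. x s (digits ds i ! s)) * signed_minor n (\<lambda>s l. A s l (digits ds i ! s)) l)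
    = (\<Sum>i<prod_list ds. \<Sum>p | p permutes {0..<n}. (-1) ^ l * signof p *
       (\<Prod>s<n. x s (digits ds i ! s) * A s (?c p s) (digits ds i ! s)))"
    unfolding signed_minor_expand sum_distrib_left prod.distrib
    by (intro sum.cong refl) (simp only: ac_simps)
  also have "\<dots> = (\<Sum>p | p permutes {0..<n}. (-1) ^ l * signof p *
       (\<Sum>i<prod_list ds. \<Prod>s<n. x s (digits ds i ! s) * A s (?c p s) (digits ds i ! s)))"
    unfolding sum_distrib_left by (rule sum.swap)
  also have "\<dots> = (\<Sum>p | p permutes {0..<n}. (-1) ^ l * signof p *
       (\<Prod>s<n. \<Sum>a<ds ! s. x s a * A s (?c p s) a))"
    using sum_prod_digits[of "\<lambda>s b. x s b * A s (?c _ s) b" ds, unfolded n] by simp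
  also have "\<dots> = signed_minor n (\<lambda>s l. \<Sum>a<ds ! s. x s a * A s l a) l"
    unfolding signed_minor_expand ..
  finally show ?thesis .
qed

text \<open>Add to \<open>a\<close> a top row with entries \<open>1\<close> in column \<open>k\<close> and \<open>- v k\<close> in column \<open>0\<close>. The resulting
  square matrix annihilates the nonzero vector \<open>v\<close>, and expanding its determinant along the new row
  gives the claim.\<close>

lemma signed_minor_cramer:
  fixes a :: "nat \<Rightarrow> nat \<Rightarrow> 'a::field"
  assumes ker: "\<And>s. s < n \<Longrightarrow> (\<Sum>l\<le>n. a s l * v l) = 0" and v0: "v 0 = 1" and k: "k \<le> n"
  shows "signed_minor n a k = v k * signed_minor n a 0"
proof (cases "k = 0")
  case True
  then show ?thesis using v0 by simp
next
  case False
  define M where "M = mat (Suc n) (Suc n) (\<lambda>(s, l).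
    case s of 0 \<Rightarrow> (if l = k then 1 else if l = 0 then - v k else 0) | Suc s' \<Rightarrow> a s' l)"
  have M: "M \<in> carrier_mat (Suc n) (Suc n)" by (simp add: M_def)
  have cof: "cofactor M 0 l = signed_minor n a l" if "l \<le> n" for l
  proof -
    have "mat_delete M 0 l = mat n n (\<lambda>(s, t). a s (if t < l then t else Suc t))"
      using that by (intro eq_matI) (auto simp: M_def mat_delete_def)
    then show ?thesis by (simp add: cofactor_def signed_minor_def)
  qed
  have M0: "M $$ (0, l) = (if l = k then 1 else if l = 0 then - v k else 0)" if "l \<le> n" for l
    using that by (simp add: M_def)
  have "det M = (\<Sum>l<Suc n. M $$ (0, l) * cofactor M 0 l)"
    by (rule laplace_expansion_row[OF M]) simp
  also have "\<dots> = (\<Sum>l\<le>n. (if l = k then signed_minor n a k else 0) + (if l = 0 then - v k * signed_minor n a 0 else 0))"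
    unfolding lessThan_Suc_atMost
    by (intro sum.cong refl) (use False in \<open>auto simp: M0 cof\<close>)
  also have "\<dots> = signed_minor n a k - v k * signed_minor n a 0"
    using k by (simp add: sum.distrib)
  finally have detM: "det M = signed_minor n a k - v k * signed_minor n a 0" .
  define w where "w = vec (Suc n) v"
  have w: "w \<in> carrier_vec (Suc n)" by (simp add: w_def)
  have "M *\<^sub>v w = 0\<^sub>v (Suc n)"
  proof (rule eq_vecI)
    fix s assume "s < dim_vec (0\<^sub>v (Suc n) :: 'a vec)"
    then have s: "s < Suc n" by simp
    have e: "(M *\<^sub>v w) $ s = (\<Sum>l\<le>n. M $$ (s, l) * v l)"
      using s M by (simp add: w_def scalar_prod_def atLeast0LessThan flip: lessThan_Suc_atMost)
    show "(M *\<^sub>v w) $ s = 0\<^sub>v (Suc n) $ s"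
    proof (cases s)
      case 0
      have "(\<Sum>l\<le>n. M $$ (s, l) * v l) = (\<Sum>l\<le>n. (if l = k then v k else 0) + (if l = 0 then - v k else 0))"
        by (intro sum.cong refl) (use False 0 v0 in \<open>auto simp: M_def\<close>)
      also have "\<dots> = 0" using k by (simp add: sum.distrib)
      finally show ?thesis using e s by simp
    next
      case (Suc s')
      have "(\<Sum>l\<le>n. M $$ (s, l) * v l) = (\<Sum>l\<le>n. a s' l * v l)"
        by (intro sum.cong refl) (use Suc s in \<open>auto simp: M_def\<close>)
      then show ?thesis using e s ker[of s'] Suc by simp
    qed
  qed (use M in auto)
  moreover have "w \<noteq> 0\<^sub>v (Suc n)"
  proof
    assume "w = 0\<^sub>v (Suc n)"
    then have "w $ 0 = 0" by simp
    then show False using v0 by (simp add: w_def)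
  qed
  ultimately have "det M = 0"
    using det_0_iff_vec_prod_zero_field[OF M] w by blast
  then show ?thesis using detM by simp
qed

text \<open>For \<open>0 \<le> t \<le> 1\<close> the matrix \<open>1 - t Q\<close> is strictly diagonally dominant, hence invertible. Its
  determinant equals \<open>1\<close> at \<open>t = 0\<close> and cannot change sign.\<close>

lemma det_one_minus_substochastic_pos:
  fixes Q :: "real mat"
  assumes Q: "Q \<in> carrier_mat n n" and nonneg: "\<And>i j. i < n \<Longrightarrow> j < n \<Longrightarrow> 0 \<le> Q $$ (i, j)"
    and rows: "\<And>i. i < n \<Longrightarrow> (\<Sum>j<n. Q $$ (i, j)) < 1"
  shows "0 < det (1\<^sub>m n - Q)"
proof -
  define D where "D t = 1\<^sub>m n - t \<cdot>\<^sub>m Q" for t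
  have D: "D t \<in> carrier_mat n n" for t
    unfolding D_def by (rule minus_carrier_mat) (use Q in auto)
  have ne: "det (D t) \<noteq> 0" if t: "0 \<le> t" "t \<le> 1" for t
  proof
    assume "det (D t) = 0"
    then obtain v where v: "v \<in> carrier_vec n" "v \<noteq> 0\<^sub>v n" "D t *\<^sub>v v = 0\<^sub>v n"
      using det_0_iff_vec_prod_zero_field[OF D] by blast
    have "n > 0" using v by (cases n) auto
    let ?S = "(\<lambda>j. \<bar>v $ j\<bar>) ` {..<n}"
    have "Max ?S \<in> ?S" using \<open>n > 0\<close> by (intro Max_in) auto
    then obtain i where i: "i < n" "Max ?S = \<bar>v $ i\<bar>" by auto
    have max: "\<bar>v $ j\<bar> \<le> \<bar>v $ i\<bar>" if "j < n" for j
      unfolding i(2)[symmetric] using that by (intro Max_ge) auto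
    have "v $ i \<noteq> 0"
    proof
      assume "v $ i = 0"
      then have "\<And>j. j < n \<Longrightarrow> v $ j = 0" using max by fastforce
      then have "v = 0\<^sub>v n" using v(1) by (intro eq_vecI) auto
      then show False using v(2) by simp
    qed
    have "0 = (D t *\<^sub>v v) $ i" using v(3) i by simp
    also have "\<dots> = (\<Sum>j<n. ((if i = j then 1 else 0) - t * Q $$ (i, j)) * v $ j)"
      using i Q v(1) by (simp add: D_def scalar_prod_def atLeast0LessThan one_mat_def)
    also have "\<dots> = (\<Sum>j<n. if i = j then v $ j else 0) - (\<Sum>j<n. t * (Q $$ (i, j) * v $ j))"
      unfolding sum_subtractf[symmetric] by (intro sum.cong) (auto simp: algebra_simps)
    also have "\<dots> = v $ i - t * (\<Sum>j<n. Q $$ (i, j) * v $ j)"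
      using i by (simp add: sum_distrib_left)
    finally have "v $ i = t * (\<Sum>j<n. Q $$ (i, j) * v $ j)" by simp
    then have "\<bar>v $ i\<bar> = t * \<bar>\<Sum>j<n. Q $$ (i, j) * v $ j\<bar>" using t by (simp add: abs_mult)
    also have "\<dots> \<le> 1 * (\<Sum>j<n. Q $$ (i, j) * \<bar>v $ i\<bar>)"
    proof (intro mult_mono order_trans[OF sum_abs] sum_mono)
      fix j assume "j \<in> {..<n}"
      then show "\<bar>Q $$ (i, j) * v $ j\<bar> \<le> Q $$ (i, j) * \<bar>v $ i\<bar>"
        using nonneg[OF i(1)] max by (auto simp: abs_mult intro!: mult_left_mono)
    qed (use t in auto)
    also have "\<dots> = (\<Sum>j<n. Q $$ (i, j)) * \<bar>v $ i\<bar>" by (simp add: sum_distrib_right)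
    also have "\<dots> < 1 * \<bar>v $ i\<bar>"
      using rows[OF i(1)] \<open>v $ i \<noteq> 0\<close> by (intro mult_strict_right_mono) auto
    finally show False by simp
  qed
  have cont: "continuous_on {0..1} (\<lambda>t. det (D t))"
    unfolding det_def'[OF D]
  proof (intro continuous_intros)
    fix p i assume p: "p \<in> {p. p permutes {0..<n}}" and i: "i \<in> {0..<n}"
    then have "i < n" "p i < n" using permutes_in_image[of p "{0..<n}" i] by auto
    then show "continuous_on {0..1} (\<lambda>t. D t $$ (i, p i))"
      using Q by (simp add: D_def continuous_intros)
  qed
  have D0: "D 0 = 1\<^sub>m n" using Q by (intro eq_matI) (auto simp: D_def)
  have D1: "D 1 = 1\<^sub>m n - Q" using Q by (intro eq_matI) (auto simp: D_def)
  show ?thesis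
  proof (rule ccontr)
    assume "\<not> ?thesis"
    then have "det (D 1) \<le> 0" "0 \<le> det (D 0)" by (auto simp: D1 D0)
    then obtain t where "0 \<le> t" "t \<le> 1" "det (D t) = 0"
      using IVT2'[of "\<lambda>t. det (D t)" 1 0 0] cont by auto
    then show False using ne by blast
  qed
qed

section \<open>Entries of the auxiliary matrices\<close>

text \<open>Kronecker determinants are indexed by \<open>1, \<dots>, n\<close> and determinants of matrices by
  \<open>0, \<dots>, n - 1\<close>; relabelling preserves signs.\<close>

lemma sum_permutes_shift:
  "(\<Sum>\<sigma> | \<sigma> permutes {1..n}. of_int (sign \<sigma>) * g (\<lambda>s. \<sigma> (Suc s))) =
   (\<Sum>p | p permutes {0..<n}. signof p * g (\<lambda>s. if s < n then Suc (p s) else Suc s) :: 'a::comm_ring_1)"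
proof -
  have b1: "bij_betw Suc {0..<n} {1..n}" by (rule bij_betwI[of _ _ _ "\<lambda>k. k - 1"]) auto
  have b2: "bij_betw (\<lambda>k. k - 1) {1..n} {0..<n}" by (rule bij_betwI[of _ _ _ Suc]) auto
  show ?thesis
  proof (rule sum.reindex_bij_witness[of _ "map_permutation {0..<n} Suc" "map_permutation {1..n} (\<lambda>k. k - 1)"])
    fix \<sigma> assume \<sigma>: "\<sigma> \<in> {\<sigma>. \<sigma> permutes {1..n}}"
    then show "map_permutation {0..<n} Suc (map_permutation {1..n} (\<lambda>k. k - 1) \<sigma>) = \<sigma>"
      by (intro map_permutation_compose_inv[OF b2]) auto
    show "map_permutation {1..n} (\<lambda>k. k - 1) \<sigma> \<in> {p. p permutes {0..<n}}"
      using map_permutation_permutes[OF b2] \<sigma> by auto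
    have sg: "sign (map_permutation {1..n} (\<lambda>k. k - 1) \<sigma>) = sign \<sigma>"
      using \<sigma> b2 by (intro sign_map_permutation) (auto simp: bij_betw_def)
    have "(\<lambda>s. if s < n then Suc (map_permutation {1..n} (\<lambda>k. k - 1) \<sigma> s) else Suc s) = (\<lambda>s. \<sigma> (Suc s))"
    proof
      fix s
      show "(if s < n then Suc (map_permutation {1..n} (\<lambda>k. k - 1) \<sigma> s) else Suc s) = \<sigma> (Suc s)"
      proof (cases "s < n")
        case True
        have "map_permutation {1..n} (\<lambda>k. k - 1) \<sigma> s = \<sigma> (Suc s) - 1"
          using map_permutation_apply[of "\<lambda>k. k - 1" "{1..n}" "Suc s" \<sigma>] b2 True by (simp add: bij_betw_def)
        moreover have "\<sigma> (Suc s) \<in> {1..n}" using permutes_in_image[of \<sigma> "{1..n}" "Suc s"] \<sigma> True by auto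
        ultimately show ?thesis using True by simp
      next
        case False
        then show ?thesis using \<sigma> by (auto simp: permutes_def)
      qed
    qed
    then show "signof (map_permutation {1..n} (\<lambda>k. k - 1) \<sigma>) *
        g (\<lambda>s. if s < n then Suc (map_permutation {1..n} (\<lambda>k. k - 1) \<sigma> s) else Suc s) =
        of_int (sign \<sigma>) * g (\<lambda>s. \<sigma> (Suc s))" using sg by simp
  next
    fix p assume p: "p \<in> {p. p permutes {0..<n}}"
    then show "map_permutation {1..n} (\<lambda>k. k - 1) (map_permutation {0..<n} Suc p) = p"
      by (intro map_permutation_compose_inv[OF b1]) auto
    show "map_permutation {0..<n} Suc p \<in> {\<sigma>. \<sigma> permutes {1..n}}"
      using map_permutation_permutes[OF b1] p by auto
  qed
qed

lemma prod_list_upt_Suc: "prod_list (map f [1..<Suc n]) = (\<Prod>k\<in>{1..n}. f k)"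
  using prod.distinct_set_conv_list[of "[1..<Suc n]" f]
  by (simp add: atLeastLessThanSuc_atLeastAtMost del: upt_Suc)

text \<open>The digits of a row index select one row in each factor of a Kronecker product, and likewise for
  columns. Hence an entry of a Kronecker determinant is an ordinary determinant.\<close>

lemma aux_mat_entries:
  fixes D :: "nat \<Rightarrow> nat \<Rightarrow> 'a::comm_ring_1 mat"
  assumes D: "\<And>k l. k \<in> {1..n} \<Longrightarrow> l \<le> n \<Longrightarrow> D k l \<in> carrier_mat (r k) (c k)" and l: "l \<le> n"
  defines "rs \<equiv> map r [1..<Suc n]" and "cs \<equiv> map c [1..<Suc n]"
  shows "aux_mat n D l = mat (prod_list rs) (prod_list cs) (\<lambda>(i, j).
      signed_minor n (\<lambda>s t. D (Suc s) t $$ (digits rs i ! s, digits cs j ! s)) l)"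
proof -
  let ?A = "remove_col l D"
  have A: "?A k t \<in> carrier_mat (r k) (c k)" if "k \<in> {1..n}" "t \<in> {1..n}" for k t
    using D[OF that(1), of t] D[OF that(1), of "t - 1"] that by (auto simp: remove_col_def)
  have dr: "(\<Prod>k\<in>{1..n}. dim_row (?A k k)) = prod_list rs" "(\<Prod>k\<in>{1..n}. dim_col (?A k k)) = prod_list cs"
    unfolding rs_def cs_def prod_list_upt_Suc using carrier_matD[OF A] by (auto intro!: prod.cong simp del: One_nat_def)
  have entry: "(\<Sum>\<sigma> | \<sigma> permutes {1..n}. of_int (sign \<sigma>) * kron_list (map (\<lambda>k. ?A k (\<sigma> k)) [1..<Suc n]) $$ (i, j)) =
     det (mat n n (\<lambda>(s, t). D (Suc s) (if t < l then t else Suc t) $$ (digits rs i ! s, digits cs j ! s)))"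
    if ij: "i < prod_list rs" "j < prod_list cs" for i j
  proof -
    have k: "kron_list (map (\<lambda>k. ?A k (\<sigma> k)) [1..<Suc n]) $$ (i, j) =
        (\<Prod>s<n. ?A (Suc s) (\<sigma> (Suc s)) $$ (digits rs i ! s, digits cs j ! s))"
      if "\<sigma> \<in> {\<sigma>. \<sigma> permutes {1..n}}" for \<sigma>
    proof -
      let ?As = "map (\<lambda>k. ?A k (\<sigma> k)) [1..<Suc n]"
      have Ak: "?A k (\<sigma> k) \<in> carrier_mat (r k) (c k)" if "k \<in> set [1..<Suc n]" for k
        using \<open>\<sigma> \<in> _\<close> permutes_in_image[of \<sigma> "{1..n}" k] that by (intro A) auto
      have rows: "map dim_row ?As = rs" and cols: "map dim_col ?As = cs"
        unfolding rs_def cs_def map_map comp_def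
        by (rule map_cong[OF refl], rule carrier_matD[OF Ak], assumption)+
      have "kron_list ?As $$ (i, j) = (\<Prod>s<length ?As. ?As ! s $$ (digits rs i ! s, digits cs j ! s))"
        using kron_list_entry[of i ?As j, unfolded rows cols, OF ij] .
      also have "\<dots> = (\<Prod>s<n. ?A (Suc s) (\<sigma> (Suc s)) $$ (digits rs i ! s, digits cs j ! s))"
        by (intro prod.cong) (auto simp del: upt_Suc)
      finally show ?thesis .
    qed
    have "(\<Sum>\<sigma> | \<sigma> permutes {1..n}. of_int (sign \<sigma>) * kron_list (map (\<lambda>k. ?A k (\<sigma> k)) [1..<Suc n]) $$ (i, j)) =
      (\<Sum>\<sigma> | \<sigma> permutes {1..n}. of_int (sign \<sigma>) * (\<Prod>s<n. ?A (Suc s) (\<sigma> (Suc s)) $$ (digits rs i ! s, digits cs j ! s)))"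
      by (intro sum.cong refl) (simp only: k)
    also have "\<dots> = (\<Sum>p | p permutes {0..<n}. signof p * (\<Prod>s<n. ?A (Suc s) (if s < n then Suc (p s) else Suc s) $$ (digits rs i ! s, digits cs j ! s)))"
      by (rule sum_permutes_shift)
    also have "\<dots> = det (mat n n (\<lambda>(s, t). D (Suc s) (if t < l then t else Suc t) $$ (digits rs i ! s, digits cs j ! s)))"
      unfolding det_def'[OF mat_carrier]
    proof (intro sum.cong arg_cong2[of _ _ _ _ "(*)"] refl prod.cong)
      fix p s assume p: "p \<in> {p. p permutes {0..<n}}" and s: "s \<in> {0..<n}"
      then have "p s < n" using permutes_in_image[of p "{0..<n}" s] by auto
      then show "?A (Suc s) (if s < n then Suc (p s) else Suc s) $$ (digits rs i ! s, digits cs j ! s) =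
        mat n n (\<lambda>(s, t). D (Suc s) (if t < l then t else Suc t) $$ (digits rs i ! s, digits cs j ! s)) $$ (s, p s)"
        using s by (auto simp: remove_col_def)
    qed auto
    finally show ?thesis .
  qed
  show ?thesis
    unfolding aux_mat_def kron_det_def dr
    by (intro eq_matI) (auto simp: entry signed_minor_def simp del: upt_Suc One_nat_def)
qed

section \<open>Index embedding of reduced matrices\<close>

lemma digits_upt_less:
  assumes "i < prod_list (map r [1..<Suc n])" "s < n"
  shows "digits (map r [1..<Suc n]) i ! s < r (Suc s)"
  using digits_less[OF assms(1), of s] assms(2) by (simp del: upt_Suc)

text \<open>For pairs \<open>(S, d)\<close> with \<open>S \<subseteq> {..<d}\<close>: the number whose digits in the bases \<open>d\<close> are the elements of
  the sets \<open>S\<close> at the positions prescribed by the digits of \<open>i\<close> in the bases \<open>card S\<close>. It locates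
  the rows, or the columns, of a reduced auxiliary matrix in the full one.\<close>

primrec embed_index :: "(nat set \<times> nat) list \<Rightarrow> nat \<Rightarrow> nat" where
  "embed_index [] i = 0"
| "embed_index (p # ps) i =
     pick (fst p) (i div prod_list (map (\<lambda>p. card (fst p)) ps)) * prod_list (map snd ps) +
     embed_index ps (i mod prod_list (map (\<lambda>p. card (fst p)) ps))"

lemma mult_add_less:
  fixes a b c d :: nat
  assumes "a < b" "c < d"
  shows "a * d + c < b * d"
proof -
  have "a * d + c < Suc a * d" using assms by simp
  also have "\<dots> \<le> b * d" using assms by (intro mult_right_mono) auto
  finally show ?thesis .
qed

lemma embed_index_bound_digits:
  assumes "\<forall>p\<in>set ps. fst p \<subseteq> {..<snd p}" "i < prod_list (map (\<lambda>p. card (fst p)) ps)"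
  shows "embed_index ps i < prod_list (map snd ps)"
    and "s < length ps \<Longrightarrow>
      digits (map snd ps) (embed_index ps i) ! s = pick (fst (ps ! s)) (digits (map (\<lambda>p. card (fst p)) ps) i ! s)"
  using assms
proof (induction ps arbitrary: i s)
  case (Cons p ps)
  let ?w = "prod_list (map (\<lambda>p. card (fst p)) ps)" and ?N = "prod_list (map snd ps)"
  {
    case 1
    have w: "0 < ?w" using 1 by (cases ?w) auto
    have d: "i div ?w < card (fst p)" using 1 by (intro less_mult_imp_div_less) simp
    have "pick (fst p) (i div ?w) < snd p" using pick_in_set_le[OF d] 1 by auto
    moreover have "embed_index ps (i mod ?w) < ?N" using 1 w by (intro Cons.IH(1)) auto
    ultimately show ?case by (simp add: mult_add_less)
  next
    case 2
    have w: "0 < ?w" using 2 by (cases ?w) auto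
    have lt: "embed_index ps (i mod ?w) < ?N" using 2 w by (intro Cons.IH(1)) auto
    then have N: "?N \<noteq> 0" by linarith
    show ?case
    proof (cases s)
      case 0
      then show ?thesis using lt N by simp
    next
      case (Suc s')
      then show ?thesis using lt N 2 w Cons.IH(2)[of s' "i mod ?w"] by simp
    qed
  }
qed auto

text \<open>Both enumerations are lexicographic. Since the embedding is increasing, minors of a reduced matrix
  are minors of the full matrix without any change of sign.\<close>

lemma embed_index_mono:
  assumes "\<forall>p\<in>set ps. fst p \<subseteq> {..<snd p}" "i < i'" "i' < prod_list (map (\<lambda>p. card (fst p)) ps)"
  shows "embed_index ps i < embed_index ps i'"
  using assms
proof (induction ps arbitrary: i i')
  case (Cons p ps)
  let ?w = "prod_list (map (\<lambda>p. card (fst p)) ps)" and ?N = "prod_list (map snd ps)"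
  have w: "0 < ?w" using Cons.prems by (cases ?w) auto
  have d: "i' div ?w < card (fst p)" using Cons.prems by (intro less_mult_imp_div_less) simp
  have le: "i div ?w \<le> i' div ?w" using Cons.prems(2) by (simp add: div_le_mono)
  have lt: "embed_index ps (i mod ?w) < ?N" using Cons.prems w by (intro embed_index_bound_digits(1)) auto
  show ?case
  proof (cases "i div ?w = i' div ?w")
    case True
    have "i mod ?w < i' mod ?w"
      using arg_cong[OF True, of "\<lambda>q. q * ?w"] Cons.prems(2)
        div_mult_mod_eq[of i ?w] div_mult_mod_eq[of i' ?w] by linarith
    then show ?thesis using True Cons.IH[of "i mod ?w" "i' mod ?w"] Cons.prems w by simp
  next
    case False
    then have "pick (fst p) (i div ?w) < pick (fst p) (i' div ?w)"
      using le d by (intro pick_mono_le) auto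
    then show ?thesis using mult_add_less[OF _ lt] by (simp add: trans_less_add1)
  qed
qed simp

lemma pick_image_strict_mono:
  assumes R: "R \<subseteq> {..<a}" and mono: "\<And>i i'. i < i' \<Longrightarrow> i' < a \<Longrightarrow> \<phi> i < (\<phi> i' :: nat)" and s: "s < card R"
  shows "pick (\<phi> ` R) s = \<phi> (pick R s)"
proof -
  have p: "pick R s \<in> R" by (rule pick_in_set_le[OF s])
  have iff: "\<phi> b < \<phi> (pick R s) \<longleftrightarrow> b < pick R s" if "b \<in> R" for b
    using mono[of b "pick R s"] mono[of "pick R s" b] p R that by (metis lessThan_iff linorder_neqE_nat order.asym subsetD)
  have inj: "inj_on \<phi> R"
    using mono R by (intro inj_onI) (metis lessThan_iff linorder_neqE_nat order.irrefl subsetD)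
  have "{c \<in> \<phi> ` R. c < \<phi> (pick R s)} = \<phi> ` {b \<in> R. b < pick R s}" using iff by auto
  then have "card {c \<in> \<phi> ` R. c < \<phi> (pick R s)} = card {b \<in> R. b < pick R s}"
    using inj by (simp add: card_image inj_on_subset)
  also have "\<dots> = s" by (rule card_pick_le[OF s])
  finally show ?thesis using pick_card_in_set[of "\<phi> (pick R s)" "\<phi> ` R"] p by simp
qed

lemma submatrix_reindex:
  assumes A: "A \<in> carrier_mat p q" and A': "A' \<in> carrier_mat a b"
    and \<phi>: "\<And>i i'. i < i' \<Longrightarrow> i' < a \<Longrightarrow> \<phi> i < \<phi> i'" "\<And>i. i < a \<Longrightarrow> \<phi> i < p"
    and \<psi>: "\<And>i i'. i < i' \<Longrightarrow> i' < b \<Longrightarrow> \<psi> i < \<psi> i'" "\<And>i. i < b \<Longrightarrow> \<psi> i < q"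
    and ent: "\<And>i j. i < a \<Longrightarrow> j < b \<Longrightarrow> A' $$ (i, j) = A $$ (\<phi> i, \<psi> j)"
    and R: "R \<subseteq> {..<a}" and C: "C \<subseteq> {..<b}"
  shows "submatrix A' R C = submatrix A (\<phi> ` R) (\<psi> ` C)" "card (\<phi> ` R) = card R" "card (\<psi> ` C) = card C"
proof -
  have inj: "inj_on \<phi> R"
    using \<phi>(1) R by (intro inj_onI) (metis lessThan_iff linorder_neqE_nat order.irrefl subsetD)
  have inj': "inj_on \<psi> C"
    using \<psi>(1) C by (intro inj_onI) (metis lessThan_iff linorder_neqE_nat order.irrefl subsetD)
  show cR: "card (\<phi> ` R) = card R" and cC: "card (\<psi> ` C) = card C"
    using inj inj' by (simp_all add: card_image)
  have sets: "{i. i < a \<and> i \<in> R} = R" "{i. i < b \<and> i \<in> C} = C"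
    "{i. i < p \<and> i \<in> \<phi> ` R} = \<phi> ` R" "{i. i < q \<and> i \<in> \<psi> ` C} = \<psi> ` C"
    using R C \<phi>(2) \<psi>(2) by auto
  show "submatrix A' R C = submatrix A (\<phi> ` R) (\<psi> ` C)"
  proof (rule eq_matI)
    fix i j assume "i < dim_row (submatrix A (\<phi> ` R) (\<psi> ` C))" "j < dim_col (submatrix A (\<phi> ` R) (\<psi> ` C))"
    then have ij: "i < card R" "j < card C" using A sets cR cC by (auto simp: dim_submatrix)
    have "pick R i < a" "pick C j < b" using pick_in_set_le[OF ij(1)] pick_in_set_le[OF ij(2)] R C by auto
    then show "submatrix A' R C $$ (i, j) = submatrix A (\<phi> ` R) (\<psi> ` C) $$ (i, j)"
      using ij A A' sets cR cC ent
        pick_image_strict_mono[OF R \<phi>(1) ij(1)] pick_image_strict_mono[OF C \<psi>(1) ij(2)]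
      by (simp add: submatrix_def)
  qed (use A A' sets cR cC in \<open>simp_all add: dim_submatrix\<close>)
qed

lemma (in comm_ring_hom) hom_signed_minor:
  "signed_minor n (\<lambda>s t. hom (a s t)) l = hom (signed_minor n a l)"
proof -
  have "mat n n (\<lambda>(s, t). hom (a s (if t < l then t else Suc t))) =
    map_mat hom (mat n n (\<lambda>(s, t). a s (if t < l then t else Suc t)))"
    by (intro eq_matI) auto
  then show ?thesis unfolding signed_minor_def by (simp add: hom_distribs)
qed

text \<open>Removing column \<open>0\<close> leaves the matrix \<open>Q - 1\<close>.\<close>

lemma signed_minor_zero_substochastic:
  fixes Q :: "nat \<Rightarrow> nat \<Rightarrow> real"
  assumes a: "\<And>s t. s < n \<Longrightarrow> t < n \<Longrightarrow> a s (Suc t) = Q s t - (if s = t then 1 else 0)"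
    and nonneg: "\<And>s t. s < n \<Longrightarrow> t < n \<Longrightarrow> 0 \<le> Q s t"
    and rows: "\<And>s. s < n \<Longrightarrow> (\<Sum>t<n. Q s t) < 1"
  shows "0 < (-1) ^ n * signed_minor n a 0"
proof -
  let ?Q = "mat n n (\<lambda>(s, t). Q s t)"
  have "mat n n (\<lambda>(s, t). a s (if t < 0 then t else Suc t)) = (-1) \<cdot>\<^sub>m (1\<^sub>m n - ?Q)"
    by (intro eq_matI) (auto simp: a)
  then have "signed_minor n a 0 = (-1) ^ n * det (1\<^sub>m n - ?Q)"
    by (simp add: signed_minor_def)
  moreover have "0 < det (1\<^sub>m n - ?Q)"
    using nonneg rows by (intro det_one_minus_substochastic_pos) auto
  ultimately show ?thesis by (simp flip: mult.assoc power_mult_distrib)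
qed

section \<open>Values of matrix games\<close>

lemma game_payoff_sum:
  assumes "A \<in> carrier_mat p m" "x \<in> carrier_vec p" "y \<in> carrier_vec m"
  shows "game_payoff A x y = (\<Sum>i<p. \<Sum>j<m. x $ i * y $ j * A $$ (i, j))"
  using assms
  by (simp add: game_payoff_def scalar_prod_def atLeast0LessThan sum_distrib_left algebra_simps)

lemma mixed_carrier: "x \<in> mixed p \<Longrightarrow> x \<in> carrier_vec p"
  by (simp add: mixed_def)

lemma mixed_unit: "j < p \<Longrightarrow> unit_vec p j \<in> mixed p"
  by (auto simp: mixed_def unit_vec_def)

lemma mixed_average_le:
  assumes "y \<in> mixed p" "\<And>j. j < p \<Longrightarrow> f j \<le> c"
  shows "(\<Sum>j<p. y $ j * f j) \<le> c"
proof -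
  have "(\<Sum>j<p. y $ j * f j) \<le> (\<Sum>j<p. y $ j * c)"
    using assms by (intro sum_mono mult_left_mono) (auto simp: mixed_def)
  also have "\<dots> = c" using assms by (simp add: mixed_def flip: sum_distrib_right)
  finally show ?thesis .
qed

lemma mixed_average_ge:
  assumes "y \<in> mixed p" "\<And>j. j < p \<Longrightarrow> c \<le> f j"
  shows "c \<le> (\<Sum>j<p. y $ j * f j)"
  using mixed_average_le[of y p "\<lambda>j. - f j" "- c"] assms by (simp add: sum_negf)

lemma game_payoff_by_cols:
  assumes "A \<in> carrier_mat p m" "x \<in> carrier_vec p" "y \<in> carrier_vec m"
  shows "game_payoff A x y = (\<Sum>j<m. y $ j * (\<Sum>i<p. x $ i * A $$ (i, j)))"
  unfolding game_payoff_sum[OF assms] by (subst sum.swap) (simp add: sum_distrib_left algebra_simps)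

lemma game_payoff_by_rows:
  assumes "A \<in> carrier_mat p m" "x \<in> carrier_vec p" "y \<in> carrier_vec m"
  shows "game_payoff A x y = (\<Sum>i<p. x $ i * (\<Sum>j<m. A $$ (i, j) * y $ j))"
  unfolding game_payoff_sum[OF assms] by (simp add: sum_distrib_left algebra_simps)

lemma game_payoff_unit:
  assumes A: "A \<in> carrier_mat p m" "x \<in> carrier_vec p" and j: "j < m"
  shows "game_payoff A x (unit_vec m j) = (\<Sum>i<p. x $ i * A $$ (i, j))"
proof -
  have "(\<Sum>j'<m. unit_vec m j $ j' * (\<Sum>i<p. x $ i * A $$ (i, j'))) =
    (\<Sum>j'<m. if j' = j then (\<Sum>i<p. x $ i * A $$ (i, j')) else 0)"
    by (intro sum.cong) (auto simp: unit_vec_def)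
  then show ?thesis using j by (simp add: game_payoff_by_cols[OF A])
qed

lemma game_payoff_bounds:
  assumes A: "A \<in> carrier_mat p m" and x: "x \<in> mixed p" and y: "y \<in> mixed m"
  shows "(\<And>i j. i < p \<Longrightarrow> j < m \<Longrightarrow> A $$ (i, j) \<le> c) \<Longrightarrow> game_payoff A x y \<le> c"
    and "(\<And>i j. i < p \<Longrightarrow> j < m \<Longrightarrow> c \<le> A $$ (i, j)) \<Longrightarrow> c \<le> game_payoff A x y"
proof -
  note cols = game_payoff_by_cols[OF A mixed_carrier[OF x] mixed_carrier[OF y]]
  show "game_payoff A x y \<le> c" if "\<And>i j. i < p \<Longrightarrow> j < m \<Longrightarrow> A $$ (i, j) \<le> c"
    unfolding cols using that by (intro mixed_average_le[OF y] mixed_average_le[OF x])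
  show "c \<le> game_payoff A x y" if "\<And>i j. i < p \<Longrightarrow> j < m \<Longrightarrow> c \<le> A $$ (i, j)"
    unfolding cols using that by (intro mixed_average_ge[OF y] mixed_average_ge[OF x])
qed

definition entry_bound :: "real mat \<Rightarrow> real" where
  "entry_bound A = (\<Sum>i<dim_row A. \<Sum>j<dim_col A. \<bar>A $$ (i, j)\<bar>)"

lemma entry_bound: "i < dim_row A \<Longrightarrow> j < dim_col A \<Longrightarrow> \<bar>A $$ (i, j)\<bar> \<le> entry_bound A"
proof -
  assume ij: "i < dim_row A" "j < dim_col A"
  have "\<bar>A $$ (i, j)\<bar> \<le> (\<Sum>j<dim_col A. \<bar>A $$ (i, j)\<bar>)"
    using ij by (intro member_le_sum) auto
  also have "\<dots> \<le> entry_bound A"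
    unfolding entry_bound_def using ij
    by (intro member_le_sum[of _ _ "\<lambda>i. \<Sum>j<dim_col A. \<bar>A $$ (i, j)\<bar>"] sum_nonneg) auto
  finally show ?thesis .
qed

lemma game_payoff_abs_le:
  assumes A: "A \<in> carrier_mat p m" and x: "x \<in> mixed p" and y: "y \<in> mixed m"
  shows "game_payoff A x y \<le> entry_bound A" "- entry_bound A \<le> game_payoff A x y"
  using A entry_bound[of _ A] by (intro game_payoff_bounds[OF A x y]; fastforce simp: abs_le_iff)+

lemma mixed_nonempty: "0 < p \<Longrightarrow> mixed p \<noteq> {}"
  using mixed_unit by blast

lemma bdd_below_game_payoff:
  assumes "A \<in> carrier_mat p m" "x \<in> mixed p"
  shows "bdd_below (game_payoff A x ` mixed m)"
  using game_payoff_abs_le(2)[OF assms] by (intro bdd_belowI2)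

lemma bdd_above_game_floor:
  assumes A: "A \<in> carrier_mat p m" and m: "0 < m"
  shows "bdd_above ((\<lambda>x. INF y\<in>mixed m. game_payoff A x y) ` mixed p)"
proof (rule bdd_aboveI2)
  fix x assume x: "x \<in> mixed p"
  show "(INF y\<in>mixed m. game_payoff A x y) \<le> entry_bound A"
    using cINF_lower[OF bdd_below_game_payoff[OF A x] mixed_unit[OF m]]
      game_payoff_abs_le(1)[OF A x mixed_unit[OF m]] by simp
qed

lemma game_val_ge:
  assumes A: "A \<in> carrier_mat p m" and m: "0 < m" and x: "x \<in> mixed p"
    and c: "\<And>y. y \<in> mixed m \<Longrightarrow> c \<le> game_payoff A x y"
  shows "c \<le> game_val A"
proof -
  have "c \<le> (INF y\<in>mixed m. game_payoff A x y)"
    using mixed_nonempty[OF m] c by (intro cINF_greatest) auto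
  also have "\<dots> \<le> (SUP x\<in>mixed p. INF y\<in>mixed m. game_payoff A x y)"
    by (rule cSUP_upper[OF x bdd_above_game_floor[OF A m]])
  finally show ?thesis using A by (simp add: game_val_def)
qed

lemma game_val_le:
  assumes A: "A \<in> carrier_mat p m" and p: "0 < p"
    and c: "\<And>x. x \<in> mixed p \<Longrightarrow> \<exists>y\<in>mixed m. game_payoff A x y \<le> c"
  shows "game_val A \<le> c"
proof -
  have "(SUP x\<in>mixed p. INF y\<in>mixed m. game_payoff A x y) \<le> c"
  proof (rule cSUP_least[OF mixed_nonempty[OF p]])
    fix x assume x: "x \<in> mixed p"
    then obtain y where y: "y \<in> mixed m" "game_payoff A x y \<le> c" using c by blast
    then show "(INF y\<in>mixed m. game_payoff A x y) \<le> c"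
      using cINF_lower[OF bdd_below_game_payoff[OF A x] y(1)] by simp
  qed
  then show ?thesis using A by (simp add: game_val_def)
qed

lemma game_val_approx:
  assumes A: "A \<in> carrier_mat p m" and p: "0 < p" "0 < m" and e: "0 < e"
  shows "\<exists>x\<in>mixed p. \<forall>y\<in>mixed m. game_val A - e \<le> game_payoff A x y"
proof -
  have "game_val A - e < (SUP x\<in>mixed p. INF y\<in>mixed m. game_payoff A x y)"
    using A e by (simp add: game_val_def)
  then obtain x where x: "x \<in> mixed p" "game_val A - e < (INF y\<in>mixed m. game_payoff A x y)"
    using less_cSUP_iff[OF mixed_nonempty[OF p(1)] bdd_above_game_floor[OF A p(2)]] by auto
  have "game_val A - e \<le> game_payoff A x y" if "y \<in> mixed m" for y
    using cINF_lower[OF bdd_below_game_payoff[OF A x(1)] that] x(2) by simp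
  then show ?thesis using x(1) by blast
qed

text \<open>The payoff is linear in the strategy of the second player, so a pure strategy is a best reply.\<close>

lemma game_pure_reply:
  assumes A: "A \<in> carrier_mat p m" and m: "0 < m" and x: "x \<in> mixed p"
  shows "\<exists>j<m. (\<Sum>i<p. x $ i * A $$ (i, j)) \<le> game_val A"
proof (rule ccontr)
  assume neg: "\<not> ?thesis"
  let ?f = "\<lambda>j. \<Sum>i<p. x $ i * A $$ (i, j)"
  have "Min (?f ` {..<m}) \<in> ?f ` {..<m}" using m by (intro Min_in) auto
  then have "game_val A < Min (?f ` {..<m})" using neg by force
  moreover have "Min (?f ` {..<m}) \<le> game_val A"
  proof (rule game_val_ge[OF A m x])
    fix y assume y: "y \<in> mixed m"
    show "Min (?f ` {..<m}) \<le> game_payoff A x y"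
      unfolding game_payoff_by_cols[OF A mixed_carrier[OF x] mixed_carrier[OF y]]
      by (intro mixed_average_ge[OF y]) auto
  qed
  ultimately show False by simp
qed

text \<open>A pure reply that holds \<open>x\<close> down to the value of \<open>B\<close> concedes at most \<open>d\<close> more in \<open>A\<close>.\<close>

lemma game_val_lipschitz:
  assumes A: "A \<in> carrier_mat p m" and B: "B \<in> carrier_mat p m" and p: "0 < p" "0 < m"
    and d: "\<And>i j. i < p \<Longrightarrow> j < m \<Longrightarrow> A $$ (i, j) \<le> B $$ (i, j) + d"
  shows "game_val A \<le> game_val B + d"
proof (rule game_val_le[OF A p(1)])
  fix x assume x: "x \<in> mixed p"
  obtain j where j: "j < m" "(\<Sum>i<p. x $ i * B $$ (i, j)) \<le> game_val B"
    using game_pure_reply[OF B p(2) x] by blast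
  have "(\<Sum>i<p. x $ i * (A $$ (i, j) - B $$ (i, j))) \<le> d"
    using d j(1) by (intro mixed_average_le[OF x]) (simp add: algebra_simps)
  then have "(\<Sum>i<p. x $ i * A $$ (i, j)) \<le> game_val B + d"
    using j(2) by (simp add: right_diff_distrib sum_subtractf)
  then show "\<exists>y\<in>mixed m. game_payoff A x y \<le> game_val B + d"
    using mixed_unit[OF j(1)] game_payoff_unit[OF A mixed_carrier[OF x] j(1)] by metis
qed

section \<open>Pencils with an equalizing pair of strategies\<close>

lemma game_val_ge_cols:
  assumes A: "A \<in> carrier_mat p m" and m: "0 < m" and x: "x \<in> mixed p"
    and c: "\<And>j. j < m \<Longrightarrow> c \<le> (\<Sum>i<p. x $ i * A $$ (i, j))"
  shows "c \<le> game_val A"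
proof (rule game_val_ge[OF A m x])
  fix y assume y: "y \<in> mixed m"
  show "c \<le> game_payoff A x y"
    unfolding game_payoff_by_cols[OF A mixed_carrier[OF x] mixed_carrier[OF y]]
    by (intro mixed_average_ge[OF y] c)
qed

lemma game_val_le_rows:
  assumes A: "A \<in> carrier_mat p m" and p: "0 < p" and y: "y \<in> mixed m"
    and c: "\<And>i. i < p \<Longrightarrow> (\<Sum>j<m. A $$ (i, j) * y $ j) \<le> c"
  shows "game_val A \<le> c"
proof (rule game_val_le[OF A p])
  fix x assume x: "x \<in> mixed p"
  have "game_payoff A x y \<le> c"
    unfolding game_payoff_by_rows[OF A mixed_carrier[OF x] mixed_carrier[OF y]]
    by (intro mixed_average_le[OF x] c)
  then show "\<exists>y\<in>mixed m. game_payoff A x y \<le> c" using y by blast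
qed

text \<open>In the game \<open>A - v B\<close> both \<open>x\<close> and \<open>y\<close> make the opponent indifferent, at payoff zero, and all
  entries of \<open>B\<close> have the same strict sign. In the application \<open>A\<close> and \<open>B\<close> are auxiliary matrices,
  \<open>v\<close> is a discounted value and \<open>\<epsilon>\<close> is \<open>(-1)\<^sup>n\<close>.\<close>

locale balanced_pencil =
  fixes m :: nat and A B :: "real mat" and x y :: "real vec" and v \<epsilon> :: real
  assumes A: "A \<in> carrier_mat m m" and B: "B \<in> carrier_mat m m"
    and x: "x \<in> mixed m" and y: "y \<in> mixed m"
    and left: "\<And>j. j < m \<Longrightarrow> (\<Sum>i<m. x $ i * A $$ (i, j)) = v * (\<Sum>i<m. x $ i * B $$ (i, j))"
    and right: "\<And>i. i < m \<Longrightarrow> (\<Sum>j<m. A $$ (i, j) * y $ j) = v * (\<Sum>j<m. B $$ (i, j) * y $ j)"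
    and pos: "\<And>i j. i < m \<Longrightarrow> j < m \<Longrightarrow> 0 < \<epsilon> * B $$ (i, j)"
begin

lemma m_pos: "0 < m"
  using x by (cases m) (auto simp: mixed_def)

lemma positive_lower_bound: "\<exists>c>0. \<forall>i<m. \<forall>j<m. c \<le> \<epsilon> * B $$ (i, j)"
proof -
  let ?S = "(\<lambda>(i, j). \<epsilon> * B $$ (i, j)) ` ({..<m} \<times> {..<m})"
  have "Min ?S \<in> ?S" using m_pos by (intro Min_in) auto
  then have "0 < Min ?S" using pos by auto
  moreover have "Min ?S \<le> \<epsilon> * B $$ (i, j)" if "i < m" "j < m" for i j
    using that by (intro Min_le) auto
  ultimately show ?thesis by blast
qed

text \<open>Against every pure strategy, \<open>x\<close> and \<open>y\<close> yield \<open>v - w\<close> times a positive amount, so the value has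
  the sign of \<open>v - w\<close>.\<close>

lemma game_val_zero_iff: "game_val (\<epsilon> \<cdot>\<^sub>m (A - w \<cdot>\<^sub>m B)) = 0 \<longleftrightarrow> w = v"
proof -
  let ?M = "\<epsilon> \<cdot>\<^sub>m (A - w \<cdot>\<^sub>m B)"
  have M: "?M \<in> carrier_mat m m" using B by (intro smult_carrier_mat minus_carrier_mat)
  have ent: "?M $$ (i, j) = \<epsilon> * A $$ (i, j) - w * (\<epsilon> * B $$ (i, j))" if "i < m" "j < m" for i j
    using that A B by (simp add: algebra_simps)
  have cols: "(\<Sum>i<m. x $ i * ?M $$ (i, j)) = (v - w) * (\<Sum>i<m. x $ i * (\<epsilon> * B $$ (i, j)))" if "j < m" for j
  proof -
    have "(\<Sum>i<m. x $ i * ?M $$ (i, j)) = \<epsilon> * (\<Sum>i<m. x $ i * A $$ (i, j)) - w * (\<epsilon> * (\<Sum>i<m. x $ i * B $$ (i, j)))"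
      unfolding sum_distrib_left sum_subtractf[symmetric]
      by (intro sum.cong refl) (simp add: ent that algebra_simps)
    also have "\<dots> = (v - w) * (\<epsilon> * (\<Sum>i<m. x $ i * B $$ (i, j)))"
      unfolding left[OF that] by (simp add: algebra_simps)
    finally show ?thesis by (simp add: sum_distrib_left mult.left_commute)
  qed
  have rows: "(\<Sum>j<m. ?M $$ (i, j) * y $ j) = (v - w) * (\<Sum>j<m. y $ j * (\<epsilon> * B $$ (i, j)))" if "i < m" for i
  proof -
    have "(\<Sum>j<m. ?M $$ (i, j) * y $ j) = \<epsilon> * (\<Sum>j<m. A $$ (i, j) * y $ j) - w * (\<epsilon> * (\<Sum>j<m. B $$ (i, j) * y $ j))"
      unfolding sum_distrib_left sum_subtractf[symmetric]
      by (intro sum.cong refl) (simp add: ent that algebra_simps)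
    also have "\<dots> = (v - w) * (\<epsilon> * (\<Sum>j<m. B $$ (i, j) * y $ j))"
      unfolding right[OF that] by (simp add: algebra_simps)
    finally show ?thesis by (simp add: sum_distrib_left algebra_simps)
  qed
  obtain c where c: "0 < c" "\<And>i j. i < m \<Longrightarrow> j < m \<Longrightarrow> c \<le> \<epsilon> * B $$ (i, j)"
    using positive_lower_bound by blast
  have xc: "c \<le> (\<Sum>i<m. x $ i * (\<epsilon> * B $$ (i, j)))" if "j < m" for j
    using that c by (intro mixed_average_ge[OF x]) auto
  have yc: "c \<le> (\<Sum>j<m. y $ j * (\<epsilon> * B $$ (i, j)))" if "i < m" for i
    using that c by (intro mixed_average_ge[OF y]) auto
  consider "w < v" | "w = v" | "v < w" by linarith
  then show ?thesis
  proof cases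
    case 1
    have "(v - w) * c \<le> game_val ?M"
      using 1 xc by (intro game_val_ge_cols[OF M m_pos x]) (auto simp: cols intro!: mult_left_mono)
    moreover have "0 < (v - w) * c" using 1 c by simp
    ultimately show ?thesis using 1 by auto
  next
    case 2
    have "0 \<le> game_val ?M" by (rule game_val_ge_cols[OF M m_pos x]) (subst cols, simp_all add: 2)
    moreover have "game_val ?M \<le> 0" by (rule game_val_le_rows[OF M m_pos y]) (subst rows, simp_all add: 2)
    ultimately show ?thesis using 2 by simp
  next
    case 3
    have "game_val ?M \<le> (v - w) * c"
      using 3 yc by (intro game_val_le_rows[OF M m_pos y]) (auto simp: rows intro!: mult_left_mono_neg)
    moreover have "(v - w) * c < 0" using 3 c by (simp add: mult_neg_pos)
    ultimately show ?thesis using 3 by auto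
  qed
qed

lemma rank_drop: "\<exists>w. vec_space.rank m (A - v \<cdot>\<^sub>m B) < vec_space.rank m (A - w \<cdot>\<^sub>m B)"
proof -
  let ?N = "A - v \<cdot>\<^sub>m B"
  have N: "?N \<in> carrier_mat m m" using B by (intro smult_carrier_mat minus_carrier_mat)
  have xm: "x \<in> carrier_vec m" and ym: "y \<in> carrier_vec m" using x y by (auto simp: mixed_def)
  have xN: "transpose_mat ?N *\<^sub>v x = 0\<^sub>v m"
  proof (rule eq_vecI)
    fix j assume "j < dim_vec (0\<^sub>v m :: real vec)"
    then have j: "j < m" by simp
    have "(transpose_mat ?N *\<^sub>v x) $ j = (\<Sum>i<m. x $ i * A $$ (i, j)) - v * (\<Sum>i<m. x $ i * B $$ (i, j))"
      using j N A B xm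
      by (simp add: scalar_prod_def atLeast0LessThan sum_distrib_left sum_subtractf[symmetric] algebra_simps)
    then show "(transpose_mat ?N *\<^sub>v x) $ j = 0\<^sub>v m $ j" using left[OF j] j by simp
  qed (use N B in simp)
  have Ny: "?N *\<^sub>v y = 0\<^sub>v m"
  proof (rule eq_vecI)
    fix i assume "i < dim_vec (0\<^sub>v m :: real vec)"
    then have i: "i < m" by simp
    have "(?N *\<^sub>v y) $ i = (\<Sum>j<m. A $$ (i, j) * y $ j) - v * (\<Sum>j<m. B $$ (i, j) * y $ j)"
      using i N A B ym
      by (simp add: scalar_prod_def atLeast0LessThan sum_distrib_left sum_subtractf[symmetric] algebra_simps)
    then show "(?N *\<^sub>v y) $ i = 0\<^sub>v m $ i" using right[OF i] i by simp
  qed (use N B in simp)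
  obtain c where c: "0 < c" "\<And>i j. i < m \<Longrightarrow> j < m \<Longrightarrow> c \<le> \<epsilon> * B $$ (i, j)"
    using positive_lower_bound by blast
  have "c \<le> game_payoff (\<epsilon> \<cdot>\<^sub>m B) x y"
    using B c by (intro game_payoff_bounds(2)[OF _ x y]) auto
  also have "\<dots> = \<epsilon> * (x \<bullet> (B *\<^sub>v y))"
  proof -
    have "game_payoff (\<epsilon> \<cdot>\<^sub>m B) x y = \<epsilon> * game_payoff B x y"
      using B by (simp add: game_payoff_sum[OF _ xm ym] sum_distrib_left algebra_simps)
    then show ?thesis by (simp add: game_payoff_def)
  qed
  finally have "x \<bullet> (B *\<^sub>v y) \<noteq> 0" using c(1) by auto
  from pencil_rank_increases[OF N B xm ym xN Ny this]
  obtain t where t: "vec_space.rank m ?N < vec_space.rank m (?N + t \<cdot>\<^sub>m B)" by blast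
  have "?N + t \<cdot>\<^sub>m B = A - (v - t) \<cdot>\<^sub>m B" using A B by (intro eq_matI) (auto simp: algebra_simps)
  then show ?thesis using t by metis
qed

lemma rank_lt_Max:
  "vec_space.rank m (A - v \<cdot>\<^sub>m B) < Max (range (\<lambda>w. vec_space.rank m (A - w \<cdot>\<^sub>m B)))"
    and finite_ranks: "finite (range (\<lambda>w. vec_space.rank m (A - w \<cdot>\<^sub>m B)))"
proof -
  have "vec_space.rank m (A - w \<cdot>\<^sub>m B) \<le> m" for w
    using A B by (intro vec_space.rank_le_nc) auto
  then have "range (\<lambda>w. vec_space.rank m (A - w \<cdot>\<^sub>m B)) \<subseteq> {..m}" by auto
  then show fin: "finite (range (\<lambda>w. vec_space.rank m (A - w \<cdot>\<^sub>m B)))" using finite_subset by blast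
  obtain w where "vec_space.rank m (A - v \<cdot>\<^sub>m B) < vec_space.rank m (A - w \<cdot>\<^sub>m B)" using rank_drop by blast
  also have "\<dots> \<le> Max (range (\<lambda>w. vec_space.rank m (A - w \<cdot>\<^sub>m B)))" using fin by (intro Max_ge) auto
  finally show "vec_space.rank m (A - v \<cdot>\<^sub>m B) < Max (range (\<lambda>w. vec_space.rank m (A - w \<cdot>\<^sub>m B)))" .
qed

definition poly_pencil :: "real poly mat" where
  "poly_pencil = mat m m (\<lambda>(i, j). [:A $$ (i, j), - B $$ (i, j):])"

text \<open>Where the rank of the pencil is maximal there is a nonzero minor of that size; at \<open>v\<close>, where the rank
  is smaller, this minor has to vanish.\<close>

lemma annihilating_minor:
  "\<exists>R C. R \<noteq> {} \<and> R \<subseteq> {..<m} \<and> C \<subseteq> {..<m} \<and> card R = card C \<and>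
     det (submatrix poly_pencil R C) \<noteq> 0 \<and> poly (det (submatrix poly_pencil R C)) v = 0 \<and>
     degree (det (submatrix poly_pencil R C)) \<le> vec_space.rank m B"
proof -
  let ?rk = "\<lambda>w. vec_space.rank m (A - w \<cdot>\<^sub>m B)"
  have P: "poly_pencil \<in> carrier_mat m m" by (simp add: poly_pencil_def)
  have "Max (range ?rk) \<in> range ?rk" using finite_ranks by (intro Max_in) auto
  then obtain w0 where w0: "?rk v < ?rk w0" using rank_lt_Max by auto
  have N: "A - w \<cdot>\<^sub>m B \<in> carrier_mat m m" for w using B by (intro smult_carrier_mat minus_carrier_mat)
  obtain R C where R: "R \<subseteq> {..<m}" "card R = ?rk w0" and C: "C \<subseteq> {..<m}" "card C = ?rk w0"
    and det0: "det (submatrix (A - w0 \<cdot>\<^sub>m B) R C) \<noteq> 0"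
    using rank_minor_exists[OF N] by blast
  have sets: "{i. i < m \<and> i \<in> R} = R" "{j. j < m \<and> j \<in> C} = C" using R C by auto
  let ?q = "det (submatrix poly_pencil R C)"
  have eval: "poly ?q w = det (submatrix (A - w \<cdot>\<^sub>m B) R C)" for w
  proof -
    have e: "comm_ring_hom (\<lambda>p::real poly. poly p w)" by unfold_locales auto
    have "map_mat (\<lambda>p. poly p w) (submatrix poly_pencil R C) = submatrix (A - w \<cdot>\<^sub>m B) R C"
    proof (rule eq_matI)
      fix i j assume "i < dim_row (submatrix (A - w \<cdot>\<^sub>m B) R C)" "j < dim_col (submatrix (A - w \<cdot>\<^sub>m B) R C)"
      then have ij: "i < card R" "j < card C" using N[of w] A B sets by (auto simp: dim_submatrix)
      have "pick R i < m" "pick C j < m" using pick_in_set_le[OF ij(1)] pick_in_set_le[OF ij(2)] R C by auto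
      then show "map_mat (\<lambda>p. poly p w) (submatrix poly_pencil R C) $$ (i, j) = submatrix (A - w \<cdot>\<^sub>m B) R C $$ (i, j)"
        using ij A B P sets by (simp add: submatrix_def poly_pencil_def)
    qed (use A B P sets in \<open>simp_all add: dim_submatrix\<close>)
    then show ?thesis using comm_ring_hom.hom_det[OF e, of "submatrix poly_pencil R C"] by simp
  qed
  have "?q \<noteq> 0" using det0 eval[of w0] by auto
  moreover have "poly ?q v = 0"
  proof (rule ccontr)
    assume "poly ?q v \<noteq> 0"
    then have "card {j. j < m \<and> j \<in> C} \<le> ?rk v"
      using vec_space.rank_gt_minor[OF N[of v], of R C] eval[of v] by simp
    then show False using w0 C sets by simp
  qed
  moreover have "degree ?q \<le> vec_space.rank m B"
  proof -
    define \<rho> where "\<rho> = vec_space.rank m B"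
    obtain U V where U: "U \<in> carrier_mat m \<rho>" and V: "V \<in> carrier_mat \<rho> m"
      and BUV: "B = U * V"
      using rank_factorization[OF B] unfolding \<rho>_def by blast
    define s where "s = card R"
    have sC: "card C = s" using R C by (simp add: s_def)
    \<comment> \<open>the pencil is \<open>A - w B\<close>, so the sign of \<open>B\<close> is absorbed in \<open>U'\<close>\<close>
    define U' where "U' = mat s \<rho> (\<lambda>(i, j). - U $$ (pick R i, j))"
    define V' where "V' = mat \<rho> s (\<lambda>(i, j). V $$ (i, pick C j))"
    define A' where "A' = submatrix A R C"
    have c: "A' \<in> carrier_mat s s" "U' \<in> carrier_mat s \<rho>" "V' \<in> carrier_mat \<rho> s"
      using A sets sC by (auto simp: A'_def U'_def V'_def submatrix_def s_def)
    have "submatrix poly_pencil R C = mat s s (\<lambda>(i, j). [:A' $$ (i, j), (U' * V') $$ (i, j):])"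
    proof (rule eq_matI)
      fix i j assume "i < dim_row (mat s s (\<lambda>(i, j). [:A' $$ (i, j), (U' * V') $$ (i, j):]))"
        "j < dim_col (mat s s (\<lambda>(i, j). [:A' $$ (i, j), (U' * V') $$ (i, j):]))"
      then have ij: "i < s" "j < s" by auto
      have pk: "pick R i < m" "pick C j < m"
        using pick_in_set_le[of i R] pick_in_set_le[of j C] ij R C sC s_def by auto
      have "(U' * V') $$ (i, j) = - B $$ (pick R i, pick C j)"
        unfolding BUV using ij pk U V c by (simp add: scalar_prod_def U'_def V'_def sum_negf)
      then show "submatrix poly_pencil R C $$ (i, j) = mat s s (\<lambda>(i, j). [:A' $$ (i, j), (U' * V') $$ (i, j):]) $$ (i, j)"
        using ij pk P A sets sC by (simp add: submatrix_def A'_def poly_pencil_def s_def)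
    qed (use P sets sC s_def in \<open>auto simp: dim_submatrix\<close>)
    then show ?thesis using degree_det_low_rank_pencil[OF c] by (simp add: \<rho>_def)
  qed
  moreover have "R \<noteq> {}" using w0 R by auto
  ultimately show ?thesis using R C by (intro exI[of _ R] exI[of _ C]) simp
qed
end

section \<open>The law of a play\<close>

definition next_law :: "stoch_game \<Rightarrow> (nat \<Rightarrow> nat pmf) \<Rightarrow> (nat \<Rightarrow> nat pmf) \<Rightarrow>
    nat \<times> nat \<times> nat \<Rightarrow> (nat \<times> nat \<times> nat) pmf" where
  "next_law G x y t = (case t of (l, i, j) \<Rightarrow> bind_pmf (trans_law G l i j) (stage_law x y))"

text \<open>The law of the triple observed at stage \<open>m + 1\<close>.\<close>

primrec marginal_law :: "stoch_game \<Rightarrow> (nat \<Rightarrow> nat pmf) \<Rightarrow> (nat \<Rightarrow> nat pmf) \<Rightarrow> nat \<Rightarrow>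
    nat \<Rightarrow> (nat \<times> nat \<times> nat) pmf" where
  "marginal_law G x y k 0 = stage_law x y k"
| "marginal_law G x y k (Suc m) = bind_pmf (marginal_law G x y k m) (next_law G x y)"

text \<open>The kernel of a stage depends only on the preceding triple, so integrating over the last stage
  first yields the recursion of \<open>marginal_law\<close>.\<close>

lemma distr_play_law:
  "distr (play_law G x y k) (count_space UNIV) (\<lambda>\<omega>. \<omega> m) = measure_pmf (marginal_law G x y k m)"
proof -
  let ?M = "\<lambda>_::nat. count_space (UNIV :: (nat \<times> nat \<times> nat) set)"
  interpret IT: Ionescu_Tulcea "play_kernel G x y k" ?M
    by (rule play_kernel_Ionescu_Tulcea)
  have coord: "(\<lambda>\<omega>. \<omega> m) \<in> measurable (PiM {0..<Suc m} ?M) (count_space UNIV)" for m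
    using measurable_component_singleton[of m "{0..<Suc m}" ?M] by simp
  have sp0: "(\<lambda>_. undefined) \<in> space (PiM {0..<0::nat} ?M)" by (simp add: space_PiM)
  have step: "(\<integral>\<^sup>+\<omega>. f (\<omega> m) \<partial>IT.C 0 (Suc m) (\<lambda>_. undefined)) =
      (\<integral>\<^sup>+\<omega>. (\<integral>\<^sup>+t. f t \<partial>play_kernel G x y k m \<omega>) \<partial>IT.C 0 m (\<lambda>_. undefined))"
    for f :: "nat \<times> nat \<times> nat \<Rightarrow> ennreal" and m
  proof -
    have sC: "sets (IT.C 0 m (\<lambda>_. undefined)) = sets (PiM {0..<m} ?M)"
      using IT.sets_C[OF sp0, of m] by simp
    have mE: "IT.eP m \<in> measurable (IT.C 0 m (\<lambda>_. undefined)) (subprob_algebra (PiM {0..<Suc m} ?M))"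
      using IT.measurable_eP[of m] by (simp add: measurable_cong_sets[OF sC refl] del: IT.C.simps)
    have mf: "(\<lambda>\<omega>. f (\<omega> m)) \<in> borel_measurable (PiM {0..<Suc m} ?M)"
      by (rule measurable_compose[OF coord[of m]]) simp
    have "(\<integral>\<^sup>+\<omega>. f (\<omega> m) \<partial>IT.C 0 (Suc m) (\<lambda>_. undefined)) =
        (\<integral>\<^sup>+\<omega>. \<integral>\<^sup>+\<omega>'. f (\<omega>' m) \<partial>IT.eP m \<omega> \<partial>IT.C 0 m (\<lambda>_. undefined))"
      using nn_integral_bind[OF mf mE] by simp
    also have "\<dots> = (\<integral>\<^sup>+\<omega>. (\<integral>\<^sup>+t. f t \<partial>play_kernel G x y k m \<omega>) \<partial>IT.C 0 m (\<lambda>_. undefined))"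
    proof (intro nn_integral_cong)
      fix \<omega> assume "\<omega> \<in> space (IT.C 0 m (\<lambda>_. undefined))"
      then have w: "\<omega> \<in> space (PiM {0..<m} ?M)" using IT.space_C[OF sp0, of m] by simp
      show "(\<integral>\<^sup>+\<omega>'. f (\<omega>' m) \<partial>IT.eP m \<omega>) = (\<integral>\<^sup>+t. f t \<partial>play_kernel G x y k m \<omega>)"
        by (subst IT.nn_integral_eP[OF w mf]) simp
    qed
    finally show ?thesis .
  qed
  have C: "(\<integral>\<^sup>+\<omega>. f (\<omega> m) \<partial>IT.C 0 (Suc m) (\<lambda>_. undefined)) = (\<integral>\<^sup>+t. f t \<partial>measure_pmf (marginal_law G x y k m))"
    for f :: "nat \<times> nat \<times> nat \<Rightarrow> ennreal" and m
  proof (induction m arbitrary: f)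
    case 0
    show ?case
      unfolding step using prob_space.emeasure_space_1[OF IT.prob_space_C[OF sp0, of 0]]
      by (simp add: play_kernel_def del: IT.C.simps)
  next
    case (Suc m)
    have "play_kernel G x y k (Suc m) \<omega> = measure_pmf (next_law G x y (\<omega> m))" for \<omega>
      by (simp add: play_kernel_def next_law_def)
    then show ?case
      unfolding step using Suc.IH[of "\<lambda>t. \<integral>\<^sup>+t'. f t' \<partial>measure_pmf (next_law G x y t)"]
      by (simp del: IT.C.simps)
  qed
  have up: "IT.up_to {0..<Suc m} = Suc m"
    using IT.up_to_less[of "{0..<Suc m}" m] by (intro antisym) (auto simp: IT.up_to_iff)
  have sC: "sets (IT.C 0 (Suc m) (\<lambda>_. undefined)) = sets (PiM {0..<Suc m} ?M)"
    using IT.sets_C[OF sp0, of "Suc m"] by simp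
  have r1: "(\<lambda>\<omega>. restrict \<omega> {0..<Suc m}) \<in> measurable IT.PF.lim (PiM {0..<Suc m} ?M)"
    by (auto simp: measurable_cong_sets[OF IT.PF.sets_lim refl] intro!: measurable_restrict measurable_component_singleton)
  have r2: "(\<lambda>\<omega>. restrict \<omega> {0..<Suc m}) \<in> measurable (IT.C 0 (Suc m) (\<lambda>_. undefined)) (PiM {0..<Suc m} ?M)"
    by (auto simp: measurable_cong_sets[OF sC refl] simp del: IT.C.simps intro!: measurable_restrict measurable_component_singleton)
  have cC: "(\<lambda>\<omega>. \<omega> m) \<in> measurable (IT.C 0 (Suc m) (\<lambda>_. undefined)) (count_space UNIV)"
    using coord[of m] by (simp add: measurable_cong_sets[OF sC refl] del: IT.C.simps)
  have "distr IT.PF.lim (count_space UNIV) (\<lambda>\<omega>. \<omega> m) =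
      distr (distr IT.PF.lim (PiM {0..<Suc m} ?M) (\<lambda>\<omega>. restrict \<omega> {0..<Suc m})) (count_space UNIV) (\<lambda>\<omega>. \<omega> m)"
    by (subst distr_distr[OF coord r1]) (auto simp: comp_def intro!: distr_cong)
  also have "\<dots> = distr (IT.CI {0..<Suc m}) (count_space UNIV) (\<lambda>\<omega>. \<omega> m)"
    by (subst IT.distr_lim) auto
  also have "\<dots> = distr (IT.C 0 (Suc m) (\<lambda>_. undefined)) (count_space UNIV) (\<lambda>\<omega>. \<omega> m)"
    unfolding IT.CI_def up
    by (subst distr_distr[OF coord r2]) (auto simp: comp_def intro!: distr_cong simp del: IT.C.simps)
  also have "\<dots> = measure_pmf (marginal_law G x y k m)"
  proof (rule measure_eqI)
    fix X assume "X \<in> sets (distr (IT.C 0 (Suc m) (\<lambda>_. undefined)) (count_space UNIV) (\<lambda>\<omega>. \<omega> m))"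
    have "emeasure (distr (IT.C 0 (Suc m) (\<lambda>_. undefined)) (count_space UNIV) (\<lambda>\<omega>. \<omega> m)) X =
       (\<integral>\<^sup>+t. indicator X t \<partial>distr (IT.C 0 (Suc m) (\<lambda>_. undefined)) (count_space UNIV) (\<lambda>\<omega>. \<omega> m))"
      by (simp del: IT.C.simps)
    also have "\<dots> = (\<integral>\<^sup>+\<omega>. indicator X (\<omega> m) \<partial>IT.C 0 (Suc m) (\<lambda>_. undefined))"
      by (rule nn_integral_distr[OF cC]) simp
    also have "\<dots> = emeasure (measure_pmf (marginal_law G x y k m)) X"
      unfolding C by simp
    finally show "emeasure (distr (IT.C 0 (Suc m) (\<lambda>_. undefined)) (count_space UNIV) (\<lambda>\<omega>. \<omega> m)) X =
      emeasure (measure_pmf (marginal_law G x y k m)) X" .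
  qed simp
  finally show ?thesis by (simp add: play_law_def)
qed

lemma measurable_play_coordinate:
  "(\<lambda>\<omega>. \<omega> m) \<in> measurable (play_law G x y k) (count_space UNIV)"
proof -
  interpret IT: Ionescu_Tulcea "play_kernel G x y k" "\<lambda>_. count_space UNIV"
    by (rule play_kernel_Ionescu_Tulcea)
  show ?thesis
    using measurable_component_singleton[of m UNIV "\<lambda>_. count_space UNIV"]
    by (simp add: play_law_def measurable_cong_sets[OF IT.PF.sets_lim refl])
qed

lemma prob_space_play_law: "prob_space (play_law G x y k)"
proof (rule prob_space_distrD[OF measurable_play_coordinate])
  show "prob_space (distr (play_law G x y k) (count_space UNIV) (\<lambda>\<omega>. \<omega> 0))"
    unfolding distr_play_law by (rule measure_pmf.prob_space_axioms)
qed

text \<open>The definition of \<open>marginal_law\<close> splits off the last transition. The recursion for the discounted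
  payoff needs the first transition split off instead.\<close>

lemma marginal_law_Suc_shift:
  "marginal_law G x y k (Suc m) =
     bind_pmf (stage_law x y k) (\<lambda>(l, i, j). bind_pmf (trans_law G l i j) (\<lambda>l'. marginal_law G x y l' m))"
proof (induction m)
  case 0
  show ?case by (auto simp: next_law_def[abs_def] intro!: bind_pmf_cong)
next
  case (Suc m)
  show ?case
    unfolding marginal_law.simps(2)[of _ _ _ _ "Suc m"] Suc.IH
    by (simp add: bind_assoc_pmf split_beta)
qed

text \<open>Play stays in this finite set, on which the stage payoff is bounded.\<close>

definition legal_stages :: "stoch_game \<Rightarrow> (nat \<times> nat \<times> nat) set" where
  "legal_stages G = (SIGMA l:{1..nstates G}. {..<num_rows G l} \<times> {..<num_cols G l})"

lemma finite_legal_stages: "finite (legal_stages G)"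
  by (simp add: legal_stages_def)

definition payoff_at :: "stoch_game \<Rightarrow> nat \<times> nat \<times> nat \<Rightarrow> real" where
  "payoff_at G t = (case t of (l, i, j) \<Rightarrow> stage_payoff G l i j)"

lemma set_stage_law:
  assumes "x \<in> stationary (nstates G) (num_rows G)" "y \<in> stationary (nstates G) (num_cols G)"
    "k \<in> {1..nstates G}"
  shows "set_pmf (stage_law x y k) \<subseteq> legal_stages G"
  using assms by (force simp: stage_law_def stationary_def legal_stages_def)

lemma set_marginal_law:
  assumes G: "stochastic_game G"
    and xy: "x \<in> stationary (nstates G) (num_rows G)" "y \<in> stationary (nstates G) (num_cols G)"
    and k: "k \<in> {1..nstates G}"
  shows "set_pmf (marginal_law G x y k m) \<subseteq> legal_stages G"
proof (induction m)
  case 0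
  then show ?case using set_stage_law[OF xy k] by simp
next
  case (Suc m)
  have "set_pmf (next_law G x y t) \<subseteq> legal_stages G" if t: "t \<in> legal_stages G" for t
  proof -
    obtain l i j where lij: "t = (l, i, j)" by (cases t) auto
    then have "set_pmf (trans_law G l i j) \<subseteq> {1..nstates G}"
      using t G by (auto simp: legal_stages_def stochastic_game_def)
    then have "(\<Union>l'\<in>set_pmf (trans_law G l i j). set_pmf (stage_law x y l')) \<subseteq> legal_stages G"
      using set_stage_law[OF xy] by (intro UN_least) blast
    then show ?thesis by (simp add: next_law_def lij)
  qed
  then show ?case using Suc by auto
qed

lemma expectation_stage_law:
  assumes xy: "x \<in> stationary (nstates G) (num_rows G)" "y \<in> stationary (nstates G) (num_cols G)"
    and k: "k \<in> {1..nstates G}"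
  shows "measure_pmf.expectation (stage_law x y k) (h :: _ \<Rightarrow> real) =
    (\<Sum>i<num_rows G k. \<Sum>j<num_cols G k. pmf (x k) i * pmf (y k) j * h (k, i, j))"
proof -
  have sx: "set_pmf (x k) \<subseteq> {..<num_rows G k}" and sy: "set_pmf (y k) \<subseteq> {..<num_cols G k}"
    using xy k by (auto simp: stationary_def)
  have fy: "finite (set_pmf (y k))" using sy finite_subset by blast
  have "stage_law x y k = bind_pmf (x k) (\<lambda>i. bind_pmf (y k) (\<lambda>j. return_pmf (k, i, j)))"
    by (simp add: stage_law_def pair_pmf_def map_bind_pmf)
  also have "measure_pmf.expectation \<dots> h = (\<Sum>i<num_rows G k. pmf (x k) i *
      measure_pmf.expectation (bind_pmf (y k) (\<lambda>j. return_pmf (k, i, j))) h)"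
    using pmf_expectation_bind[of "{..<num_rows G k}" "\<lambda>i. bind_pmf (y k) (\<lambda>j. return_pmf (k, i, j))" "x k" h]
      sx fy by simp
  also have "\<dots> = (\<Sum>i<num_rows G k. pmf (x k) i * (\<Sum>j<num_cols G k. pmf (y k) j * h (k, i, j)))"
    using sy by (intro sum.cong refl arg_cong2[of _ _ _ _ "(*)"])
      (subst pmf_expectation_bind[of "{..<num_cols G k}"], auto)
  finally show ?thesis by (simp add: sum_distrib_left mult.assoc)
qed

lemma expectation_marginal_law_Suc:
  assumes G: "stochastic_game G"
    and xy: "x \<in> stationary (nstates G) (num_rows G)" "y \<in> stationary (nstates G) (num_cols G)"
    and k: "k \<in> {1..nstates G}"
  shows "measure_pmf.expectation (marginal_law G x y k (Suc m)) (h :: _ \<Rightarrow> real) =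
    (\<Sum>i<num_rows G k. \<Sum>j<num_cols G k. pmf (x k) i * pmf (y k) j *
       (\<Sum>l\<in>{1..nstates G}. pmf (trans_law G k i j) l * measure_pmf.expectation (marginal_law G x y l m) h))"
proof -
  let ?f = "\<lambda>(l, i, j). bind_pmf (trans_law G l i j) (\<lambda>l'. marginal_law G x y l' m)"
  have tr: "set_pmf (trans_law G l i j) \<subseteq> {1..nstates G}" if "(l, i, j) \<in> legal_stages G" for l i j
    using that G by (auto simp: legal_stages_def stochastic_game_def)
  have fin: "finite (set_pmf (marginal_law G x y l m))" if "l \<in> {1..nstates G}" for l
    using set_marginal_law[OF G xy that] finite_legal_stages finite_subset by blast
  have finf: "finite (set_pmf (?f t))" if t: "t \<in> legal_stages G" for t
  proof -
    obtain l i j where lij: "t = (l, i, j)" by (cases t) auto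
    have s: "set_pmf (trans_law G l i j) \<subseteq> {1..nstates G}" using tr t lij by blast
    then have "finite (set_pmf (trans_law G l i j))" using finite_subset by blast
    then show ?thesis using s fin by (auto simp: lij)
  qed
  have sub: "set_pmf (stage_law x y k) \<subseteq> legal_stages G" by (rule set_stage_law[OF xy k])
  have fs: "finite (set_pmf (stage_law x y k))" using sub finite_legal_stages finite_subset by blast
  have "measure_pmf.expectation (marginal_law G x y k (Suc m)) h =
      (\<Sum>t\<in>legal_stages G. pmf (stage_law x y k) t * measure_pmf.expectation (?f t) h)"
    unfolding marginal_law_Suc_shift
    using pmf_expectation_bind[OF finite_legal_stages finf sub, where h = h] by simp
  also have "\<dots> = measure_pmf.expectation (stage_law x y k) (\<lambda>t. measure_pmf.expectation (?f t) h)"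
    by (subst integral_measure_pmf[OF finite_legal_stages]) (use sub in auto)
  also have "\<dots> = (\<Sum>i<num_rows G k. \<Sum>j<num_cols G k. pmf (x k) i * pmf (y k) j *
       measure_pmf.expectation (?f (k, i, j)) h)"
    by (rule expectation_stage_law[OF xy k])
  also have "\<dots> = (\<Sum>i<num_rows G k. \<Sum>j<num_cols G k. pmf (x k) i * pmf (y k) j *
       (\<Sum>l\<in>{1..nstates G}. pmf (trans_law G k i j) l * measure_pmf.expectation (marginal_law G x y l m) h))"
  proof (intro sum.cong refl arg_cong2[of _ _ _ _ "(*)"])
    fix i j assume "i \<in> {..<num_rows G k}" "j \<in> {..<num_cols G k}"
    then have "(k, i, j) \<in> legal_stages G" using k by (auto simp: legal_stages_def)
    then show "measure_pmf.expectation (?f (k, i, j)) h =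
      (\<Sum>l\<in>{1..nstates G}. pmf (trans_law G k i j) l * measure_pmf.expectation (marginal_law G x y l m) h)"
      using pmf_expectation_bind[of "{1..nstates G}" "\<lambda>l'. marginal_law G x y l' m" "trans_law G k i j" h] tr fin by simp
  qed
  finally show ?thesis .
qed

text \<open>Almost surely all stages are legal, so the discounted sum is dominated by a geometric series and may
  be integrated term by term.\<close>

lemma discounted_payoff_sums:
  assumes G: "stochastic_game G" and lam: "0 < lam" "lam \<le> 1"
    and xy: "x \<in> stationary (nstates G) (num_rows G)" "y \<in> stationary (nstates G) (num_cols G)"
    and k: "k \<in> {1..nstates G}"
  shows "(\<lambda>m. lam * (1 - lam) ^ m * measure_pmf.expectation (marginal_law G x y k m) (payoff_at G))
    sums discounted_payoff G lam x y k"
proof -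
  interpret prob_space "play_law G x y k" by (rule prob_space_play_law)
  note coord [measurable] = measurable_play_coordinate[of _ G x y k]
  define g where "g t = (if t \<in> legal_stages G then payoff_at G t else 0)" for t
  define B where "B = (\<Sum>t\<in>legal_stages G. \<bar>payoff_at G t\<bar>)"
  have gB: "\<bar>g t\<bar> \<le> B" for t
    unfolding g_def B_def using finite_legal_stages
    by (auto intro!: member_le_sum sum_nonneg)
  have geo: "summable (\<lambda>m. lam * (1 - lam) ^ m * B)"
    using lam by (intro summable_mult2 summable_mult summable_geometric) auto
  have AEm: "AE \<omega> in play_law G x y k. \<omega> m \<in> legal_stages G" for m
  proof -
    have "AE t in distr (play_law G x y k) (count_space UNIV) (\<lambda>\<omega>. \<omega> m). t \<in> legal_stages G"
      unfolding distr_play_law using set_marginal_law[OF G xy k, of m]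
      by (auto simp: AE_measure_pmf_iff)
    then show ?thesis by (subst (asm) AE_distr_iff[OF coord]) auto
  qed
  have mg: "(\<lambda>\<omega>. h (\<omega> m)) \<in> borel_measurable (play_law G x y k)" for h :: "_ \<Rightarrow> real" and m
    by (rule measurable_compose[OF coord]) simp
  have "discounted_payoff G lam x y k = (\<integral>\<omega>. (\<Sum>m. lam * (1 - lam) ^ m * payoff_at G (\<omega> m)) \<partial>play_law G x y k)"
    by (simp add: discounted_payoff_def payoff_at_def)
  also have "\<dots> = (\<integral>\<omega>. (\<Sum>m. lam * (1 - lam) ^ m * g (\<omega> m)) \<partial>play_law G x y k)"
  proof (rule integral_cong_AE)
    show "(\<lambda>\<omega>. \<Sum>m. lam * (1 - lam) ^ m * payoff_at G (\<omega> m)) \<in> borel_measurable (play_law G x y k)"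
      "(\<lambda>\<omega>. \<Sum>m. lam * (1 - lam) ^ m * g (\<omega> m)) \<in> borel_measurable (play_law G x y k)"
      by (intro borel_measurable_suminf borel_measurable_times borel_measurable_const mg)+
    have "AE \<omega> in play_law G x y k. \<forall>m. \<omega> m \<in> legal_stages G"
      using AEm by (simp add: AE_all_countable)
    then show "AE \<omega> in play_law G x y k. (\<Sum>m. lam * (1 - lam) ^ m * payoff_at G (\<omega> m)) =
        (\<Sum>m. lam * (1 - lam) ^ m * g (\<omega> m))"
      by eventually_elim (simp add: g_def)
  qed
  finally have eq: "discounted_payoff G lam x y k = \<dots>" .
  have bnd: "norm (lam * (1 - lam) ^ m * g t) \<le> lam * (1 - lam) ^ m * B" for m t
    using lam gB[of t] by (simp add: abs_mult mult_left_mono)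
  have int: "integrable (play_law G x y k) (\<lambda>\<omega>. lam * (1 - lam) ^ m * g (\<omega> m))" for m
    by (rule integrable_const_bound[where B = "lam * (1 - lam) ^ m * B"])
      (auto intro!: AE_I2 bnd[unfolded real_norm_def] borel_measurable_times mg)
  have "(\<lambda>m. \<integral>\<omega>. lam * (1 - lam) ^ m * g (\<omega> m) \<partial>play_law G x y k) sums
      (\<integral>\<omega>. (\<Sum>m. lam * (1 - lam) ^ m * g (\<omega> m)) \<partial>play_law G x y k)"
  proof (rule sums_integral[OF int])
    show "AE \<omega> in play_law G x y k. summable (\<lambda>m. norm (lam * (1 - lam) ^ m * g (\<omega> m)))"
      using bnd by (intro AE_I2 summable_comparison_test'[OF geo, of 0]) auto
    have "norm (\<integral>\<omega>. norm (lam * (1 - lam) ^ m * g (\<omega> m)) \<partial>play_law G x y k) \<le> lam * (1 - lam) ^ m * B" for m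
    proof -
      have "(\<integral>\<omega>. norm (lam * (1 - lam) ^ m * g (\<omega> m)) \<partial>play_law G x y k) \<le> lam * (1 - lam) ^ m * B"
        using int by (intro integral_le_const integrable_norm AE_I2 bnd)
      then show ?thesis by simp
    qed
    then show "summable (\<lambda>m. \<integral>\<omega>. norm (lam * (1 - lam) ^ m * g (\<omega> m)) \<partial>play_law G x y k)"
      by (intro summable_comparison_test'[OF geo, of 0]) auto
  qed
  moreover have "(\<lambda>m. \<integral>\<omega>. lam * (1 - lam) ^ m * g (\<omega> m) \<partial>play_law G x y k) =
      (\<lambda>m. lam * (1 - lam) ^ m * measure_pmf.expectation (marginal_law G x y k m) (payoff_at G))"
  proof
    fix m
    have "(\<integral>\<omega>. g (\<omega> m) \<partial>play_law G x y k) = measure_pmf.expectation (marginal_law G x y k m) g"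
      unfolding distr_play_law[symmetric] by (rule integral_distr[symmetric, OF coord]) simp
    also have "\<dots> = measure_pmf.expectation (marginal_law G x y k m) (payoff_at G)"
      using set_marginal_law[OF G xy k, of m]
      by (intro integral_cong_AE) (auto simp: AE_measure_pmf_iff g_def)
    finally show "(\<integral>\<omega>. lam * (1 - lam) ^ m * g (\<omega> m) \<partial>play_law G x y k) =
      lam * (1 - lam) ^ m * measure_pmf.expectation (marginal_law G x y k m) (payoff_at G)" by simp
  qed
  ultimately show ?thesis by (simp only: eq)
qed

lemma double_sum_affine:
  fixes p :: "nat \<Rightarrow> nat \<Rightarrow> real"
  shows "(\<Sum>i<a. \<Sum>j<b. p i j * (c * f i j + d * h i j)) =
    c * (\<Sum>i<a. \<Sum>j<b. p i j * f i j) + d * (\<Sum>i<a. \<Sum>j<b. p i j * h i j)"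
  by (simp add: sum_distrib_left sum.distrib algebra_simps)

lemma discounted_payoff_recursion:
  assumes G: "stochastic_game G" and lam: "0 < lam" "lam \<le> 1"
    and xy: "x \<in> stationary (nstates G) (num_rows G)" "y \<in> stationary (nstates G) (num_cols G)"
    and k: "k \<in> {1..nstates G}"
  shows "discounted_payoff G lam x y k = (\<Sum>i<num_rows G k. \<Sum>j<num_cols G k. pmf (x k) i * pmf (y k) j *
     (lam * stage_payoff G k i j +
      (1 - lam) * (\<Sum>l\<in>{1..nstates G}. pmf (trans_law G k i j) l * discounted_payoff G lam x y l)))"
proof -
  let ?E = "\<lambda>l m. measure_pmf.expectation (marginal_law G x y l m) (payoff_at G)"
  let ?S = "\<lambda>f. \<Sum>i<num_rows G k. \<Sum>j<num_cols G k. pmf (x k) i * pmf (y k) j *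
     (\<Sum>l\<in>{1..nstates G}. pmf (trans_law G k i j) l * f l)"
  have "(\<lambda>m. (1 - lam) * ?S (\<lambda>l. lam * (1 - lam) ^ m * ?E l m)) sums
      ((1 - lam) * ?S (\<lambda>l. discounted_payoff G lam x y l))"
    by (intro sums_mult sums_sum discounted_payoff_sums[OF G lam xy])
  moreover have "(\<lambda>m. (1 - lam) * ?S (\<lambda>l. lam * (1 - lam) ^ m * ?E l m)) = (\<lambda>m. lam * (1 - lam) ^ Suc m * ?E k (Suc m))"
    unfolding expectation_marginal_law_Suc[OF G xy k] sum_distrib_left
    by (intro ext sum.cong refl) (simp add: algebra_simps)
  ultimately have "(\<lambda>m. lam * (1 - lam) ^ Suc m * ?E k (Suc m)) sums
      ((1 - lam) * ?S (\<lambda>l. discounted_payoff G lam x y l))" by (simp only:)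
  then have "(\<lambda>m. lam * (1 - lam) ^ m * ?E k m) sums
      ((1 - lam) * ?S (\<lambda>l. discounted_payoff G lam x y l) + lam * (1 - lam) ^ 0 * ?E k 0)"
    by (rule sums_Suc)
  then have "discounted_payoff G lam x y k =
     (1 - lam) * ?S (\<lambda>l. discounted_payoff G lam x y l) + lam * ?E k 0"
    using sums_unique2[OF discounted_payoff_sums[OF G lam xy k]] by simp
  also have "?E k 0 = (\<Sum>i<num_rows G k. \<Sum>j<num_cols G k. pmf (x k) i * pmf (y k) j * stage_payoff G k i j)"
    using expectation_stage_law[OF xy k, of "payoff_at G"] by (simp add: payoff_at_def)
  finally show ?thesis
    unfolding double_sum_affine by simp
qed

section \<open>The fixed point theorem of Shapley\<close>

lemma local_game_carrier: "local_game G lam z k \<in> carrier_mat (num_rows G k) (num_cols G k)"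
  by (simp add: local_game_def)

lemma sum_trans_law:
  assumes G: "stochastic_game G" and k: "k \<in> {1..nstates G}" "i < num_rows G k" "j < num_cols G k"
  shows "(\<Sum>l\<in>{1..nstates G}. pmf (trans_law G k i j) l) = 1"
  using G k by (intro sum_pmf_eq_1) (auto simp: stochastic_game_def)

lemma game_val_local_contraction:
  assumes G: "stochastic_game G" and lam: "0 < lam" "lam \<le> 1" and k: "k \<in> {1..nstates G}"
    and d: "\<And>l. l \<in> {1..nstates G} \<Longrightarrow> \<bar>z l - z' l\<bar> \<le> d"
  shows "\<bar>game_val (local_game G lam z k) - game_val (local_game G lam z' k)\<bar> \<le> (1 - lam) * d"
proof -
  have pos: "0 < num_rows G k" "0 < num_cols G k" using G k by (auto simp: stochastic_game_def)
  have "game_val (local_game G lam u k) \<le> game_val (local_game G lam u' k) + (1 - lam) * d"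
    if uu: "\<And>l. l \<in> {1..nstates G} \<Longrightarrow> u l - u' l \<le> d" for u u'
  proof (rule game_val_lipschitz[OF local_game_carrier local_game_carrier pos])
    fix i j assume ij: "i < num_rows G k" "j < num_cols G k"
    have "(\<Sum>l\<in>{1..nstates G}. pmf (trans_law G k i j) l * (u l - u' l)) \<le>
        (\<Sum>l\<in>{1..nstates G}. pmf (trans_law G k i j) l * d)"
      using uu by (intro sum_mono mult_left_mono) auto
    also have "\<dots> = d" using sum_trans_law[OF G k ij] by (simp flip: sum_distrib_right)
    finally have "(1 - lam) * ((\<Sum>l\<in>{1..nstates G}. pmf (trans_law G k i j) l * u l) -
        (\<Sum>l\<in>{1..nstates G}. pmf (trans_law G k i j) l * u' l)) \<le> (1 - lam) * d"
      using lam by (intro mult_left_mono) (auto simp: right_diff_distrib sum_subtractf)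
    then show "local_game G lam u k $$ (i, j) \<le> local_game G lam u' k $$ (i, j) + (1 - lam) * d"
      using ij by (simp add: local_game_def right_diff_distrib)
  qed
  from this[of z z'] this[of z' z] d show ?thesis by (force simp: abs_le_iff)
qed

text \<open>Value iteration: successive differences decrease geometrically, so the iterates converge, and the
  limit is a fixed point by continuity.\<close>

lemma shapley_fixed_point_exists:
  assumes G: "stochastic_game G" and lam: "0 < lam" "lam \<le> 1"
  shows "\<exists>z. \<forall>k\<in>{1..nstates G}. z k = game_val (local_game G lam z k)"
proof -
  let ?K = "{1..nstates G}"
  define it where "it m = ((\<lambda>z k. game_val (local_game G lam z k)) ^^ m) (\<lambda>_. 0)" for m
  have it_Suc: "it (Suc m) k = game_val (local_game G lam (it m) k)" for m k
    by (simp add: it_def)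
  define B where "B = (\<Sum>l\<in>?K. \<bar>it 1 l - it 0 l\<bar>)"
  have step: "\<bar>it (Suc m) k - it m k\<bar> \<le> (1 - lam) ^ m * B" if "k \<in> ?K" for m k
    using that
  proof (induction m arbitrary: k)
    case 0
    have "\<bar>it 1 k - it 0 k\<bar> \<le> B" unfolding B_def using 0
      by (intro member_le_sum[of _ _ "\<lambda>l. \<bar>it 1 l - it 0 l\<bar>"]) auto
    then show ?case by simp
  next
    case (Suc m)
    have "\<bar>it (Suc (Suc m)) k - it (Suc m) k\<bar> \<le> (1 - lam) * ((1 - lam) ^ m * B)"
      unfolding it_Suc[of "Suc m"] it_Suc[of m k]
      by (rule game_val_local_contraction[OF G lam Suc.prems Suc.IH])
    then show ?case by simp
  qed
  have "convergent (\<lambda>m. it m k)" if k: "k \<in> ?K" for k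
  proof -
    have "summable (\<lambda>m. it (Suc m) k - it m k)"
    proof (rule summable_comparison_test')
      show "summable (\<lambda>m. (1 - lam) ^ m * B)"
        using lam by (intro summable_mult2 summable_geometric) auto
    qed (use step[OF k] in auto)
    then have "convergent (\<lambda>m. \<Sum>i<m. it (Suc i) k - it i k)"
      by (simp add: summable_iff_convergent)
    then have "convergent (\<lambda>m. (it m k - it 0 k) + it 0 k)"
      unfolding sum_lessThan_telescope[of "\<lambda>m. it m k"] by (intro convergent_add convergent_const)
    then show ?thesis by simp
  qed
  then have lim: "(\<lambda>m. it m k) \<longlonglongrightarrow> lim (\<lambda>m. it m k)" if "k \<in> ?K" for k
    using that by (simp add: convergent_LIMSEQ_iff)
  define z where "z k = lim (\<lambda>m. it m k)" for k
  have zlim: "(\<lambda>m. it m k) \<longlonglongrightarrow> z k" if "k \<in> ?K" for k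
    using lim[OF that] by (simp add: z_def)
  have "z k = game_val (local_game G lam z k)" if k: "k \<in> ?K" for k
  proof -
    have "(\<lambda>m. (1 - lam) * (\<Sum>l\<in>?K. \<bar>it m l - z l\<bar>)) \<longlonglongrightarrow> (1 - lam) * (\<Sum>l\<in>?K. \<bar>z l - z l\<bar>)"
      by (intro tendsto_intros zlim)
    then have to0: "(\<lambda>m. (1 - lam) * (\<Sum>l\<in>?K. \<bar>it m l - z l\<bar>)) \<longlonglongrightarrow> 0" by simp
    have "(\<lambda>m. it (Suc m) k - game_val (local_game G lam z k)) \<longlonglongrightarrow> 0"
    proof (rule tendsto_0_le[OF to0, of _ 1])
      have "\<bar>it (Suc m) k - game_val (local_game G lam z k)\<bar> \<le> (1 - lam) * (\<Sum>l\<in>?K. \<bar>it m l - z l\<bar>)" for m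
        unfolding it_Suc
        by (rule game_val_local_contraction[OF G lam k])
          (rule member_le_sum[of _ _ "\<lambda>l. \<bar>it m l - z l\<bar>"], auto)
      then show "\<forall>\<^sub>F m in sequentially. norm (it (Suc m) k - game_val (local_game G lam z k))
          \<le> norm ((1 - lam) * (\<Sum>l\<in>?K. \<bar>it m l - z l\<bar>)) * 1"
        unfolding real_norm_def mult_1_right
        by (intro always_eventually allI order_trans[OF _ abs_ge_self])
    qed
    then have "(\<lambda>m. it (Suc m) k) \<longlonglongrightarrow> game_val (local_game G lam z k)"
      by (simp add: LIM_zero_iff)
    moreover have "(\<lambda>m. it (Suc m) k) \<longlonglongrightarrow> z k" using zlim[OF k] by (rule LIMSEQ_Suc)
    ultimately show ?thesis by (rule LIMSEQ_unique[symmetric])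
  qed
  then show ?thesis by blast
qed

text \<open>At a state where \<open>u - w\<close> attains its maximum \<open>d\<close>, the assumptions give
  \<open>d \<le> lam * e + (1 - lam) * d\<close>.\<close>

lemma discounted_comparison:
  fixes P :: "nat \<Rightarrow> nat \<Rightarrow> real"
  assumes K: "finite K" and lam: "0 < lam" "lam \<le> 1"
    and P: "\<And>k l. k \<in> K \<Longrightarrow> l \<in> K \<Longrightarrow> 0 \<le> P k l" "\<And>k. k \<in> K \<Longrightarrow> (\<Sum>l\<in>K. P k l) = 1"
    and u: "\<And>k. k \<in> K \<Longrightarrow> u k = c k + (1 - lam) * (\<Sum>l\<in>K. P k l * u l)"
    and w: "\<And>k. k \<in> K \<Longrightarrow> c k + (1 - lam) * (\<Sum>l\<in>K. P k l * w l) \<le> w k + lam * e"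
    and k: "k \<in> K"
  shows "u k \<le> w k + e"
proof -
  define d where "d = Max ((\<lambda>l. u l - w l) ` K)"
  have "d \<in> (\<lambda>l. u l - w l) ` K" unfolding d_def using K k by (intro Max_in) auto
  then obtain k0 where k0: "k0 \<in> K" "d = u k0 - w k0" by auto
  have le: "u l - w l \<le> d" if "l \<in> K" for l unfolding d_def using K that by (intro Max_ge) auto
  have "(\<Sum>l\<in>K. P k0 l * (u l - w l)) \<le> (\<Sum>l\<in>K. P k0 l * d)"
    using P(1)[OF k0(1)] le by (intro sum_mono mult_left_mono) auto
  also have "\<dots> = d" using P(2)[OF k0(1)] by (simp flip: sum_distrib_right)
  finally have "(1 - lam) * ((\<Sum>l\<in>K. P k0 l * u l) - (\<Sum>l\<in>K. P k0 l * w l)) \<le> (1 - lam) * d"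
    using lam by (intro mult_left_mono) (auto simp: right_diff_distrib sum_subtractf)
  then have "d \<le> lam * e + (1 - lam) * d"
    using u[OF k0(1)] w[OF k0(1)] k0(2) by (simp add: right_diff_distrib)
  then have "lam * d \<le> lam * e" by (simp add: left_diff_distrib)
  then have "d \<le> e" using lam by simp
  then show ?thesis using le[OF k] by simp
qed

lemma mixed_pmf:
  assumes "set_pmf p \<subseteq> {..<d}"
  shows "vec d (pmf p) \<in> mixed d"
  using sum_pmf_eq_1[of "{..<d}" p] assms by (auto simp: mixed_def)

lemma pmf_of_mixed:
  assumes x: "x \<in> mixed d"
  shows "\<exists>p. set_pmf p \<subseteq> {..<d} \<and> (\<forall>i<d. pmf p i = x $ i)"
proof -
  define f where "f i = (if i < d then x $ i else 0)" for i
  have nn: "0 \<le> f i" for i using x by (auto simp: f_def mixed_def)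
  have "(\<integral>\<^sup>+i. ennreal (f i) \<partial>count_space UNIV) = (\<Sum>i<d. ennreal (f i))"
    by (rule nn_integral_count_space') (auto simp: f_def)
  also have "\<dots> = ennreal (\<Sum>i<d. f i)" using nn by (simp add: sum_ennreal)
  also have "(\<Sum>i<d. f i) = 1" using x by (simp add: f_def mixed_def)
  finally have one: "(\<integral>\<^sup>+i. ennreal (f i) \<partial>count_space UNIV) = 1" by simp
  have "pmf (embed_pmf f) i = f i" for i by (rule pmf_embed_pmf[OF nn one])
  then show ?thesis
    by (intro exI[of _ "embed_pmf f"]) (auto simp: set_pmf_iff f_def split: if_splits)
qed

lemma transition_average:
  fixes p :: "nat \<Rightarrow> nat \<Rightarrow> real"
  shows "(\<Sum>i<a. \<Sum>j<b. p i j * (lam * g i j + (1 - lam) * (\<Sum>l\<in>K. q i j l * w l))) =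
    lam * (\<Sum>i<a. \<Sum>j<b. p i j * g i j) + (1 - lam) * (\<Sum>l\<in>K. (\<Sum>i<a. \<Sum>j<b. p i j * q i j l) * w l)"
proof -
  have "(\<Sum>l\<in>K. (\<Sum>i<a. \<Sum>j<b. p i j * q i j l) * w l) = (\<Sum>l\<in>K. \<Sum>i<a. \<Sum>j<b. p i j * (q i j l * w l))"
    by (simp add: sum_distrib_right mult.assoc)
  also have "\<dots> = (\<Sum>i<a. \<Sum>l\<in>K. \<Sum>j<b. p i j * (q i j l * w l))" by (rule sum.swap)
  also have "\<dots> = (\<Sum>i<a. \<Sum>j<b. \<Sum>l\<in>K. p i j * (q i j l * w l))"
    by (intro sum.cong refl sum.swap)
  finally show ?thesis
    unfolding double_sum_affine by (simp add: sum_distrib_left)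
qed

lemma local_game_payoff_pmf:
  "game_payoff (local_game G lam w k) (vec (num_rows G k) (pmf p)) (vec (num_cols G k) (pmf q)) =
    (\<Sum>i<num_rows G k. \<Sum>j<num_cols G k. pmf p i * pmf q j *
     (lam * stage_payoff G k i j + (1 - lam) * (\<Sum>l\<in>{1..nstates G}. pmf (trans_law G k i j) l * w l)))"
  by (subst game_payoff_sum[OF local_game_carrier]) (simp_all add: local_game_def)

lemma discounted_payoff_comparison:
  assumes G: "stochastic_game G" and lam: "0 < lam" "lam \<le> 1"
    and xy: "x \<in> stationary (nstates G) (num_rows G)" "y \<in> stationary (nstates G) (num_cols G)"
    and k: "k \<in> {1..nstates G}"
  shows "(\<And>l. l \<in> {1..nstates G} \<Longrightarrow>
      game_payoff (local_game G lam w l) (vec (num_rows G l) (pmf (x l))) (vec (num_cols G l) (pmf (y l))) \<le> w l + lam * e)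
      \<Longrightarrow> discounted_payoff G lam x y k \<le> w k + e"
    and "(\<And>l. l \<in> {1..nstates G} \<Longrightarrow>
      w l - lam * e \<le> game_payoff (local_game G lam w l) (vec (num_rows G l) (pmf (x l))) (vec (num_cols G l) (pmf (y l))))
      \<Longrightarrow> w k - e \<le> discounted_payoff G lam x y k"
proof -
  let ?K = "{1..nstates G}"
  define c where "c k = lam * (\<Sum>i<num_rows G k. \<Sum>j<num_cols G k. pmf (x k) i * pmf (y k) j * stage_payoff G k i j)" for k
  define P where "P k l = (\<Sum>i<num_rows G k. \<Sum>j<num_cols G k. pmf (x k) i * pmf (y k) j * pmf (trans_law G k i j) l)" for k l
  have pay: "game_payoff (local_game G lam w k) (vec (num_rows G k) (pmf (x k))) (vec (num_cols G k) (pmf (y k))) =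
      c k + (1 - lam) * (\<Sum>l\<in>?K. P k l * w l)" for w k
    unfolding local_game_payoff_pmf transition_average c_def P_def ..
  have u: "discounted_payoff G lam x y k = c k + (1 - lam) * (\<Sum>l\<in>?K. P k l * discounted_payoff G lam x y l)"
    if "k \<in> ?K" for k
    unfolding discounted_payoff_recursion[OF G lam xy that] transition_average c_def P_def ..
  have P0: "0 \<le> P k l" for k l unfolding P_def by (intro sum_nonneg mult_nonneg_nonneg) auto
  have P1: "(\<Sum>l\<in>?K. P k l) = 1" if k: "k \<in> ?K" for k
  proof -
    have "(\<Sum>l\<in>?K. P k l) = (\<Sum>i<num_rows G k. \<Sum>l\<in>?K. \<Sum>j<num_cols G k. pmf (x k) i * pmf (y k) j * pmf (trans_law G k i j) l)"
      unfolding P_def by (rule sum.swap)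
    also have "\<dots> = (\<Sum>i<num_rows G k. \<Sum>j<num_cols G k. \<Sum>l\<in>?K. pmf (x k) i * pmf (y k) j * pmf (trans_law G k i j) l)"
      by (intro sum.cong refl sum.swap)
    also have "\<dots> = (\<Sum>i<num_rows G k. \<Sum>j<num_cols G k. pmf (x k) i * pmf (y k) j)"
      using sum_trans_law[OF G k] by (intro sum.cong refl) (simp flip: sum_distrib_left)
    also have "\<dots> = (\<Sum>i<num_rows G k. pmf (x k) i) * (\<Sum>j<num_cols G k. pmf (y k) j)"
      by (simp add: sum_product)
    also have "\<dots> = 1"
      using xy k sum_pmf_eq_1[of "{..<num_rows G k}" "x k"] sum_pmf_eq_1[of "{..<num_cols G k}" "y k"]
      by (auto simp: stationary_def)
    finally show ?thesis .
  qed
  show "discounted_payoff G lam x y k \<le> w k + e"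
    if "\<And>l. l \<in> ?K \<Longrightarrow> game_payoff (local_game G lam w l) (vec (num_rows G l) (pmf (x l))) (vec (num_cols G l) (pmf (y l))) \<le> w l + lam * e"
  proof (rule discounted_comparison[of ?K lam P "discounted_payoff G lam x y" c w e k])
    fix k assume k: "k \<in> ?K"
    show "discounted_payoff G lam x y k = c k + (1 - lam) * (\<Sum>l\<in>?K. P k l * discounted_payoff G lam x y l)"
      by (rule u[OF k])
    show "c k + (1 - lam) * (\<Sum>l\<in>?K. P k l * w l) \<le> w k + lam * e"
      using that[OF k] by (simp only: pay)
  qed (use lam P0 P1 k in auto)
  show "w k - e \<le> discounted_payoff G lam x y k"
    if "\<And>l. l \<in> ?K \<Longrightarrow> w l - lam * e \<le> game_payoff (local_game G lam w l) (vec (num_rows G l) (pmf (x l))) (vec (num_cols G l) (pmf (y l)))"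
  proof -
    have "- discounted_payoff G lam x y k \<le> - w k + e"
    proof (rule discounted_comparison[of ?K lam P "\<lambda>k. - discounted_payoff G lam x y k" "\<lambda>k. - c k" "\<lambda>k. - w k" e k])
      fix k assume k: "k \<in> ?K"
      show "- discounted_payoff G lam x y k = - c k + (1 - lam) * (\<Sum>l\<in>?K. P k l * - discounted_payoff G lam x y l)"
        by (subst u[OF k]) (simp add: sum_negf)
      show "- c k + (1 - lam) * (\<Sum>l\<in>?K. P k l * - w l) \<le> - w k + lam * e"
        using that[OF k] by (simp add: pay sum_negf)
    qed (use lam P0 P1 k in auto)
    then show ?thesis by simp
  qed
qed

lemma local_game_cong:
  "(\<And>l. l \<in> {1..nstates G} \<Longrightarrow> w l = w' l) \<Longrightarrow> local_game G lam w k = local_game G lam w' k"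
  unfolding local_game_def by (intro eq_matI) auto

text \<open>Let \<open>z\<close> be the fixed point of the value iteration. Playing almost optimally in the local games at \<open>z\<close>
  guarantees \<open>z\<close> up to a small error. Conversely, every stationary strategy of Player 1 admits a pure
  reply in each local game at \<open>z\<close> that holds the payoff down to \<open>z\<close>, and the comparison lemma
  transfers this bound to the stochastic game. So the discounted value is \<open>z\<close>.\<close>

theorem discounted_value_fixed_point:
  assumes G: "stochastic_game G" and lam: "0 < lam" "lam \<le> 1" and k: "k \<in> {1..nstates G}"
  shows "discounted_value G lam k = game_val (local_game G lam (discounted_value G lam) k)"
proof -
  let ?K = "{1..nstates G}"
  let ?X = "stationary (nstates G) (num_rows G)" and ?Y = "stationary (nstates G) (num_cols G)"
  let ?vx = "\<lambda>x l. vec (num_rows G l) (pmf (x l))" and ?vy = "\<lambda>y l. vec (num_cols G l) (pmf (y l))"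
  have pos: "0 < num_rows G l" "0 < num_cols G l" if "l \<in> ?K" for l
    using G that by (auto simp: stochastic_game_def)
  have mx: "?vx x l \<in> mixed (num_rows G l)" if "x \<in> ?X" "l \<in> ?K" for x l
    using that by (intro mixed_pmf) (auto simp: stationary_def)
  have my: "?vy y l \<in> mixed (num_cols G l)" if "y \<in> ?Y" "l \<in> ?K" for y l
    using that by (intro mixed_pmf) (auto simp: stationary_def)
  have X0: "(\<lambda>_. return_pmf 0) \<in> ?X" and Y0: "(\<lambda>_. return_pmf 0) \<in> ?Y"
    using pos by (auto simp: stationary_def)
  \<comment> \<open>a bound for all stage payoffs, which are the entries of the local games for discount factor \<open>1\<close>\<close>
  define B where "B = (\<Sum>l\<in>?K. entry_bound (local_game G 1 (\<lambda>_. 0) l))"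
  have gB: "\<bar>stage_payoff G l i j\<bar> \<le> B" if "l \<in> ?K" "i < num_rows G l" "j < num_cols G l" for l i j
  proof -
    have "\<bar>stage_payoff G l i j\<bar> \<le> entry_bound (local_game G 1 (\<lambda>_. 0) l)"
      using entry_bound[of i "local_game G 1 (\<lambda>_. 0) l" j] that by (simp add: local_game_def)
    also have "\<dots> \<le> B" unfolding B_def using that(1)
      by (intro member_le_sum[of _ _ "\<lambda>l. entry_bound (local_game G 1 (\<lambda>_. 0) l)"])
        (auto simp: entry_bound_def intro!: sum_nonneg)
    finally show ?thesis .
  qed
  have loc: "local_game G lam (\<lambda>_. b) l $$ (i, j) = lam * stage_payoff G l i j + (1 - lam) * b"
    if "l \<in> ?K" "i < num_rows G l" "j < num_cols G l" for l i j b
    using that sum_trans_law[OF G that] by (simp add: local_game_def flip: sum_distrib_right)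
  have upper: "discounted_payoff G lam x y l \<le> B" if "x \<in> ?X" "y \<in> ?Y" "l \<in> ?K" for x y l
  proof -
    have "discounted_payoff G lam x y l \<le> B + 0"
    proof (rule discounted_payoff_comparison(1)[OF G lam that])
      fix l assume l: "l \<in> ?K"
      show "game_payoff (local_game G lam (\<lambda>_. B) l) (?vx x l) (?vy y l) \<le> B + lam * 0"
      proof (rule game_payoff_bounds(1)[OF local_game_carrier mx[OF that(1) l] my[OF that(2) l]])
        fix i j assume ij: "i < num_rows G l" "j < num_cols G l"
        have "lam * stage_payoff G l i j \<le> lam * B" using lam gB[OF l ij] by (intro mult_left_mono) auto
        then show "local_game G lam (\<lambda>_. B) l $$ (i, j) \<le> B + lam * 0"
          by (simp add: loc[OF l ij] algebra_simps)
      qed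
    qed
    then show ?thesis by simp
  qed
  have lower: "- B \<le> discounted_payoff G lam x y l" if "x \<in> ?X" "y \<in> ?Y" "l \<in> ?K" for x y l
  proof -
    have "- B - 0 \<le> discounted_payoff G lam x y l"
    proof (rule discounted_payoff_comparison(2)[OF G lam that])
      fix l assume l: "l \<in> ?K"
      show "- B - lam * 0 \<le> game_payoff (local_game G lam (\<lambda>_. - B) l) (?vx x l) (?vy y l)"
      proof (rule game_payoff_bounds(2)[OF local_game_carrier mx[OF that(1) l] my[OF that(2) l]])
        fix i j assume ij: "i < num_rows G l" "j < num_cols G l"
        have "lam * (- stage_payoff G l i j) \<le> lam * B" using lam gB[OF l ij] by (intro mult_left_mono) auto
        then show "- B - lam * 0 \<le> local_game G lam (\<lambda>_. - B) l $$ (i, j)"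
          by (simp add: loc[OF l ij] algebra_simps)
      qed
    qed
    then show ?thesis by simp
  qed
  have bb: "bdd_below ((\<lambda>y. discounted_payoff G lam x y l) ` ?Y)" if "x \<in> ?X" "l \<in> ?K" for x l
    using lower that by (intro bdd_belowI2) auto
  have ba: "bdd_above ((\<lambda>x. INF y\<in>?Y. discounted_payoff G lam x y l) ` ?X)" if l: "l \<in> ?K" for l
  proof (rule bdd_aboveI2)
    fix x assume x: "x \<in> ?X"
    show "(INF y\<in>?Y. discounted_payoff G lam x y l) \<le> B"
      using cINF_lower[OF bb[OF x l] Y0] upper[OF x Y0 l] by simp
  qed
  obtain z where z: "\<And>l. l \<in> ?K \<Longrightarrow> z l = game_val (local_game G lam z l)"
    using shapley_fixed_point_exists[OF G lam] by blast
  have "discounted_value G lam l = z l" if l: "l \<in> ?K" for l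
  proof (rule antisym)
    show "discounted_value G lam l \<le> z l"
      unfolding discounted_value_def
    proof (rule cSUP_least)
      fix x assume x: "x \<in> ?X"
      have "\<forall>l\<in>?K. \<exists>j<num_cols G l. (\<Sum>i<num_rows G l. ?vx x l $ i * local_game G lam z l $$ (i, j)) \<le> z l"
        using game_pure_reply[OF local_game_carrier pos(2) mx[OF x]] z by metis
      then obtain r where r: "\<And>l. l \<in> ?K \<Longrightarrow> r l < num_cols G l"
        "\<And>l. l \<in> ?K \<Longrightarrow> (\<Sum>i<num_rows G l. ?vx x l $ i * local_game G lam z l $$ (i, r l)) \<le> z l"
        by metis
      define y where "y l = return_pmf (r l)" for l
      have y: "y \<in> ?Y" using r(1) by (auto simp: stationary_def y_def)
      have "discounted_payoff G lam x y l \<le> z l + 0"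
      proof (rule discounted_payoff_comparison(1)[OF G lam x y l])
        fix l assume l: "l \<in> ?K"
        have "?vy y l = unit_vec (num_cols G l) (r l)"
          by (intro eq_vecI) (auto simp: y_def unit_vec_def)
        then show "game_payoff (local_game G lam z l) (?vx x l) (?vy y l) \<le> z l + lam * 0"
          using game_payoff_unit[OF local_game_carrier vec_carrier r(1)[OF l]] r(2)[OF l] by simp
      qed
      then show "(INF y\<in>?Y. discounted_payoff G lam x y l) \<le> z l"
        using cINF_lower[OF bb[OF x l] y] by simp
    qed (use X0 in auto)
    show "z l \<le> discounted_value G lam l"
    proof (rule field_le_epsilon)
      fix e :: real assume e: "0 < e"
      then have le: "0 < lam * e" using lam by simp
      have "\<exists>p. set_pmf p \<subseteq> {..<num_rows G l} \<and>
          (\<forall>y\<in>mixed (num_cols G l). z l - lam * e \<le> game_payoff (local_game G lam z l) (vec (num_rows G l) (pmf p)) y)"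
        if l: "l \<in> ?K" for l
      proof -
        obtain x where x: "x \<in> mixed (num_rows G l)"
          "\<And>y. y \<in> mixed (num_cols G l) \<Longrightarrow> z l - lam * e \<le> game_payoff (local_game G lam z l) x y"
          using game_val_approx[OF local_game_carrier[of G lam z l] pos[OF l] le] z[OF l] by auto
        obtain p where p: "set_pmf p \<subseteq> {..<num_rows G l}" "\<And>i. i < num_rows G l \<Longrightarrow> pmf p i = x $ i"
          using pmf_of_mixed[OF x(1)] by auto
        have "vec (num_rows G l) (pmf p) = x"
          using p(2) mixed_carrier[OF x(1)] by (intro eq_vecI) auto
        then show ?thesis using p(1) x(2) by auto
      qed
      then obtain x where x: "\<And>l. l \<in> ?K \<Longrightarrow> set_pmf (x l) \<subseteq> {..<num_rows G l}"
        "\<And>l y. l \<in> ?K \<Longrightarrow> y \<in> mixed (num_cols G l) \<Longrightarrow>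
           z l - lam * e \<le> game_payoff (local_game G lam z l) (vec (num_rows G l) (pmf (x l))) y"
        by metis
      have xX: "x \<in> ?X" using x(1) by (auto simp: stationary_def)
      have "z l - e \<le> (INF y\<in>?Y. discounted_payoff G lam x y l)"
      proof (rule cINF_greatest)
        fix y assume y: "y \<in> ?Y"
        show "z l - e \<le> discounted_payoff G lam x y l"
          using x(2) my[OF y] by (intro discounted_payoff_comparison(2)[OF G lam xX y l]) auto
      qed (use Y0 in auto)
      also have "\<dots> \<le> discounted_value G lam l"
        unfolding discounted_value_def by (rule cSUP_upper[OF xX ba[OF l]])
      finally show "z l \<le> discounted_value G lam l + e" by simp
    qed
  qed
  then show ?thesis using z[OF k] k local_game_cong[of G "discounted_value G lam" z lam k] by simp
qed

section \<open>Algebraic degree and rationality of determinants\<close>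

text \<open>A nonzero rational polynomial of least degree that vanishes at \<open>a\<close> is irreducible.\<close>

lemma algebraic_of_degree_le:
  fixes p :: "rat poly"
  assumes "p \<noteq> 0" "poly (map_poly of_rat p) (a :: real) = 0"
  shows "\<exists>d\<le>degree p. algebraic_of_degree a d"
proof -
  interpret r: map_poly_inj_idom_hom "of_rat :: rat \<Rightarrow> real" ..
  let ?P = "\<lambda>p::rat poly. p \<noteq> 0 \<and> poly (map_poly of_rat p) a = 0"
  obtain q where q: "?P q" and min: "\<And>q'. ?P q' \<Longrightarrow> degree q \<le> degree q'"
    using ex_has_least_nat[of ?P p degree] assms by blast
  define u where "u = Polynomial.smult (inverse (lead_coeff q)) q"
  have u: "?P u" "degree u = degree q" "lead_coeff u = 1"
    using q by (auto simp: u_def of_rat_hom.map_poly_hom_smult)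
  have nonunit: "\<not> u dvd 1"
  proof
    assume "u dvd 1"
    then have "degree u = 0" using poly_dvd_1 by blast
    then have "u = 1" using u(3) by (metis degree_eq_zeroE lead_coeff_pCons(2) pCons_0_0 one_pCons)
    then show False using u(1) by simp
  qed
  have prime: "b dvd 1 \<or> c dvd 1" if ubc: "u = b * c" for b c
  proof -
    have bc: "b \<noteq> 0" "c \<noteq> 0" using ubc u by auto
    have dg: "degree u = degree b + degree c" using ubc bc by (simp add: degree_mult_eq)
    have "poly (map_poly of_rat b) a = 0 \<or> poly (map_poly of_rat c) a = 0"
      using u(1) by (simp add: ubc r.hom_mult)
    then have "degree b = 0 \<or> degree c = 0"
      using min[of b] min[of c] bc dg u(2) by auto
    then show ?thesis using bc by (auto simp: is_unit_iff_degree)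
  qed
  have "irreducible u" by (rule irreducibleI[OF conjunct1[OF u(1)] nonunit prime])
  then show ?thesis
    using u min[of p] assms by (intro exI[of _ "degree u"]) (auto simp: algebraic_of_degree_def)
qed

lemma (in comm_ring_hom) det_in_range_hom:
  assumes M: "M \<in> carrier_mat n n" and ent: "\<And>i j. i < n \<Longrightarrow> j < n \<Longrightarrow> M $$ (i, j) \<in> range hom"
  shows "det M \<in> range hom"
proof -
  have "\<forall>i j. \<exists>a. i < n \<longrightarrow> j < n \<longrightarrow> M $$ (i, j) = hom a" using ent by blast
  then obtain f where f: "\<And>i j. i < n \<Longrightarrow> j < n \<Longrightarrow> M $$ (i, j) = hom (f i j)" by metis
  have "M = map_mat hom (mat n n (\<lambda>(i, j). f i j))" using M f by (intro eq_matI) auto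
  then show ?thesis using hom_det by (metis rangeI)
qed

section \<open>The auxiliary matrices of a stochastic game\<close>

text \<open>The weights of a kernel are restrictions of mixed strategies. They are again mixed strategies: by
  the cofactor formula they sum up to \<open>1\<close>, the total of all cofactors being the normalization.\<close>

lemma shapley_snow_kernelE:
  assumes "shapley_snow_kernel A I J"
  obtains x y where "I \<subseteq> {..<dim_row A}" "J \<subseteq> {..<dim_col A}" "card I = card J"
    "x \<in> mixed (card I)" "y \<in> mixed (card I)"
    "\<And>b. b < card I \<Longrightarrow> (\<Sum>a<card I. x $ a * A $$ (pick I a, pick J b)) = game_val A"
    "\<And>a. a < card I \<Longrightarrow> (\<Sum>b<card I. A $$ (pick I a, pick J b) * y $ b) = game_val A"
proof -
  define B where "B = submatrix A I J"
  define C where "C = cofactor_mat B"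
  define s where "s = entry_sum C"
  define r where "r = card I"
  obtain x0 y0 where IJ: "I \<subseteq> {..<dim_row A}" "J \<subseteq> {..<dim_col A}" "card I = card J"
    and basic: "basic_solution A x0 y0" and s: "s \<noteq> 0"
    and x: "restrict_vec x0 I = (1 / s) \<cdot>\<^sub>v (C *\<^sub>v ones r)"
    and y: "restrict_vec y0 J = (1 / s) \<cdot>\<^sub>v (transpose_mat C *\<^sub>v ones r)"
    and xB: "transpose_mat B *\<^sub>v restrict_vec x0 I = game_val A \<cdot>\<^sub>v ones r"
    and By: "B *\<^sub>v restrict_vec y0 J = game_val A \<cdot>\<^sub>v ones r"
    using assms unfolding shapley_snow_kernel_def Let_def B_def C_def s_def r_def by blast
  have sets: "{i. i < dim_row A \<and> i \<in> I} = I" "{i. i < dim_col A \<and> i \<in> J} = J"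
    using IJ by auto
  have rJ: "card J = r" using IJ by (simp add: r_def)
  have B: "B \<in> carrier_mat r r" using sets rJ by (simp add: B_def submatrix_def r_def)
  have C: "C \<in> carrier_mat r r" using B by (simp add: C_def cofactor_mat_def)
  have Bent: "B $$ (a, b) = A $$ (pick I a, pick J b)" if "a < r" "b < r" for a b
    using that sets rJ by (simp add: B_def submatrix_def r_def)
  have pI: "pick I a < dim_row A" if "a < r" for a using pick_in_set_le[of a I] that IJ by (auto simp: r_def)
  have pJ: "pick J a < dim_col A" if "a < r" for a using pick_in_set_le[of a J] that IJ by (auto simp: r_def)
  have opt: "x0 \<in> mixed (dim_row A)" "y0 \<in> mixed (dim_col A)"
    using basic by (auto simp: basic_solution_def optimal_pairs_def)
  have ssum: "s = (\<Sum>i<r. \<Sum>j<r. C $$ (i, j))" using C by (simp add: s_def entry_sum_def)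
  have "(\<Sum>a<r. restrict_vec x0 I $ a) = (\<Sum>a<r. (\<Sum>b<r. C $$ (a, b)) / s)"
    using C by (intro sum.cong refl) (simp add: x scalar_prod_def ones_def atLeast0LessThan)
  also have "\<dots> = 1" using s ssum by (simp flip: sum_divide_distrib)
  finally have sx: "(\<Sum>a<r. restrict_vec x0 I $ a) = 1" .
  have "(\<Sum>b<r. restrict_vec y0 J $ b) = (\<Sum>b<r. (\<Sum>a<r. C $$ (a, b)) / s)"
    using C by (intro sum.cong refl) (simp add: y scalar_prod_def ones_def atLeast0LessThan)
  also have "\<dots> = (\<Sum>b<r. \<Sum>a<r. C $$ (a, b)) / s" by (simp add: sum_divide_distrib)
  also have "(\<Sum>b<r. \<Sum>a<r. C $$ (a, b)) = s" unfolding ssum by (rule sum.swap)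
  finally have sy: "(\<Sum>b<r. restrict_vec y0 J $ b) = 1" using s by simp
  have mx: "restrict_vec x0 I \<in> mixed r"
    using sx opt(1) pI by (auto simp: mixed_def restrict_vec_def r_def)
  have my: "restrict_vec y0 J \<in> mixed r"
    using sy opt(2) pJ rJ by (auto simp: mixed_def restrict_vec_def)
  have left: "(\<Sum>a<r. restrict_vec x0 I $ a * A $$ (pick I a, pick J b)) = game_val A" if b: "b < r" for b
  proof -
    have "(transpose_mat B *\<^sub>v restrict_vec x0 I) $ b = (\<Sum>a<r. B $$ (a, b) * restrict_vec x0 I $ a)"
      using b B mixed_carrier[OF mx] by (simp add: scalar_prod_def atLeast0LessThan)
    then show ?thesis using b unfolding xB by (simp add: ones_def Bent mult.commute)
  qed
  have right: "(\<Sum>b<r. A $$ (pick I a, pick J b) * restrict_vec y0 J $ b) = game_val A" if a: "a < r" for a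
  proof -
    have "(B *\<^sub>v restrict_vec y0 J) $ a = (\<Sum>b<r. B $$ (a, b) * restrict_vec y0 J $ b)"
      using a B mixed_carrier[OF my] by (simp add: scalar_prod_def atLeast0LessThan)
    then show ?thesis using a unfolding By by (simp add: ones_def Bent)
  qed
  show ?thesis
    by (rule that[of "restrict_vec x0 I" "restrict_vec y0 J"])
      (use IJ mx my left right in \<open>auto simp: r_def\<close>)
qed

lemma mixed_tensor:
  assumes "\<And>s. s < length rs \<Longrightarrow> x s \<in> mixed (rs ! s)"
  shows "vec (prod_list rs) (\<lambda>i. \<Prod>s<length rs. x s $ (digits rs i ! s)) \<in> mixed (prod_list rs)"
proof -
  have "0 \<le> (\<Prod>s<length rs. x s $ (digits rs i ! s))" if "i < prod_list rs" for i
    using assms digits_less[OF that] by (intro prod_nonneg) (auto simp: mixed_def)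
  moreover have "(\<Sum>i<prod_list rs. \<Prod>s<length rs. x s $ (digits rs i ! s)) = 1"
    unfolding sum_prod_digits[of "\<lambda>s a. x s $ a" rs] using assms by (simp add: mixed_def)
  ultimately show ?thesis by (simp add: mixed_def)
qed

text \<open>Averaging the rows of the scalar array behind an entry with the weights \<open>x k\<close> produces an array with
  \<open>v\<close> in its kernel, and Cramer's rule applies; similarly for \<open>y k\<close> and the columns.\<close>

lemma balanced_pencil_aux_mat:
  fixes D :: "nat \<Rightarrow> nat \<Rightarrow> real mat"
  assumes D: "\<And>k l. k \<in> {1..n} \<Longrightarrow> l \<le> n \<Longrightarrow> D k l \<in> carrier_mat (r k) (r k)"
    and x: "\<And>k. k \<in> {1..n} \<Longrightarrow> x k \<in> mixed (r k)" and y: "\<And>k. k \<in> {1..n} \<Longrightarrow> y k \<in> mixed (r k)"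
    and left: "\<And>k b. k \<in> {1..n} \<Longrightarrow> b < r k \<Longrightarrow> (\<Sum>a<r k. x k $ a * (\<Sum>l\<le>n. D k l $$ (a, b) * v l)) = 0"
    and right: "\<And>k a. k \<in> {1..n} \<Longrightarrow> a < r k \<Longrightarrow> (\<Sum>b<r k. (\<Sum>l\<le>n. D k l $$ (a, b) * v l) * y k $ b) = 0"
    and v0: "v 0 = 1"
    and pos: "\<And>f g. (\<And>k. k \<in> {1..n} \<Longrightarrow> f k < r k \<and> g k < r k) \<Longrightarrow>
      0 < (-1) ^ n * signed_minor n (\<lambda>s t. D (Suc s) t $$ (f (Suc s), g (Suc s))) 0"
    and k: "k \<le> n"
  defines "rs \<equiv> map r [1..<Suc n]"
  shows "balanced_pencil (prod_list rs) (aux_mat n D k) (aux_mat n D 0)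
    (vec (prod_list rs) (\<lambda>i. \<Prod>s<n. x (Suc s) $ (digits rs i ! s)))
    (vec (prod_list rs) (\<lambda>i. \<Prod>s<n. y (Suc s) $ (digits rs i ! s))) (v k) ((-1) ^ n)"
proof -
  let ?m = "prod_list rs"
  have len: "length rs = n" by (simp add: rs_def del: upt_Suc)
  have nth: "rs ! s = r (Suc s)" if "s < n" for s using that by (simp add: rs_def del: upt_Suc)
  have dig: "digits rs i ! s < r (Suc s)" if "i < ?m" "s < n" for i s
    using digits_less[OF that(1), of s] that(2) len nth by simp
  have aux: "aux_mat n D l = mat ?m ?m (\<lambda>(i, j).
      signed_minor n (\<lambda>s t. D (Suc s) t $$ (digits rs i ! s, digits rs j ! s)) l)" if "l \<le> n" for l
    unfolding rs_def by (rule aux_mat_entries[OF D that])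
  have xsum: "(\<Sum>i<?m. (\<Prod>s<n. x (Suc s) $ (digits rs i ! s)) * aux_mat n D l $$ (i, j)) =
     signed_minor n (\<lambda>s t. \<Sum>a<r (Suc s). x (Suc s) $ a * D (Suc s) t $$ (a, digits rs j ! s)) l"
    if j: "j < ?m" and l: "l \<le> n" for j l
  proof -
    have "(\<Sum>i<?m. (\<Prod>s<n. x (Suc s) $ (digits rs i ! s)) * aux_mat n D l $$ (i, j)) =
      (\<Sum>i<?m. (\<Prod>s<n. x (Suc s) $ (digits rs i ! s)) *
        signed_minor n (\<lambda>s t. D (Suc s) t $$ (digits rs i ! s, digits rs j ! s)) l)"
      using j by (intro sum.cong refl) (simp add: aux[OF l])
    also have "\<dots> = signed_minor n (\<lambda>s t. \<Sum>a<rs ! s. x (Suc s) $ a * D (Suc s) t $$ (a, digits rs j ! s)) l"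
      by (rule sum_signed_minor_digits[OF len, of "\<lambda>s a. x (Suc s) $ a" "\<lambda>s t a. D (Suc s) t $$ (a, digits rs j ! s)"])
    also have "\<dots> = signed_minor n (\<lambda>s t. \<Sum>a<r (Suc s). x (Suc s) $ a * D (Suc s) t $$ (a, digits rs j ! s)) l"
      by (intro signed_minor_cong) (simp add: nth)
    finally show ?thesis .
  qed
  have ysum: "(\<Sum>j<?m. aux_mat n D l $$ (i, j) * (\<Prod>s<n. y (Suc s) $ (digits rs j ! s))) =
     signed_minor n (\<lambda>s t. \<Sum>b<r (Suc s). y (Suc s) $ b * D (Suc s) t $$ (digits rs i ! s, b)) l"
    if i: "i < ?m" and l: "l \<le> n" for i l
  proof -
    have "(\<Sum>j<?m. aux_mat n D l $$ (i, j) * (\<Prod>s<n. y (Suc s) $ (digits rs j ! s))) =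
      (\<Sum>j<?m. (\<Prod>s<n. y (Suc s) $ (digits rs j ! s)) *
        signed_minor n (\<lambda>s t. D (Suc s) t $$ (digits rs i ! s, digits rs j ! s)) l)"
      using i by (intro sum.cong refl) (simp add: aux[OF l])
    also have "\<dots> = signed_minor n (\<lambda>s t. \<Sum>b<rs ! s. y (Suc s) $ b * D (Suc s) t $$ (digits rs i ! s, b)) l"
      by (rule sum_signed_minor_digits[OF len, of "\<lambda>s a. y (Suc s) $ a" "\<lambda>s t b. D (Suc s) t $$ (digits rs i ! s, b)"])
    also have "\<dots> = signed_minor n (\<lambda>s t. \<Sum>b<r (Suc s). y (Suc s) $ b * D (Suc s) t $$ (digits rs i ! s, b)) l"
      by (intro signed_minor_cong) (simp add: nth)
    finally show ?thesis .
  qed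
  show ?thesis
  proof
    show "aux_mat n D k \<in> carrier_mat ?m ?m" "aux_mat n D 0 \<in> carrier_mat ?m ?m"
      by (simp_all add: aux k)
    show "vec ?m (\<lambda>i. \<Prod>s<n. x (Suc s) $ (digits rs i ! s)) \<in> mixed ?m"
      using mixed_tensor[of rs "\<lambda>s. x (Suc s)"] x by (simp add: len nth)
    show "vec ?m (\<lambda>i. \<Prod>s<n. y (Suc s) $ (digits rs i ! s)) \<in> mixed ?m"
      using mixed_tensor[of rs "\<lambda>s. y (Suc s)"] y by (simp add: len nth)
  next
    fix j assume j: "j < ?m"
    have "signed_minor n (\<lambda>s t. \<Sum>a<r (Suc s). x (Suc s) $ a * D (Suc s) t $$ (a, digits rs j ! s)) k =
      v k * signed_minor n (\<lambda>s t. \<Sum>a<r (Suc s). x (Suc s) $ a * D (Suc s) t $$ (a, digits rs j ! s)) 0"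
    proof (rule signed_minor_cramer[where v = v, OF _ v0 k])
      fix s assume s: "s < n"
      have "(\<Sum>l\<le>n. (\<Sum>a<r (Suc s). x (Suc s) $ a * D (Suc s) l $$ (a, digits rs j ! s)) * v l) =
        (\<Sum>a<r (Suc s). x (Suc s) $ a * (\<Sum>l\<le>n. D (Suc s) l $$ (a, digits rs j ! s) * v l))"
        unfolding sum_distrib_left sum_distrib_right by (subst sum.swap) (simp only: mult.assoc)
      then show "(\<Sum>l\<le>n. (\<Sum>a<r (Suc s). x (Suc s) $ a * D (Suc s) l $$ (a, digits rs j ! s)) * v l) = 0"
        using left[of "Suc s", OF _ dig[OF j s]] s by simp
    qed
    then show "(\<Sum>i<?m. vec ?m (\<lambda>i. \<Prod>s<n. x (Suc s) $ (digits rs i ! s)) $ i * aux_mat n D k $$ (i, j)) =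
        v k * (\<Sum>i<?m. vec ?m (\<lambda>i. \<Prod>s<n. x (Suc s) $ (digits rs i ! s)) $ i * aux_mat n D 0 $$ (i, j))"
      using xsum[OF j k] xsum[OF j, of 0] by simp
  next
    fix i assume i: "i < ?m"
    have "signed_minor n (\<lambda>s t. \<Sum>b<r (Suc s). y (Suc s) $ b * D (Suc s) t $$ (digits rs i ! s, b)) k =
      v k * signed_minor n (\<lambda>s t. \<Sum>b<r (Suc s). y (Suc s) $ b * D (Suc s) t $$ (digits rs i ! s, b)) 0"
    proof (rule signed_minor_cramer[where v = v, OF _ v0 k])
      fix s assume s: "s < n"
      have "(\<Sum>l\<le>n. (\<Sum>b<r (Suc s). y (Suc s) $ b * D (Suc s) l $$ (digits rs i ! s, b)) * v l) =
        (\<Sum>b<r (Suc s). (\<Sum>l\<le>n. D (Suc s) l $$ (digits rs i ! s, b) * v l) * y (Suc s) $ b)"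
        unfolding sum_distrib_right by (subst sum.swap) (simp only: ac_simps)
      then show "(\<Sum>l\<le>n. (\<Sum>b<r (Suc s). y (Suc s) $ b * D (Suc s) l $$ (digits rs i ! s, b)) * v l) = 0"
        using right[of "Suc s", OF _ dig[OF i s]] s by simp
    qed
    then show "(\<Sum>j<?m. aux_mat n D k $$ (i, j) * vec ?m (\<lambda>i. \<Prod>s<n. y (Suc s) $ (digits rs i ! s)) $ j) =
        v k * (\<Sum>j<?m. aux_mat n D 0 $$ (i, j) * vec ?m (\<lambda>i. \<Prod>s<n. y (Suc s) $ (digits rs i ! s)) $ j)"
      using ysum[OF i k] ysum[OF i, of 0] by simp
  next
    fix i j assume ij: "i < ?m" "j < ?m"
    have "0 < (-1) ^ n * signed_minor n (\<lambda>s t. D (Suc s) t $$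
        ((\<lambda>k. digits rs i ! (k - 1)) (Suc s), (\<lambda>k. digits rs j ! (k - 1)) (Suc s))) 0"
    proof (rule pos)
      fix k assume "k \<in> {1..n}"
      then show "digits rs i ! (k - 1) < r k \<and> digits rs j ! (k - 1) < r k"
        using dig[OF ij(1), of "k - 1"] dig[OF ij(2), of "k - 1"] by auto
    qed
    then show "0 < (-1) ^ n * aux_mat n D 0 $$ (i, j)" using ij by (simp add: aux)
  qed
qed

lemma comm_ring_hom_specialize: "comm_ring_hom (specialize lam)"
proof -
  interpret e: comm_ring_hom "\<lambda>c::real poly. poly c lam" by unfold_locales auto
  interpret m: map_poly_comm_ring_hom "\<lambda>c::real poly. poly c lam" ..
  have "specialize lam = map_poly (\<lambda>c. poly c lam)" by (simp add: specialize_def fun_eq_iff)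
  then show ?thesis using m.comm_ring_hom_axioms by simp
qed

lemma data_array_carrier: "data_array emb lam G k l \<in> carrier_mat (num_rows G k) (num_cols G k)"
  by (simp add: data_array_def)

lemma specialize_data_array:
  assumes "i < num_rows G k" "j < num_cols G k"
  shows "specialize lam (data_array (\<lambda>a. [:[:a:]:]) [:[:0, 1:]:] G k l $$ (i, j)) =
    [:data_array (\<lambda>a. a) lam G k l $$ (i, j):]"
proof -
  interpret s: comm_ring_hom "specialize lam" by (rule comm_ring_hom_specialize)
  have c: "specialize lam [:[:a:]:] = [:a:]" "specialize lam [:[:0, 1:]:] = [:lam:]" for a
    by (rule poly_eqI, simp add: specialize_def coeff_map_poly coeff_pCons split: nat.split)+
  have payoff: "specialize lam ([:[:0, 1:]:] * [:[:a:]:]) = [:lam * a:]" for a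
    unfolding s.hom_mult c by simp
  have trans: "specialize lam ((1 - [:[:0, 1:]:]) * [:[:a:]:]) = [:(1 - lam) * a:]" for a
    unfolding s.hom_mult s.hom_minus s.hom_one c by (simp add: one_pCons)
  have diag: "specialize lam (p - (if l = k then 1 else 0)) = specialize lam p - (if l = k then 1 else 0)" for p
    by (simp add: s.hom_minus)
  show ?thesis
  proof (cases "l = 0")
    case True
    then show ?thesis
      unfolding data_array_def index_mat(1)[OF assms] prod.case by (simp only: if_True payoff simp_thms)
  next
    case False
    then have "specialize lam (data_array (\<lambda>a. [:[:a:]:]) [:[:0, 1:]:] G k l $$ (i, j)) =
        [:(1 - lam) * pmf (trans_law G k i j) l:] - (if l = k then 1 else 0)"
      unfolding data_array_def index_mat(1)[OF assms] prod.case by (simp only: if_False diag trans)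
    then show ?thesis using False assms by (simp add: data_array_def one_pCons)
  qed
qed

abbreviation full_aux :: "stoch_game \<Rightarrow> real \<Rightarrow> nat \<Rightarrow> real mat" where
  "full_aux G lam l \<equiv> aux_mat (nstates G) (data_array (\<lambda>a. a) lam G) l"

lemma full_aux_entries:
  "l \<le> nstates G \<Longrightarrow> aux_mat (nstates G) (data_array emb lam G) l =
     mat (prod_list (map (num_rows G) [1..<Suc (nstates G)])) (prod_list (map (num_cols G) [1..<Suc (nstates G)]))
      (\<lambda>(i, j). signed_minor (nstates G) (\<lambda>s t. data_array emb lam G (Suc s) t $$
        (digits (map (num_rows G) [1..<Suc (nstates G)]) i ! s, digits (map (num_cols G) [1..<Suc (nstates G)]) j ! s)) l)"
  by (rule aux_mat_entries[OF data_array_carrier])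

lemma dim_symbolic_pencil:
  "dim_row (symbolic_pencil G k) = prod_list (map (num_rows G) [1..<Suc (nstates G)])"
  "dim_col (symbolic_pencil G k) = prod_list (map (num_cols G) [1..<Suc (nstates G)])"
  unfolding symbolic_pencil_def Let_def by (simp_all add: full_aux_entries del: upt_Suc)

lemma specialize_symbolic_pencil:
  assumes k: "k \<le> nstates G"
    and ij: "i < prod_list (map (num_rows G) [1..<Suc (nstates G)])" "j < prod_list (map (num_cols G) [1..<Suc (nstates G)])"
  shows "specialize lam (symbolic_pencil G k $$ (i, j)) = [:full_aux G lam k $$ (i, j), - full_aux G lam 0 $$ (i, j):]"
proof -
  let ?n = "nstates G" and ?S = "data_array (\<lambda>a. [:[:a:]:]) [:[:0, 1:]:] G"
  let ?rs = "map (num_rows G) [1..<Suc ?n]" and ?cs = "map (num_cols G) [1..<Suc ?n]"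
  interpret s: comm_ring_hom "specialize lam" by (rule comm_ring_hom_specialize)
  interpret c: comm_ring_hom "\<lambda>a::real. [:a:]" by unfold_locales auto
  have minor: "specialize lam (aux_mat ?n ?S l $$ (i, j)) = [:full_aux G lam l $$ (i, j):]" if l: "l \<le> ?n" for l
  proof -
    have "specialize lam (aux_mat ?n ?S l $$ (i, j)) =
       signed_minor ?n (\<lambda>s t. specialize lam (?S (Suc s) t $$ (digits ?rs i ! s, digits ?cs j ! s))) l"
      using ij by (simp add: full_aux_entries[OF l] s.hom_signed_minor del: upt_Suc)
    also have "\<dots> = signed_minor ?n (\<lambda>s t. [:data_array (\<lambda>a. a) lam G (Suc s) t $$ (digits ?rs i ! s, digits ?cs j ! s):]) l"
    proof (rule signed_minor_cong, rule specialize_data_array)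
      fix s t assume s: "s < ?n"
      show "digits ?rs i ! s < num_rows G (Suc s)" "digits ?cs j ! s < num_cols G (Suc s)"
        using digits_upt_less[OF ij(1) s] digits_upt_less[OF ij(2) s] .
    qed
    also have "\<dots> = [:full_aux G lam l $$ (i, j):]"
      using ij by (simp add: full_aux_entries[OF l] c.hom_signed_minor del: upt_Suc)
    finally show ?thesis .
  qed
  have w: "specialize lam [:0, 1:] = [:0, 1:]"
    by (simp add: specialize_def map_poly_pCons one_pCons[symmetric])
  have "symbolic_pencil G k $$ (i, j) = aux_mat ?n ?S k $$ (i, j) - [:0, 1:] * aux_mat ?n ?S 0 $$ (i, j)"
    using ij k by (simp add: symbolic_pencil_def Let_def full_aux_entries del: upt_Suc)
  then have "specialize lam (symbolic_pencil G k $$ (i, j)) =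
      [:full_aux G lam k $$ (i, j):] - [:0, 1:] * [:full_aux G lam 0 $$ (i, j):]"
    by (simp only: s.hom_minus s.hom_mult w minor[OF k] minor[of 0] le0)
  then show ?thesis by simp
qed

lemma specialize_det_symbolic_minor:
  assumes k: "k \<le> nstates G"
    and R: "R \<subseteq> {..<dim_row (symbolic_pencil G k)}" and C: "C \<subseteq> {..<dim_col (symbolic_pencil G k)}"
  shows "specialize lam (det (submatrix (symbolic_pencil G k) R C)) =
    det (mat (card R) (card C) (\<lambda>(i, j).
      [:full_aux G lam k $$ (pick R i, pick C j), - full_aux G lam 0 $$ (pick R i, pick C j):]))"
proof -
  have sets: "{i. i < dim_row (symbolic_pencil G k) \<and> i \<in> R} = R" "{i. i < dim_col (symbolic_pencil G k) \<and> i \<in> C} = C"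
    using R C by auto
  have "map_mat (specialize lam) (submatrix (symbolic_pencil G k) R C) = mat (card R) (card C) (\<lambda>(i, j).
      [:full_aux G lam k $$ (pick R i, pick C j), - full_aux G lam 0 $$ (pick R i, pick C j):])"
  proof (rule eq_matI)
    fix i j assume "i < dim_row (mat (card R) (card C) (\<lambda>(i, j).
      [:full_aux G lam k $$ (pick R i, pick C j), - full_aux G lam 0 $$ (pick R i, pick C j):]))"
      "j < dim_col (mat (card R) (card C) (\<lambda>(i, j).
      [:full_aux G lam k $$ (pick R i, pick C j), - full_aux G lam 0 $$ (pick R i, pick C j):]))"
    then have ij: "i < card R" "j < card C" by auto
    have "pick R i < dim_row (symbolic_pencil G k)" "pick C j < dim_col (symbolic_pencil G k)"
      using pick_in_set_le[OF ij(1)] pick_in_set_le[OF ij(2)] R C by auto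
    note sp = specialize_symbolic_pencil[OF k this[unfolded dim_symbolic_pencil], of lam]
    show "map_mat (specialize lam) (submatrix (symbolic_pencil G k) R C) $$ (i, j) = mat (card R) (card C) (\<lambda>(i, j).
      [:full_aux G lam k $$ (pick R i, pick C j), - full_aux G lam 0 $$ (pick R i, pick C j):]) $$ (i, j)"
      using ij sets sp by (simp add: submatrix_def)
  qed (simp_all add: submatrix_def sets)
  then show ?thesis
    using comm_ring_hom.hom_det[OF comm_ring_hom_specialize, of lam "submatrix (symbolic_pencil G k) R C"] by simp
qed

lemma minor_poly_rational:
  assumes k: "k \<le> nstates G"
    and lam: "lam \<in> \<rat>"
    and rat: "\<forall>l\<in>{1..nstates G}. \<forall>i<num_rows G l. \<forall>j<num_cols G l.
            stage_payoff G l i j \<in> \<rat> \<and> (\<forall>l'\<in>{1..nstates G}. pmf (trans_law G l i j) l' \<in> \<rat>)"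
    and P: "P \<in> minor_polys G lam I J k"
  shows "\<exists>p. specialize lam P = map_poly of_rat p"
proof -
  let ?n = "nstates G"
  let ?rs = "map (num_rows G) [1..<Suc ?n]" and ?cs = "map (num_cols G) [1..<Suc ?n]"
  obtain R C where R: "R \<subseteq> {..<dim_row (symbolic_pencil G k)}" and C: "C \<subseteq> {..<dim_col (symbolic_pencil G k)}"
    and RC: "card R = card C" and PRC: "P = det (submatrix (symbolic_pencil G k) R C)"
    using P unfolding minor_polys_def by blast
  have q: "comm_ring_hom (of_rat :: rat \<Rightarrow> real)" by unfold_locales (auto simp: of_rat_add of_rat_mult)
  interpret m: map_poly_comm_ring_hom "of_rat :: rat \<Rightarrow> real" ..
  have m: "comm_ring_hom (map_poly (of_rat :: rat \<Rightarrow> real))" by (rule m.comm_ring_hom_axioms)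
  have data: "data_array (\<lambda>a. a) lam G (Suc s) t $$ (i, j) \<in> \<rat>"
    if "s < ?n" "t \<le> ?n" "i < num_rows G (Suc s)" "j < num_cols G (Suc s)" for s t i j
    using that rat lam by (auto simp: data_array_def intro!: Rats_mult Rats_diff)
  have full: "full_aux G lam l $$ (i, j) \<in> range of_rat"
    if l: "l \<le> ?n" and ij: "i < prod_list ?rs" "j < prod_list ?cs" for l i j
  proof -
    have "signed_minor ?n (\<lambda>s t. data_array (\<lambda>a. a) lam G (Suc s) t $$ (digits ?rs i ! s, digits ?cs j ! s)) l \<in> \<rat>"
      unfolding signed_minor_def
    proof (rule Rats_mult)
      have "det (mat ?n ?n (\<lambda>(s, t). data_array (\<lambda>a. a) lam G (Suc s) (if t < l then t else Suc t) $$
          (digits ?rs i ! s, digits ?cs j ! s))) \<in> range of_rat"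
      proof (rule comm_ring_hom.det_in_range_hom[OF q])
        fix s t assume st: "s < ?n" "t < ?n"
        have "data_array (\<lambda>a. a) lam G (Suc s) (if t < l then t else Suc t) $$ (digits ?rs i ! s, digits ?cs j ! s) \<in> \<rat>"
          using st digits_upt_less[OF ij(1) st(1)] digits_upt_less[OF ij(2) st(1)] by (intro data) auto
        then show "mat ?n ?n (\<lambda>(s, t). data_array (\<lambda>a. a) lam G (Suc s) (if t < l then t else Suc t) $$
          (digits ?rs i ! s, digits ?cs j ! s)) $$ (s, t) \<in> range of_rat"
          using st by (simp add: Rats_def del: upt_Suc)
      qed simp
      then show "det (mat ?n ?n (\<lambda>(s, t). data_array (\<lambda>a. a) lam G (Suc s) (if t < l then t else Suc t) $$
          (digits ?rs i ! s, digits ?cs j ! s))) \<in> \<rat>" by (simp add: Rats_def)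
    qed simp
    then show ?thesis using ij by (simp add: full_aux_entries[OF l] Rats_def del: upt_Suc)
  qed
  have "specialize lam P \<in> range (map_poly of_rat)"
    unfolding PRC specialize_det_symbolic_minor[OF k R C] RC
  proof (rule comm_ring_hom.det_in_range_hom[OF m mat_carrier])
    fix i j assume ij: "i < card C" "j < card C"
    have "pick R i < prod_list ?rs" "pick C j < prod_list ?cs"
      using pick_in_set_le[of i R] pick_in_set_le[of j C] ij RC R C
      unfolding dim_symbolic_pencil[of G k] by auto
    then obtain a b where "full_aux G lam k $$ (pick R i, pick C j) = of_rat a"
      "full_aux G lam 0 $$ (pick R i, pick C j) = of_rat b"
      using full[OF k] full[of 0] by blast
    then have "[:full_aux G lam k $$ (pick R i, pick C j), - full_aux G lam 0 $$ (pick R i, pick C j):] =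
        map_poly of_rat [:a, - b:]"
      by (intro poly_eqI) (simp add: coeff_map_poly coeff_pCons of_rat_minus split: nat.split)
    then show "mat (card C) (card C) (\<lambda>(i, j).
      [:full_aux G lam k $$ (pick R i, pick C j), - full_aux G lam 0 $$ (pick R i, pick C j):]) $$ (i, j) \<in> range (map_poly of_rat)"
      using ij by simp
  qed
  then show ?thesis by auto
qed


lemma reduced_array_carrier:
  assumes "I k \<subseteq> {..<num_rows G k}" "J k \<subseteq> {..<num_cols G k}"
  shows "reduced_array I J (data_array emb lam G) k l \<in> carrier_mat (card (I k)) (card (J k))"
    and "a < card (I k) \<Longrightarrow> b < card (J k) \<Longrightarrow>
      reduced_array I J (data_array emb lam G) k l $$ (a, b) = data_array emb lam G k l $$ (pick (I k) a, pick (J k) b)"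
proof -
  have "{i. i < num_rows G k \<and> i \<in> I k} = I k" "{i. i < num_cols G k \<and> i \<in> J k} = J k"
    using assms by auto
  moreover have "dim_row (data_array emb lam G k l) = num_rows G k" "dim_col (data_array emb lam G k l) = num_cols G k"
    by (simp_all add: data_array_def)
  ultimately show "reduced_array I J (data_array emb lam G) k l \<in> carrier_mat (card (I k)) (card (J k))"
    "a < card (I k) \<Longrightarrow> b < card (J k) \<Longrightarrow>
      reduced_array I J (data_array emb lam G) k l $$ (a, b) = data_array emb lam G k l $$ (pick (I k) a, pick (J k) b)"
    by (simp_all add: reduced_array_def submatrix_def)
qed

lemma reduced_aux_entry:
  assumes IJ: "\<And>l. l \<in> {1..nstates G} \<Longrightarrow> I l \<subseteq> {..<num_rows G l} \<and> J l \<subseteq> {..<num_cols G l}"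
    and l: "l \<le> nstates G"
    and i: "i < prod_list (map (\<lambda>k. card (I k)) [1..<Suc (nstates G)])"
    and j: "j < prod_list (map (\<lambda>k. card (J k)) [1..<Suc (nstates G)])"
  shows "reduced_aux G lam I J l $$ (i, j) = full_aux G lam l $$
     (embed_index (map (\<lambda>k. (I k, num_rows G k)) [1..<Suc (nstates G)]) i,
      embed_index (map (\<lambda>k. (J k, num_cols G k)) [1..<Suc (nstates G)]) j)"
proof -
  let ?n = "nstates G"
  let ?ps = "map (\<lambda>k. (I k, num_rows G k)) [1..<Suc ?n]" and ?qs = "map (\<lambda>k. (J k, num_cols G k)) [1..<Suc ?n]"
  let ?is = "map (\<lambda>k. card (I k)) [1..<Suc ?n]" and ?js = "map (\<lambda>k. card (J k)) [1..<Suc ?n]"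
  let ?rs = "map (num_rows G) [1..<Suc ?n]" and ?cs = "map (num_cols G) [1..<Suc ?n]"
  have cards: "map (\<lambda>p. card (fst p)) ?ps = ?is" "map (\<lambda>p. card (fst p)) ?qs = ?js"
    and dims: "map snd ?ps = ?rs" "map snd ?qs = ?cs"
    by (simp_all add: comp_def del: upt_Suc)
  have sub: "\<forall>p\<in>set ?ps. fst p \<subseteq> {..<snd p}" "\<forall>p\<in>set ?qs. fst p \<subseteq> {..<snd p}"
    using IJ by (auto simp del: upt_Suc)
  note ei = embed_index_bound_digits[OF sub(1), unfolded cards dims, OF i] and ej = embed_index_bound_digits[OF sub(2), unfolded cards dims, OF j]
  have red: "reduced_array I J (data_array (\<lambda>a. a) lam G) k t \<in> carrier_mat (card (I k)) (card (J k))"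
    if "k \<in> {1..?n}" for k t
    using IJ[OF that] by (intro reduced_array_carrier(1)) auto
  have "reduced_aux G lam I J l $$ (i, j) = signed_minor ?n (\<lambda>s t.
      reduced_array I J (data_array (\<lambda>a. a) lam G) (Suc s) t $$ (digits ?is i ! s, digits ?js j ! s)) l"
    unfolding reduced_aux_def using i j
    by (subst aux_mat_entries[OF red l]) (simp_all del: upt_Suc)
  also have "\<dots> = signed_minor ?n (\<lambda>s t. data_array (\<lambda>a. a) lam G (Suc s) t $$
      (digits ?rs (embed_index ?ps i) ! s, digits ?cs (embed_index ?qs j) ! s)) l"
  proof (rule signed_minor_cong)
    fix s t assume s: "s < ?n"
    have "digits ?rs (embed_index ?ps i) ! s = pick (I (Suc s)) (digits ?is i ! s)"
      "digits ?cs (embed_index ?qs j) ! s = pick (J (Suc s)) (digits ?js j ! s)"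
      using ei(2)[of s] ej(2)[of s] s by (simp_all del: upt_Suc)
    then show "reduced_array I J (data_array (\<lambda>a. a) lam G) (Suc s) t $$ (digits ?is i ! s, digits ?js j ! s) =
      data_array (\<lambda>a. a) lam G (Suc s) t $$ (digits ?rs (embed_index ?ps i) ! s, digits ?cs (embed_index ?qs j) ! s)"
      using reduced_array_carrier(2)[of I "Suc s" G J] IJ[of "Suc s"] s digits_upt_less[OF i s] digits_upt_less[OF j s]
      by simp
  qed
  also have "\<dots> = full_aux G lam l $$ (embed_index ?ps i, embed_index ?qs j)"
    using ei(1) ej(1) by (simp add: full_aux_entries[OF l] del: upt_Suc)
  finally show ?thesis .
qed

text \<open>The annihilating minor of the reduced pencil, moved to the full symbolic pencil by the increasing
  embeddings of row and column indices.\<close>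

lemma annihilating_symbolic_minor:
  assumes IJ: "\<And>l. l \<in> {1..nstates G} \<Longrightarrow> I l \<subseteq> {..<num_rows G l} \<and> J l \<subseteq> {..<num_cols G l} \<and> card (I l) = card (J l)"
    and k: "k \<le> nstates G"
    and bp: "balanced_pencil m (reduced_aux G lam I J k) (reduced_aux G lam I J 0) x y v \<epsilon>"
    and m: "m = prod_list (map (\<lambda>k. card (I k)) [1..<Suc (nstates G)])"
  shows "\<exists>P\<in>minor_polys G lam I J k. poly (specialize lam P) v = 0"
proof -
  interpret balanced_pencil m "reduced_aux G lam I J k" "reduced_aux G lam I J 0" x y v \<epsilon> by (rule bp)
  let ?n = "nstates G"
  let ?ps = "map (\<lambda>k. (I k, num_rows G k)) [1..<Suc ?n]" and ?qs = "map (\<lambda>k. (J k, num_cols G k)) [1..<Suc ?n]"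
  let ?rs = "map (num_rows G) [1..<Suc ?n]" and ?cs = "map (num_cols G) [1..<Suc ?n]"
  let ?\<phi> = "embed_index ?ps" and ?\<psi> = "embed_index ?qs"
  have mJ: "m = prod_list (map (\<lambda>k. card (J k)) [1..<Suc ?n])"
    unfolding m using IJ by (intro arg_cong[of _ _ prod_list] map_cong) auto
  have cards: "prod_list (map (\<lambda>p. card (fst p)) ?ps) = m" "prod_list (map (\<lambda>p. card (fst p)) ?qs) = m"
    and dims: "map snd ?ps = ?rs" "map snd ?qs = ?cs"
    using m mJ by (simp_all add: comp_def del: upt_Suc)
  have sub: "\<forall>p\<in>set ?ps. fst p \<subseteq> {..<snd p}" "\<forall>p\<in>set ?qs. fst p \<subseteq> {..<snd p}"
    using IJ by (auto simp del: upt_Suc)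
  obtain R C where RC: "R \<noteq> {}" "R \<subseteq> {..<m}" "C \<subseteq> {..<m}" "card R = card C"
    and q: "det (submatrix poly_pencil R C) \<noteq> 0" "poly (det (submatrix poly_pencil R C)) v = 0"
      "degree (det (submatrix poly_pencil R C)) \<le> vec_space.rank m (reduced_aux G lam I J 0)"
    using annihilating_minor by blast
  define F where "F = mat (prod_list ?rs) (prod_list ?cs) (\<lambda>(i, j). [:full_aux G lam k $$ (i, j), - full_aux G lam 0 $$ (i, j):])"
  have F: "F \<in> carrier_mat (prod_list ?rs) (prod_list ?cs)" by (simp add: F_def)
  have P: "poly_pencil \<in> carrier_mat m m" by (simp add: poly_pencil_def)
  have \<phi>: "i < i' \<Longrightarrow> i' < m \<Longrightarrow> ?\<phi> i < ?\<phi> i'" "i < m \<Longrightarrow> ?\<phi> i < prod_list ?rs" for i i'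
    using embed_index_mono[OF sub(1)] embed_index_bound_digits(1)[OF sub(1)] unfolding cards dims by blast+
  have \<psi>: "i < i' \<Longrightarrow> i' < m \<Longrightarrow> ?\<psi> i < ?\<psi> i'" "i < m \<Longrightarrow> ?\<psi> i < prod_list ?cs" for i i'
    using embed_index_mono[OF sub(2)] embed_index_bound_digits(1)[OF sub(2)] unfolding cards dims by blast+
  have ent: "poly_pencil $$ (i, j) = F $$ (?\<phi> i, ?\<psi> j)" if "i < m" "j < m" for i j
  proof -
    have "reduced_aux G lam I J l $$ (i, j) = full_aux G lam l $$ (?\<phi> i, ?\<psi> j)" if l: "l \<le> ?n" for l
      using IJ \<open>i < m\<close> \<open>j < m\<close> by (intro reduced_aux_entry l, unfold m[symmetric] mJ[symmetric]) auto
    from this[OF k] this[of 0] show ?thesis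
      unfolding poly_pencil_def F_def index_mat(1)[OF that] index_mat(1)[OF \<phi>(2)[OF that(1)] \<psi>(2)[OF that(2)]]
      by simp
  qed
  have sm: "submatrix poly_pencil R C = submatrix F (?\<phi> ` R) (?\<psi> ` C)"
    "card (?\<phi> ` R) = card R" "card (?\<psi> ` C) = card C"
  proof -
    note reindex = submatrix_reindex[OF F P, where \<phi> = ?\<phi> and \<psi> = ?\<psi> and R = R and C = C]
    show "submatrix poly_pencil R C = submatrix F (?\<phi> ` R) (?\<psi> ` C)"
      by (rule reindex(1)) (rule \<phi> \<psi> ent RC(2) RC(3) | assumption)+
    show "card (?\<phi> ` R) = card R"
      by (rule reindex(2)) (rule \<phi> \<psi> ent RC(2) RC(3) | assumption)+
    show "card (?\<psi> ` C) = card C"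
      by (rule reindex(3)) (rule \<phi> \<psi> ent RC(2) RC(3) | assumption)+
  qed
  have R': "?\<phi> ` R \<subseteq> {..<dim_row (symbolic_pencil G k)}" and C': "?\<psi> ` C \<subseteq> {..<dim_col (symbolic_pencil G k)}"
    using RC \<phi>(2) \<psi>(2) unfolding dim_symbolic_pencil by auto
  have sets: "{i. i < prod_list ?rs \<and> i \<in> ?\<phi> ` R} = ?\<phi> ` R" "{i. i < prod_list ?cs \<and> i \<in> ?\<psi> ` C} = ?\<psi> ` C"
    using R' C' unfolding dim_symbolic_pencil by auto
  have "submatrix F (?\<phi> ` R) (?\<psi> ` C) = mat (card (?\<phi> ` R)) (card (?\<psi> ` C)) (\<lambda>(i, j).
      [:full_aux G lam k $$ (pick (?\<phi> ` R) i, pick (?\<psi> ` C) j), - full_aux G lam 0 $$ (pick (?\<phi> ` R) i, pick (?\<psi> ` C) j):])"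
  proof (rule eq_matI, goal_cases)
    case (1 i j)
    then have ij: "i < card (?\<phi> ` R)" "j < card (?\<psi> ` C)" by auto
    have "pick (?\<phi> ` R) i < prod_list ?rs" "pick (?\<psi> ` C) j < prod_list ?cs"
      using pick_in_set_le[OF ij(1)] pick_in_set_le[OF ij(2)] R' C' unfolding dim_symbolic_pencil by auto
    then show ?case using ij F sets by (simp add: submatrix_def F_def del: upt_Suc)
  qed (use F sets in \<open>simp_all add: submatrix_def del: upt_Suc\<close>)
  then have eq: "specialize lam (det (submatrix (symbolic_pencil G k) (?\<phi> ` R) (?\<psi> ` C))) = det (submatrix poly_pencil R C)"
    using specialize_det_symbolic_minor[OF k R' C', of lam] sm(1) by simp
  have rk: "mat_rank (reduced_aux G lam I J 0) = vec_space.rank m (reduced_aux G lam I J 0)"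
    using B by (simp add: mat_rank_def)
  have "det (submatrix (symbolic_pencil G k) (?\<phi> ` R) (?\<psi> ` C)) \<in> minor_polys G lam I J k"
    unfolding minor_polys_def mem_Collect_eq eq rk
  proof (rule conjI, rule exI[of _ "?\<phi> ` R"], rule exI[of _ "?\<psi> ` C"], intro conjI)
    show "?\<phi> ` R \<noteq> {}" using RC(1) by blast
    show "card (?\<phi> ` R) = card (?\<psi> ` C)" using sm RC(4) by simp
  qed (rule R' C' refl q conjI)+
  then show ?thesis using eq q(2) by metis
qed

text \<open>The combination of the matrices of row \<open>l\<close> with coefficients \<open>1, v\<^sup>1, \<dots>, v\<^sup>n\<close> is the kernel of the
  local game minus the constant \<open>v\<^sup>l\<close>, because \<open>M\<^sup>l\<^sub>l\<close> contains the summand \<open>- U\<close>. The kernel strategies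
  annihilate it since the value of the local game is \<open>v\<^sup>l\<close>.\<close>

lemma balanced_pencil_reduced_aux:
  assumes game: "stochastic_game G" and lam: "0 < lam" "lam \<le> 1" and k: "k \<in> {1..nstates G}"
    and kernels: "\<forall>l\<in>{1..nstates G}.
      shapley_snow_kernel (local_game G lam (discounted_value G lam) l) (I l) (J l)"
  shows "\<exists>x y. balanced_pencil (prod_list (map (\<lambda>k. card (I k)) [1..<Suc (nstates G)]))
    (reduced_aux G lam I J k) (reduced_aux G lam I J 0) x y (discounted_value G lam k) ((-1) ^ nstates G)"
proof -
  let ?n = "nstates G" and ?V = "discounted_value G lam"
  let ?L = "local_game G lam ?V"
  let ?D = "reduced_array I J (data_array (\<lambda>a. a) lam G)"
  have dimL: "dim_row (?L l) = num_rows G l" "dim_col (?L l) = num_cols G l" for l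
    by (simp_all add: local_game_def)
  define optimal where "optimal l x y \<longleftrightarrow>
     I l \<subseteq> {..<num_rows G l} \<and> J l \<subseteq> {..<num_cols G l} \<and> card (I l) = card (J l) \<and>
     x \<in> mixed (card (I l)) \<and> y \<in> mixed (card (I l)) \<and>
     (\<forall>b<card (I l). (\<Sum>a<card (I l). x $ a * ?L l $$ (pick (I l) a, pick (J l) b)) = ?V l) \<and>
     (\<forall>a<card (I l). (\<Sum>b<card (I l). ?L l $$ (pick (I l) a, pick (J l) b) * y $ b) = ?V l)" for l x y
  have "\<exists>x y. optimal l x y" if l: "l \<in> {1..?n}" for l
  proof -
    have val: "game_val (?L l) = ?V l" using discounted_value_fixed_point[OF game lam l] by simp
    show ?thesis
    proof (rule shapley_snow_kernelE[OF bspec[OF kernels l]], unfold val dimL)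
      fix x y
      assume *: "I l \<subseteq> {..<num_rows G l}" "J l \<subseteq> {..<num_cols G l}" "card (I l) = card (J l)"
        "x \<in> mixed (card (I l))" "y \<in> mixed (card (I l))"
        "\<And>b. b < card (I l) \<Longrightarrow> (\<Sum>a<card (I l). x $ a * ?L l $$ (pick (I l) a, pick (J l) b)) = ?V l"
        "\<And>a. a < card (I l) \<Longrightarrow> (\<Sum>b<card (I l). ?L l $$ (pick (I l) a, pick (J l) b) * y $ b) = ?V l"
      show ?thesis unfolding optimal_def by (intro exI[of _ x] exI[of _ y] conjI allI impI *)
    qed
  qed
  then obtain x y where xy: "\<And>l. l \<in> {1..?n} \<Longrightarrow> optimal l (x l) (y l)" by metis
  have IJ: "I l \<subseteq> {..<num_rows G l}" "J l \<subseteq> {..<num_cols G l}" "card (I l) = card (J l)"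
    and x: "x l \<in> mixed (card (I l))" and y: "y l \<in> mixed (card (I l))"
    and xL: "b < card (I l) \<Longrightarrow> (\<Sum>a<card (I l). x l $ a * ?L l $$ (pick (I l) a, pick (J l) b)) = ?V l"
    and yL: "a < card (I l) \<Longrightarrow> (\<Sum>b<card (I l). ?L l $$ (pick (I l) a, pick (J l) b) * y l $ b) = ?V l"
    if "l \<in> {1..?n}" for l a b
    using xy[OF that] unfolding optimal_def by blast+
  have pI: "pick (I l) a < num_rows G l" if "l \<in> {1..?n}" "a < card (I l)" for l a
    using pick_in_set_le[OF that(2)] IJ(1)[OF that(1)] by auto
  have pJ: "pick (J l) a < num_cols G l" if "l \<in> {1..?n}" "a < card (I l)" for l a
    using pick_in_set_le[of a "J l"] that IJ(2,3)[OF that(1)] by auto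
  have D: "?D l t $$ (a, b) = data_array (\<lambda>a. a) lam G l t $$ (pick (I l) a, pick (J l) b)"
    if "l \<in> {1..?n}" "a < card (I l)" "b < card (I l)" for l t a b
    using reduced_array_carrier(2)[of I l G J] IJ that by simp
  define v where "v l = (if l = 0 then 1 else ?V l)" for l
  have comb: "(\<Sum>t\<le>?n. ?D l t $$ (a, b) * v t) = ?L l $$ (pick (I l) a, pick (J l) b) - ?V l"
    if l: "l \<in> {1..?n}" and ab: "a < card (I l)" "b < card (I l)" for l a b
  proof -
    let ?i = "pick (I l) a" and ?j = "pick (J l) b"
    have ij: "?i < num_rows G l" "?j < num_cols G l" using pI[OF l ab(1)] pJ[OF l ab(2)] .
    have "{..?n} = insert 0 {1..?n}" by auto
    then have "(\<Sum>t\<le>?n. ?D l t $$ (a, b) * v t) =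
        ?D l 0 $$ (a, b) * v 0 + (\<Sum>t\<in>{1..?n}. ?D l t $$ (a, b) * v t)" by simp
    also have "\<dots> = lam * stage_payoff G l ?i ?j +
        (\<Sum>t\<in>{1..?n}. ((1 - lam) * pmf (trans_law G l ?i ?j) t - (if t = l then 1 else 0)) * ?V t)"
      by (intro arg_cong2[of _ _ _ _ "(+)"] sum.cong refl) (use ij in \<open>auto simp: D[OF l ab] data_array_def v_def\<close>)
    also have "(\<Sum>t\<in>{1..?n}. ((1 - lam) * pmf (trans_law G l ?i ?j) t - (if t = l then 1 else 0)) * ?V t) =
        (\<Sum>t\<in>{1..?n}. (1 - lam) * (pmf (trans_law G l ?i ?j) t * ?V t)) - (\<Sum>t\<in>{1..?n}. if t = l then ?V t else 0)"
      unfolding sum_subtractf[symmetric] by (intro sum.cong refl) (simp add: algebra_simps)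
    also have "(\<Sum>t\<in>{1..?n}. if t = l then ?V t else 0) = ?V l" using l by simp
    finally show ?thesis using ij by (simp add: local_game_def sum_distrib_left)
  qed
  have "balanced_pencil (prod_list (map (\<lambda>k. card (I k)) [1..<Suc ?n])) (aux_mat ?n ?D k) (aux_mat ?n ?D 0)
    (vec (prod_list (map (\<lambda>k. card (I k)) [1..<Suc ?n])) (\<lambda>i. \<Prod>s<?n. x (Suc s) $ (digits (map (\<lambda>k. card (I k)) [1..<Suc ?n]) i ! s)))
    (vec (prod_list (map (\<lambda>k. card (I k)) [1..<Suc ?n])) (\<lambda>i. \<Prod>s<?n. y (Suc s) $ (digits (map (\<lambda>k. card (I k)) [1..<Suc ?n]) i ! s)))
    (v k) ((-1) ^ ?n)"
  proof (rule balanced_pencil_aux_mat)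
    fix l t assume l: "l \<in> {1..?n}"
    show "?D l t \<in> carrier_mat (card (I l)) (card (I l))"
      using reduced_array_carrier(1)[of I l G J] IJ l by simp
  next
    fix l b assume l: "l \<in> {1..?n}" and b: "b < card (I l)"
    have "(\<Sum>a<card (I l). x l $ a * (\<Sum>t\<le>?n. ?D l t $$ (a, b) * v t)) =
      (\<Sum>a<card (I l). x l $ a * ?L l $$ (pick (I l) a, pick (J l) b) - x l $ a * ?V l)"
      by (intro sum.cong refl) (subst comb[OF l _ b], simp_all add: algebra_simps)
    also have "\<dots> = (\<Sum>a<card (I l). x l $ a * ?L l $$ (pick (I l) a, pick (J l) b)) - (\<Sum>a<card (I l). x l $ a) * ?V l"
      by (simp add: sum_subtractf sum_distrib_right)
    finally show "(\<Sum>a<card (I l). x l $ a * (\<Sum>t\<le>?n. ?D l t $$ (a, b) * v t)) = 0"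
      using xL[OF l b] x[OF l] by (simp add: mixed_def)
  next
    fix l a assume l: "l \<in> {1..?n}" and a: "a < card (I l)"
    have "(\<Sum>b<card (I l). (\<Sum>t\<le>?n. ?D l t $$ (a, b) * v t) * y l $ b) =
      (\<Sum>b<card (I l). ?L l $$ (pick (I l) a, pick (J l) b) * y l $ b - y l $ b * ?V l)"
      by (intro sum.cong refl) (subst comb[OF l a], simp_all add: algebra_simps)
    also have "\<dots> = (\<Sum>b<card (I l). ?L l $$ (pick (I l) a, pick (J l) b) * y l $ b) - (\<Sum>b<card (I l). y l $ b) * ?V l"
      by (simp add: sum_subtractf sum_distrib_right)
    finally show "(\<Sum>b<card (I l). (\<Sum>t\<le>?n. ?D l t $$ (a, b) * v t) * y l $ b) = 0"
      using yL[OF l a] y[OF l] by (simp add: mixed_def)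
  next
    fix f g :: "nat \<Rightarrow> nat" assume fg: "\<And>l. l \<in> {1..?n} \<Longrightarrow> f l < card (I l) \<and> g l < card (I l)"
    let ?q = "\<lambda>s t. (1 - lam) * pmf (trans_law G (Suc s) (pick (I (Suc s)) (f (Suc s))) (pick (J (Suc s)) (g (Suc s)))) (Suc t)"
    show "0 < (-1) ^ ?n * signed_minor ?n (\<lambda>s t. ?D (Suc s) t $$ (f (Suc s), g (Suc s))) 0"
    proof (rule signed_minor_zero_substochastic[where Q = ?q])
      fix s t assume st: "s < ?n" "t < ?n"
      then have S: "Suc s \<in> {1..?n}" by simp
      show "?D (Suc s) (Suc t) $$ (f (Suc s), g (Suc s)) = ?q s t - (if s = t then 1 else 0)"
        using fg[OF S] pI[OF S] pJ[OF S] by (simp add: D[OF S] data_array_def)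
      show "0 \<le> ?q s t" using lam by simp
    next
      fix s assume "s < ?n"
      then have S: "Suc s \<in> {1..?n}" by simp
      have "(\<Sum>t<?n. ?q s t) = (1 - lam) * (\<Sum>l\<in>{1..?n}. pmf (trans_law G (Suc s) (pick (I (Suc s)) (f (Suc s))) (pick (J (Suc s)) (g (Suc s)))) l)"
        by (simp add: sum.atLeast1_atMost_eq sum_distrib_left)
      also have "\<dots> = 1 - lam"
        using sum_trans_law[OF game S pI[OF S] pJ[OF S]] fg[OF S] by simp
      finally show "(\<Sum>t<?n. ?q s t) < 1" using lam by simp
    qed
  qed (use x y k in \<open>auto simp: v_def\<close>)
  then show ?thesis using k by (auto simp: reduced_aux_def v_def)
qed

section \<open>Characterization of the discounted value\<close>

theorem mainTheorem1:
  fixes G :: stoch_game and lam :: real and k :: nat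
    and I J :: "nat \<Rightarrow> nat set"
  assumes game: "stochastic_game G"
    and lam: "0 < lam" "lam \<le> 1"
    and k: "k \<in> {1..nstates G}"
    and kernels: "\<forall>l\<in>{1..nstates G}.
      shapley_snow_kernel (local_game G lam (discounted_value G lam) l) (I l) (J l)"
  shows
    "(\<forall>w::real.
        game_val ((-1) ^ nstates G \<cdot>\<^sub>m (reduced_aux G lam I J k - w \<cdot>\<^sub>m reduced_aux G lam I J 0)) = 0
        \<longleftrightarrow> w = discounted_value G lam k)
     \<and> mat_rank (reduced_aux G lam I J k - discounted_value G lam k \<cdot>\<^sub>m reduced_aux G lam I J 0)
         < Max (range (\<lambda>w::real. mat_rank (reduced_aux G lam I J k - w \<cdot>\<^sub>m reduced_aux G lam I J 0)))
     \<and> (\<exists>P\<in>minor_polys G lam I J k. poly (specialize lam P) (discounted_value G lam k) = 0)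
     \<and> (lam \<in> \<rat> \<and>
         (\<forall>l\<in>{1..nstates G}. \<forall>i<num_rows G l. \<forall>j<num_cols G l.
            stage_payoff G l i j \<in> \<rat> \<and>
            (\<forall>l'\<in>{1..nstates G}. pmf (trans_law G l i j) l' \<in> \<rat>))
        \<longrightarrow> (\<exists>d \<le> mat_rank (reduced_aux G lam I J 0).
               algebraic_of_degree (discounted_value G lam k) d))"
proof -
  let ?A = "reduced_aux G lam I J k" and ?B = "reduced_aux G lam I J 0" and ?v = "discounted_value G lam k"
  let ?m = "prod_list (map (\<lambda>k. card (I k)) [1..<Suc (nstates G)])"
  obtain x y where bp: "balanced_pencil ?m ?A ?B x y ?v ((-1) ^ nstates G)"
    using balanced_pencil_reduced_aux[OF game lam k kernels] by blast
  interpret balanced_pencil ?m ?A ?B x y ?v "(-1) ^ nstates G" by (rule bp)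
  have IJ: "I l \<subseteq> {..<num_rows G l} \<and> J l \<subseteq> {..<num_cols G l} \<and> card (I l) = card (J l)"
    if "l \<in> {1..nstates G}" for l
    using bspec[OF kernels that] by (simp add: shapley_snow_kernel_def local_game_def)
  have rk: "mat_rank (?A - w \<cdot>\<^sub>m ?B) = vec_space.rank ?m (?A - w \<cdot>\<^sub>m ?B)" for w
    using B by (simp add: mat_rank_def)
  have i: "game_val ((-1) ^ nstates G \<cdot>\<^sub>m (?A - w \<cdot>\<^sub>m ?B)) = 0 \<longleftrightarrow> w = ?v" for w
    by (rule game_val_zero_iff)
  have ii: "mat_rank (?A - ?v \<cdot>\<^sub>m ?B) < Max (range (\<lambda>w. mat_rank (?A - w \<cdot>\<^sub>m ?B)))"
    unfolding rk by (rule rank_lt_Max)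
  have iii: "\<exists>P\<in>minor_polys G lam I J k. poly (specialize lam P) ?v = 0"
    using annihilating_symbolic_minor[OF IJ _ bp refl] k by simp
  have iv: "\<exists>d\<le>mat_rank ?B. algebraic_of_degree ?v d"
    if lamq: "lam \<in> \<rat>" and rat: "\<forall>l\<in>{1..nstates G}. \<forall>i<num_rows G l. \<forall>j<num_cols G l.
            stage_payoff G l i j \<in> \<rat> \<and> (\<forall>l'\<in>{1..nstates G}. pmf (trans_law G l i j) l' \<in> \<rat>)"
  proof -
    obtain P where P: "P \<in> minor_polys G lam I J k" "poly (specialize lam P) ?v = 0" using iii by blast
    obtain p where p: "specialize lam P = map_poly of_rat p"
      using minor_poly_rational[OF _ lamq rat P(1)] k by auto
    have "p \<noteq> 0" "degree p \<le> mat_rank ?B" using P(1) p by (auto simp: minor_polys_def)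
    then show ?thesis using algebraic_of_degree_le[of p ?v] P(2) p by fastforce
  qed
  show ?thesis using i ii iii iv by blast
qed

end
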